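(* Let $\gamma\in\mathbb{Q}\cap[0,1]$ and consider the log pair $(\mathbb{P}^2,B_\gamma)$ over $\mathbb{C}$, where $B_\gamma=\gamma\sum_{i=0}^3H_i$ with $H_i=V(z_i)$ for $i=1,2,3$ and $H_0=V(z_1+z_2+z_3)$. Let $S_4$ act on $\mathbb{P}^2$ by the projective automorphisms permuting the four lines $H_0,H_1,H_2,H_3$. Then $$\mathrm{glct}_{S_4}(\mathbb{P}^2,B_\gamma)\;\ge\;\begin{cases}\dfrac{1}{3-4\gamma}&\text{for }\gamma\le\frac12,\\[2mm]\dfrac{2(1-\gamma)}{3-4\gamma}&\text{for }\frac12\le\gamma\le\frac34,\\[2mm]\infty&\text{for }\gamma\ge\frac34,\end{cases}$$ where at $\gamma=\frac34$ the second expression is read as $\infty$.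
   Context: A log pair $(Y,D)$ consists of a normal variety $Y$ and a $\mathbb{Q}$-divisor $D$ whose irreducible components have coefficients in $[0,1]$. For a finite group $G$ acting on $Y$ and preserving $B$, the global $G$-equivariant log canonical threshold is $$\mathrm{glct}_G(Y,B):=\sup\{\lambda\;|\;(Y,B+\lambda D)\text{ is log canonical for all }D\in|-K_Y-B|_{\mathbb{Q}}^G\},$$ where $|-K_Y-B|_{\mathbb{Q}}^G$ is the set of $G$-invariant effective $\mathbb{Q}$-divisors $D$ with $D\sim_{\mathbb{Q}}-K_Y-B$ (if this set is empty, the supremum is $\infty$). Log canonicity has its usual meaning: on a log resolution $\pi:\tilde Y\to Y$, all coefficients of $\pi^*(K_Y+D)-K_{\tilde Y}$, written as a combination of strict transforms of components of $D$ and exceptional divisors, are at most $1$. *)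

theory Defs
  imports
    "HOL-Computational_Algebra.Computational_Algebra"
    "HOL-Combinatorics.Permutations"
    "HOL-Library.Extended_Real"
begin

text \<open>
  Varieties are treated as models in the sense of Zariski and Chevalley: a variety with function
  field \<open>K\<close> is identified with the set of its local rings, which are subrings of \<open>K\<close>. Under this
  identification a birational map that is the identity on \<open>K\<close> is a morphism \<open>X \<rightarrow> Y\<close> iff every
  local ring of \<open>X\<close> dominates a local ring of \<open>Y\<close>, a point \<open>R\<close> is a specialisation of \<open>S\<close> iff
  \<open>R \<subseteq> S\<close>, and a prime divisor of a normal variety is a local ring which is a discrete valuation
  ring, so that a prime divisor and its strict transform are the same subring of \<open>K\<close>.
  Here \<open>K = \<complex>(x, y)\<close> is the function field of the projective plane.
\<close>

section \<open>The function field\<close>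

type_synonym ratfun = "complex poly poly fract"

definition const :: "complex \<Rightarrow> ratfun" where
  "const c = Fract [:[:c:]:] 1"

definition fx :: ratfun where
  "fx = Fract [:[:0, 1:]:] 1"

definition fy :: ratfun where
  "fy = Fract [:0, 1:] 1"

text \<open>The extension of a derivation of an integral domain to the fraction field.\<close>

definition fract_deriv :: "('a::idom \<Rightarrow> 'a) \<Rightarrow> 'a fract \<Rightarrow> 'a fract" where
  "fract_deriv \<delta> f =
     (THE g. \<forall>p q. q \<noteq> 0 \<and> f = Fract p q \<longrightarrow> g = Fract (\<delta> p * q - p * \<delta> q) (q * q))"

lemma fract_deriv_Fract:
  fixes \<delta> :: "'a::idom \<Rightarrow> 'a"
  assumes leibniz: "\<And>a b. \<delta> (a * b) = \<delta> a * b + a * \<delta> b" and "q \<noteq> 0"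
  shows "fract_deriv \<delta> (Fract p q) = Fract (\<delta> p * q - p * \<delta> q) (q * q)"
  unfolding fract_deriv_def
proof (rule the_equality)
  show "\<forall>p' q'. q' \<noteq> 0 \<and> Fract p q = Fract p' q' \<longrightarrow>
      Fract (\<delta> p * q - p * \<delta> q) (q * q) = Fract (\<delta> p' * q' - p' * \<delta> q') (q' * q')"
  proof (intro allI impI, elim conjE)
    fix p' q' assume q': "q' \<noteq> 0" and "Fract p q = Fract p' q'"
    with \<open>q \<noteq> 0\<close> have e: "p * q' = p' * q" by (simp add: eq_fract)
    then have d: "\<delta> p * q' + p * \<delta> q' = \<delta> p' * q + p' * \<delta> q" by (metis leibniz)
    have "(\<delta> p * q - p * \<delta> q) * (q' * q') - (\<delta> p' * q' - p' * \<delta> q') * (q * q)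
        = q * q' * ((\<delta> p * q' + p * \<delta> q') - (\<delta> p' * q + p' * \<delta> q))
          - (p * q' - p' * q) * (q * \<delta> q' + q' * \<delta> q)"
      by (simp add: algebra_simps)
    then have "(\<delta> p * q - p * \<delta> q) * (q' * q') = (\<delta> p' * q' - p' * \<delta> q') * (q * q)"
      using e d by simp
    with q' \<open>q \<noteq> 0\<close> show "Fract (\<delta> p * q - p * \<delta> q) (q * q)
        = Fract (\<delta> p' * q' - p' * \<delta> q') (q' * q')"
      by (simp add: eq_fract)
  qed
qed (use \<open>q \<noteq> 0\<close> in blast)

definition dx :: "ratfun \<Rightarrow> ratfun" where
  "dx = fract_deriv (map_poly pderiv)"

definition dy :: "ratfun \<Rightarrow> ratfun" where
  "dy = fract_deriv pderiv"

text \<open>\<open>du \<and> dv = jacobian u v \<cdot> dx \<and> dy\<close> in the module of rational 2-forms.\<close>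

definition jacobian :: "ratfun \<Rightarrow> ratfun \<Rightarrow> ratfun" where
  "jacobian u v = dx u * dy v - dy u * dx v"


section \<open>Subrings of the function field\<close>

definition subalgebra :: "ratfun set \<Rightarrow> bool" where
  "subalgebra R \<longleftrightarrow> range const \<subseteq> R \<and> (\<forall>a\<in>R. \<forall>b\<in>R. a - b \<in> R \<and> a * b \<in> R)"

definition ideal_of :: "ratfun set \<Rightarrow> ratfun set \<Rightarrow> bool" where
  "ideal_of R I \<longleftrightarrow> I \<subseteq> R \<and> 0 \<in> I \<and> (\<forall>a\<in>I. \<forall>b\<in>I. a + b \<in> I) \<and> (\<forall>r\<in>R. \<forall>a\<in>I. r * a \<in> I)"

definition prime_ideal_of :: "ratfun set \<Rightarrow> ratfun set \<Rightarrow> bool" where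
  "prime_ideal_of R P \<longleftrightarrow>
     ideal_of R P \<and> P \<noteq> R \<and> (\<forall>a\<in>R. \<forall>b\<in>R. a * b \<in> P \<longrightarrow> a \<in> P \<or> b \<in> P)"

definition localization :: "ratfun set \<Rightarrow> ratfun set \<Rightarrow> ratfun set" where
  "localization R P = {a / b | a b. a \<in> R \<and> b \<in> R - P}"

definition units_of_ring :: "ratfun set \<Rightarrow> ratfun set" where
  "units_of_ring R = {a \<in> R. a \<noteq> 0 \<and> inverse a \<in> R}"

text \<open>The non-units; used for local rings only, where they form the maximal ideal.\<close>

definition maxideal :: "ratfun set \<Rightarrow> ratfun set" where
  "maxideal R = R - units_of_ring R"

definition dominates :: "ratfun set \<Rightarrow> ratfun set \<Rightarrow> bool" where
  "dominates S R \<longleftrightarrow> R \<subseteq> S \<and> maxideal S \<inter> R = maxideal R"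

definition valuation_ring :: "ratfun set \<Rightarrow> bool" where
  "valuation_ring V \<longleftrightarrow> subalgebra V \<and> (\<forall>f. f \<noteq> 0 \<longrightarrow> f \<in> V \<or> inverse f \<in> V)"

definition integrally_closed :: "ratfun set \<Rightarrow> bool" where
  "integrally_closed R \<longleftrightarrow>
     (\<forall>f p. lead_coeff p = 1 \<and> (\<forall>i. coeff p i \<in> R) \<and> poly p f = 0 \<longrightarrow> f \<in> R)"

definition uniformizer :: "ratfun set \<Rightarrow> ratfun \<Rightarrow> bool" where
  "uniformizer R t \<longleftrightarrow>
     t \<in> maxideal R \<and> t \<noteq> 0 \<and> (\<forall>f. f \<noteq> 0 \<longrightarrow> (\<exists>n. \<exists>u\<in>units_of_ring R. f = u * t powi n))"

definition is_dvr :: "ratfun set \<Rightarrow> bool" where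
  "is_dvr R \<longleftrightarrow> subalgebra R \<and> (\<exists>t. uniformizer R t)"

text \<open>Only meaningful for \<open>f \<noteq> 0\<close>.\<close>

definition ord_at :: "ratfun set \<Rightarrow> ratfun \<Rightarrow> int" where
  "ord_at R f = (THE n. \<exists>t. uniformizer R t \<and> (\<exists>u\<in>units_of_ring R. f = u * t powi n))"

definition has_krull_dim :: "ratfun set \<Rightarrow> nat \<Rightarrow> bool" where
  "has_krull_dim R n \<longleftrightarrow>
     (let chain = (\<lambda>n P. (\<forall>i\<le>n. prime_ideal_of R (P i)) \<and> (\<forall>i<n. P i \<subset> P (Suc i)))
      in (\<exists>P. chain n P) \<and> \<not> (\<exists>P. chain (Suc n) P))"

text \<open>A local ring that has a regular system of parameters is a regular local ring.\<close>

definition regular_parameters :: "ratfun set \<Rightarrow> ratfun list \<Rightarrow> bool" where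
  "regular_parameters R us \<longleftrightarrow>
     has_krull_dim R (length us) \<and> ideal_of R hull set us = maxideal R"


section \<open>Varieties and divisors\<close>

definition affine_algebra :: "ratfun set \<Rightarrow> bool" where
  "affine_algebra A \<longleftrightarrow>
     (\<exists>S. finite S \<and> A = subalgebra hull S) \<and> (\<forall>f. \<exists>a\<in>A. \<exists>b\<in>A - {0}. f = a / b)"

definition Spec :: "ratfun set \<Rightarrow> ratfun set set" where
  "Spec A = {localization A P | P. prime_ideal_of A P}"

text \<open>
  Separatedness is the valuative criterion: a valuation ring of \<open>K\<close> has at most one centre.
\<close>

definition variety :: "ratfun set set \<Rightarrow> bool" where
  "variety X \<longleftrightarrow>
     (\<exists>\<A>. finite \<A> \<and> \<A> \<noteq> {} \<and> (\<forall>A\<in>\<A>. affine_algebra A) \<and> X = (\<Union>A\<in>\<A>. Spec A)) \<and>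
     (\<forall>V. valuation_ring V \<longrightarrow>
        (\<forall>R\<in>X. \<forall>S\<in>X. dominates V R \<and> dominates V S \<longrightarrow> R = S))"

definition normal_variety :: "ratfun set set \<Rightarrow> bool" where
  "normal_variety X \<longleftrightarrow> variety X \<and> (\<forall>R\<in>X. integrally_closed R)"

definition prime_divisors :: "ratfun set set \<Rightarrow> ratfun set set" where
  "prime_divisors X = {E \<in> X. is_dvr E}"

type_synonym qdiv = "ratfun set \<Rightarrow> rat"

definition q_divisor :: "ratfun set set \<Rightarrow> qdiv \<Rightarrow> bool" where
  "q_divisor X D \<longleftrightarrow> finite {E. D E \<noteq> 0} \<and> {E. D E \<noteq> 0} \<subseteq> prime_divisors X"

definition q_lin_equiv :: "ratfun set set \<Rightarrow> qdiv \<Rightarrow> qdiv \<Rightarrow> bool" where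
  "q_lin_equiv X D D' \<longleftrightarrow>
     (\<exists>n::nat. \<exists>f. n > 0 \<and> f \<noteq> 0 \<and>
        (\<forall>E\<in>prime_divisors X. of_nat n * (D E - D' E) = of_int (ord_at E f)))"

text \<open>
  The divisor of the rational 2-form \<open>dx \<and> dy\<close>. At a prime divisor \<open>E\<close> the image of
  \<open>\<Omega>\<^sup>2\<close> of the discrete valuation ring \<open>E\<close> in the rational 2-forms is free of rank one over \<open>E\<close>
  and spanned by the forms \<open>du \<and> dv\<close> with \<open>u, v \<in> E\<close>; so it is generated by a form
  \<open>h \<cdot> dx \<and> dy\<close> with \<open>ord h\<close> the least order of a jacobian, and \<open>dx \<and> dy\<close> has order \<open>- ord h\<close>.
  The same form is used on all models, as is required when comparing \<open>K\<^sub>X\<close> with the pullback of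
  \<open>K\<^sub>Y\<close>.
\<close>

definition canonical_div :: "ratfun set set \<Rightarrow> qdiv" where
  "canonical_div X E =
     (if E \<in> prime_divisors X
      then - of_int (Inf {ord_at E (jacobian u v) | u v. u \<in> E \<and> v \<in> E \<and> jacobian u v \<noteq> 0})
      else 0)"

text \<open>\<open>f\<close> is an equation of \<open>n \<cdot> D\<close> in a neighbourhood of the point \<open>R\<close>.\<close>

definition local_equation :: "ratfun set set \<Rightarrow> qdiv \<Rightarrow> ratfun set \<Rightarrow> nat \<Rightarrow> ratfun \<Rightarrow> bool" where
  "local_equation Y D R n f \<longleftrightarrow>
     f \<noteq> 0 \<and> (\<forall>F\<in>prime_divisors Y. R \<subseteq> F \<longrightarrow> of_int (ord_at F f) = of_nat n * D F)"

definition q_cartier :: "ratfun set set \<Rightarrow> qdiv \<Rightarrow> bool" where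
  "q_cartier Y D \<longleftrightarrow> (\<exists>n>0. \<forall>R\<in>Y. \<exists>f. local_equation Y D R n f)"

text \<open>
  The coefficient at \<open>E\<close> of the pullback of a \<open>\<rat>\<close>-Cartier divisor \<open>D\<close> on \<open>Y\<close> to a variety over \<open>Y\<close>
  on which \<open>E\<close> is a prime divisor; \<open>R\<close> is the centre of \<open>E\<close> on \<open>Y\<close>.
\<close>

definition pullback_coeff :: "ratfun set set \<Rightarrow> qdiv \<Rightarrow> ratfun set \<Rightarrow> rat" where
  "pullback_coeff Y D E =
     (THE r. \<exists>R\<in>Y. dominates E R \<and>
        (\<exists>n f. n > 0 \<and> local_equation Y D R n f \<and> r = of_int (ord_at E f) / of_nat n))"


section \<open>Log canonical pairs\<close>

definition log_pair :: "ratfun set set \<Rightarrow> qdiv \<Rightarrow> bool" where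
  "log_pair Y D \<longleftrightarrow> normal_variety Y \<and> q_divisor Y D \<and> (\<forall>E. 0 \<le> D E \<and> D E \<le> 1)"

text \<open>Properness is expressed by the valuative criterion.\<close>

definition proper_birational :: "ratfun set set \<Rightarrow> ratfun set set \<Rightarrow> bool" where
  "proper_birational X Y \<longleftrightarrow>
     (\<forall>S\<in>X. \<exists>R\<in>Y. dominates S R) \<and>
     (\<forall>V. valuation_ring V \<and> (\<exists>R\<in>Y. dominates V R) \<longrightarrow> (\<exists>S\<in>X. dominates V S))"

definition exceptional_divisors :: "ratfun set set \<Rightarrow> ratfun set set \<Rightarrow> ratfun set set" where
  "exceptional_divisors X Y = prime_divisors X - Y"

text \<open>
  \<open>X\<close> is smooth and the reduced divisor with components \<open>C\<close> is a simple normal crossing divisor: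
  near every point the components through it are cut out by distinct members of a regular system
  of parameters.
\<close>

definition smooth_snc :: "ratfun set set \<Rightarrow> ratfun set set \<Rightarrow> bool" where
  "smooth_snc X C \<longleftrightarrow>
     (\<forall>R\<in>X. \<exists>us. regular_parameters R us \<and>
        (\<forall>E\<in>C. R \<subseteq> E \<longrightarrow> (\<exists>u\<in>set us. maxideal E \<inter> R = ideal_of R hull {u})))"

text \<open>
  The points of \<open>X\<close> outside the exceptional locus are those whose local ring is already a local
  ring of \<open>Y\<close>; the third condition says that the exceptional locus is a divisor.
\<close>

definition log_resolution :: "ratfun set set \<Rightarrow> ratfun set set \<Rightarrow> qdiv \<Rightarrow> bool" where
  "log_resolution X Y D \<longleftrightarrow>
     variety X \<and> proper_birational X Y \<and>
     (\<forall>R\<in>X - Y. \<exists>E\<in>exceptional_divisors X Y. R \<subseteq> E) \<and>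
     smooth_snc X (exceptional_divisors X Y \<union> {E. D E \<noteq> 0})"

text \<open>
  The condition on the coefficients does not depend on the log resolution; it is required for all
  of them, and for all prime divisors \<open>E\<close> of \<open>X\<close>, since the coefficient vanishes unless \<open>E\<close> is
  exceptional or the strict transform of a component of \<open>D\<close>.
\<close>

definition log_canonical :: "ratfun set set \<Rightarrow> qdiv \<Rightarrow> bool" where
  "log_canonical Y D \<longleftrightarrow>
     q_cartier Y (\<lambda>F. canonical_div Y F + D F) \<and>
     (\<forall>X. log_resolution X Y D \<longrightarrow>
        (\<forall>E\<in>prime_divisors X.
           pullback_coeff Y (\<lambda>F. canonical_div Y F + D F) E - canonical_div X E \<le> 1))"


section \<open>The equivariant log canonical threshold\<close>

text \<open>
  An automorphism of a variety is given by the induced automorphism of the function field, which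
  maps local rings to local rings.
\<close>

definition field_aut :: "(ratfun \<Rightarrow> ratfun) \<Rightarrow> bool" where
  "field_aut \<phi> \<longleftrightarrow> bij \<phi> \<and> (\<forall>a b. \<phi> (a + b) = \<phi> a + \<phi> b \<and> \<phi> (a * b) = \<phi> a * \<phi> b) \<and>
     (\<forall>c. \<phi> (const c) = const c)"

definition invariant_div :: "(ratfun \<Rightarrow> ratfun) set \<Rightarrow> ratfun set set \<Rightarrow> qdiv \<Rightarrow> bool" where
  "invariant_div G Y D \<longleftrightarrow> (\<forall>\<phi>\<in>G. \<forall>E\<in>prime_divisors Y. D (\<phi> ` E) = D E)"

definition anticanonical_system ::
  "(ratfun \<Rightarrow> ratfun) set \<Rightarrow> ratfun set set \<Rightarrow> qdiv \<Rightarrow> qdiv set" where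
  "anticanonical_system G Y B =
     {D. q_divisor Y D \<and> (\<forall>E. 0 \<le> D E) \<and> invariant_div G Y D \<and>
         q_lin_equiv Y D (\<lambda>F. - canonical_div Y F - B F)}"

definition glct :: "(ratfun \<Rightarrow> ratfun) set \<Rightarrow> ratfun set set \<Rightarrow> qdiv \<Rightarrow> ereal" where
  "glct G Y B =
     Sup {ereal (of_rat t) | t. \<forall>D\<in>anticanonical_system G Y B.
            log_pair Y (\<lambda>F. B F + t * D F) \<and> log_canonical Y (\<lambda>F. B F + t * D F)}"


section \<open>The projective plane, the four lines and the symmetric group\<close>

text \<open>
  Homogeneous coordinates are normalised by \<open>z\<^sub>3 = 1\<close>: only their ratios, and orders relative to
  the smallest order of \<open>z\<^sub>1, z\<^sub>2, z\<^sub>3\<close>, are used. The index \<open>0\<close> stands for the linear form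
  \<open>z\<^sub>1 + z\<^sub>2 + z\<^sub>3\<close>.
\<close>

definition coord :: "nat \<Rightarrow> ratfun" where
  "coord i = (if i = 1 then fx else if i = 2 then fy else if i = 3 then 1 else fx + fy + 1)"

definition P2 :: "ratfun set set" where
  "P2 = (\<Union>i\<in>{1, 2, 3}. Spec (subalgebra hull {coord j / coord i | j. j \<in> {1, 2, 3}}))"

text \<open>
  \<open>H\<^sub>i = V(z\<^sub>i)\<close> as the divisor of zeros of \<open>z\<^sub>i\<close>, a section of \<open>\<O>(1)\<close>, which at \<open>E\<close> is generated by
  the coordinate of least order.
\<close>

definition line :: "nat \<Rightarrow> qdiv" where
  "line i E =
     (if E \<in> prime_divisors P2
      then of_int (ord_at E (coord i) - Min ((\<lambda>j. ord_at E (coord j)) ` {1, 2, 3}))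
      else 0)"

definition boundary :: "rat \<Rightarrow> qdiv" where
  "boundary \<gamma> E = \<gamma> * (\<Sum>i\<in>{0..3}. line i E)"

text \<open>
  With the sign below the four linear forms have sum zero and this is their only linear relation.
  Hence each permutation of them is induced by a linear automorphism, and this is the only
  projective automorphism which permutes the four lines in that way, as these are in general
  position.
\<close>

definition frame :: "nat \<Rightarrow> ratfun" where
  "frame i = (if i = 0 then - coord 0 else coord i)"

definition S4 :: "(ratfun \<Rightarrow> ratfun) set" where
  "S4 = {\<phi>. field_aut \<phi> \<and>
            (\<exists>\<sigma>. \<sigma> permutes {0..3} \<and>
               (\<forall>i\<in>{0..3}. \<forall>j\<in>{0..3}. \<phi> (frame i / frame j) = frame (\<sigma> i) / frame (\<sigma> j)))}"

end

theory Submission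
  imports Defs "HOL-Computational_Algebra.Field_as_Ring"
begin

text \<open>
  Let \<open>v\<close> be the order along a divisor \<open>E\<close> over the plane and \<open>A\<close> its log discrepancy. Since
  \<open>df/f \<and> dg/g\<close> has at most a simple pole along \<open>E\<close>, one has \<open>v f + v g - v (f, g) \<le> A\<close>, where
  \<open>(f, g)\<close> is the jacobian in affine coordinates \<open>X, Y\<close> of a chart. Three consequences suffice.
  With \<open>f = X\<close>, \<open>g = Y\<close>: \<open>v X + v Y \<le> A\<close>, so the four lines are log canonical. With \<open>g\<close> a coordinate,
  iterated: \<open>v q \<le> e A\<close> for a polynomial \<open>q\<close> of degree at most \<open>e\<close>, as some iterated derivative of
  \<open>q\<close> is a nonzero constant. With \<open>g = X\<close>, iterated: \<open>v q \<le> e (A - v X)\<close> if \<open>X\<close> does not divide \<open>q\<close>.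

  By invariance, \<open>D\<close> contains the four lines with equal multiplicity, and at most two of the lines
  pass through the centre of \<open>E\<close>. If these are \<open>X = 0\<close> and \<open>Y = 0\<close>, a multiple of \<open>D\<close> has the
  equation \<open>X\<^sup>m Y\<^sup>m q\<close>, and the inequalities show that half the sum of the lines plus an invariant
  divisor of degree 1 is log canonical. This is the case \<open>\<gamma> = 1/2\<close>; smaller \<open>\<gamma>\<close> follow by
  monotonicity, and larger ones by convexity between \<open>\<gamma> = 1/2\<close> and \<open>\<gamma> = 1\<close>.
\<close>

section \<open>Derivations and the jacobian\<close>

text \<open>\<open>D\<close> has degree \<open>3 - 4 * \<gamma>\<close>, so \<open>t * D\<close> is
  \<open>\<delta> = t * (3 - 4 * \<gamma>)\<close> times a divisor of degree 1; this is the origin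
  of the denominators. Let \<open>s\<close> be the order along \<open>E\<close> of the sum of the
  four lines and \<open>V\<close> that of the degree 1 divisor. The estimates are
  \<open>0 \<le> s \<le> A\<close> and \<open>V + s/2 \<le> A\<close>, and
  \<open>\<gamma> s + \<delta> V \<le> A\<close> is wanted. If
  \<open>2 \<gamma> \<le> \<delta>\<close>, the left side is at most
  \<open>\<delta> (V + s/2)\<close>, so \<open>\<delta> \<le> 1\<close> suffices. Otherwise it is
  \<open>\<delta> (V + s/2) + (\<gamma> - \<delta>/2) s\<close>, which is at most
  \<open>(\<gamma> + \<delta>/2) A\<close>, so \<open>\<delta> \<le> 2 (1 - \<gamma>)\<close>
  suffices. These are the first two cases of the theorem.

  The obstacle is \<open>V + s/2 \<le> A\<close>: it fails when the degree 1 divisor is one of the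
  lines, which then has coefficient 3/2. Invariance under the transposition of two lines excludes
  this. All estimates hold for an arbitrary divisor over the plane, so no resolution has to be
  constructed.\<close>

definition derivation :: "(ratfun \<Rightarrow> ratfun) \<Rightarrow> bool" where
  "derivation \<delta> \<longleftrightarrow> (\<forall>a b. \<delta> (a + b) = \<delta> a + \<delta> b) \<and> (\<forall>a b. \<delta> (a * b) = \<delta> a * b + a * \<delta> b) \<and>
     (\<forall>c. \<delta> (const c) = 0)"

lemma const_0 [simp]: "const 0 = 0"
  by (simp add: const_def fract_collapse)

lemma const_1 [simp]: "const 1 = 1"
  by (simp add: const_def fract_collapse flip: one_pCons)

lemma const_add: "const (a + b) = const a + const b"
  by (simp add: const_def)

lemma const_mult: "const (a * b) = const a * const b"
  by (simp add: const_def)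

lemma const_minus: "const (- a) = - const a"
  by (simp add: const_def)

lemma const_eq_0_iff [simp]: "const c = 0 \<longleftrightarrow> c = 0"
  by (simp add: const_def Zero_fract_def eq_fract)

lemma inverse_const: "inverse (const c) = const (inverse c)"
proof (cases "c = 0")
  case False
  then have "const c * const (inverse c) = 1" by (simp flip: const_mult)
  with False show ?thesis by (metis inverse_unique)
qed simp

lemma of_int_eq_const: "of_int n = const (of_int n)"
proof (induction n rule: int_induct[where k = 0])
  case (step2 i)
  then show ?case by (simp add: const_add const_minus flip: add_uminus_conv_diff)
qed (simp_all add: const_add)

lemma map_poly_add_hom:
  assumes "f 0 = 0" "\<And>a b. f (a + b) = f a + f b"
  shows "map_poly f (p + q) = map_poly f p + map_poly f q"
  by (rule poly_eqI) (simp add: coeff_map_poly assms)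

lemma map_poly_pderiv_mult:
  fixes p q :: "complex poly poly"
  shows "map_poly pderiv (p * q) = map_poly pderiv p * q + p * map_poly pderiv q"
proof (induction p)
  case (pCons a p)
  have smult: "map_poly pderiv (smult a q) = smult (pderiv a) q + smult a (map_poly pderiv q)"
    by (rule poly_eqI) (simp add: coeff_map_poly pderiv_mult algebra_simps)
  show ?case
    by (simp add: mult_pCons_left map_poly_add_hom map_poly_pCons pderiv_add smult pCons.IH
        algebra_simps)
qed simp

lemma derivation_fract_deriv:
  assumes add: "\<And>a b. \<delta> (a + b) = \<delta> a + \<delta> b" and leibniz: "\<And>a b. \<delta> (a * b) = \<delta> a * b + a * \<delta> b"
    and c: "\<And>c. \<delta> [:[:c:]:] = 0"
  shows "derivation (fract_deriv \<delta>)"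
proof -
  have one: "\<delta> 1 = 0" using leibniz[of 1 1] by simp
  have "fract_deriv \<delta> (a + b) = fract_deriv \<delta> a + fract_deriv \<delta> b \<and>
      fract_deriv \<delta> (a * b) = fract_deriv \<delta> a * b + a * fract_deriv \<delta> b" for a b
  proof (cases a)
    case a: (Fract p q)
    then show ?thesis
    proof (cases b)
      case b: (Fract r s)
      show ?thesis using a b
        by (simp add: fract_deriv_Fract[of \<delta>, OF leibniz] add leibniz eq_fract)
          (simp add: algebra_simps)
    qed
  qed
  moreover have "fract_deriv \<delta> (const k) = 0" for k
    by (simp add: const_def fract_deriv_Fract[of \<delta>, OF leibniz] c one fract_collapse)
  ultimately show ?thesis unfolding derivation_def by blast
qed

lemma derivation_dx: "derivation dx"
  unfolding dx_def
  by (rule derivation_fract_deriv)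
    (simp_all add: map_poly_pderiv_mult map_poly_add_hom pderiv_add map_poly_pCons)

lemma derivation_dy: "derivation dy"
  unfolding dy_def by (rule derivation_fract_deriv) (simp_all add: pderiv_mult pderiv_add pderiv_pCons)

lemma dx_fx [simp]: "dx fx = 1"
  unfolding dx_def fx_def
  by (subst fract_deriv_Fract) (simp_all add: map_poly_pderiv_mult map_poly_pCons pderiv_pCons
      map_poly_1 fract_collapse flip: one_pCons)

lemma dx_fy [simp]: "dx fy = 0"
  unfolding dx_def fy_def
  by (subst fract_deriv_Fract) (simp_all add: map_poly_pderiv_mult map_poly_pCons map_poly_1
      fract_collapse)

lemma dy_fx [simp]: "dy fx = 0"
  unfolding dy_def fx_def
  by (subst fract_deriv_Fract) (simp_all add: pderiv_mult pderiv_pCons fract_collapse)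

lemma dy_fy [simp]: "dy fy = 1"
  unfolding dy_def fy_def
  by (subst fract_deriv_Fract) (simp_all add: pderiv_mult pderiv_pCons fract_collapse flip: one_pCons)

context
  fixes \<delta> assumes \<delta>: "derivation \<delta>"
begin

lemma derivation_add: "\<delta> (a + b) = \<delta> a + \<delta> b"
  using \<delta> by (simp add: derivation_def)

lemma derivation_mult: "\<delta> (a * b) = \<delta> a * b + a * \<delta> b"
  using \<delta> by (simp add: derivation_def)

lemma derivation_const: "\<delta> (const c) = 0"
  using \<delta> by (simp add: derivation_def)

lemma derivation_0: "\<delta> 0 = 0"
  using derivation_const[of 0] by simp

lemma derivation_1: "\<delta> 1 = 0"
  using derivation_const[of 1] by simp

lemma derivation_minus: "\<delta> (- a) = - \<delta> a"
  using derivation_add[of a "- a"] derivation_0 by (simp add: add_eq_0_iff)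

lemma derivation_diff: "\<delta> (a - b) = \<delta> a - \<delta> b"
  using derivation_add[of a "- b"] derivation_minus by simp

lemma derivation_inverse:
  assumes "a \<noteq> 0"
  shows "\<delta> (inverse a) = - \<delta> a / a\<^sup>2"
proof -
  have "\<delta> a * inverse a + a * \<delta> (inverse a) = 0"
    using derivation_mult[of a "inverse a"] derivation_1 assms by simp
  then show ?thesis using assms by (simp add: field_simps power2_eq_square add_eq_0_iff)
qed

lemma derivation_divide:
  assumes "b \<noteq> 0"
  shows "\<delta> (a / b) = (\<delta> a * b - a * \<delta> b) / b\<^sup>2"
  unfolding divide_inverse[of a b] derivation_mult derivation_inverse[OF assms]
  using assms by (simp add: field_simps power2_eq_square)

lemma derivation_power_int:
  assumes "a \<noteq> 0"
  shows "\<delta> (a powi n) = of_int n * a powi (n - 1) * \<delta> a"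
proof (induction n rule: int_induct[where k = 0])
  case (step1 i)
  define c where "c = a powi (i - 1)"
  have "a powi (i + 1) = c * a * a" "a powi i = c * a"
    using assms by (simp_all add: c_def power_int_add power_int_diff)
  with step1 show ?case by (simp add: derivation_mult algebra_simps flip: c_def)
next
  case (step2 i)
  define c where "c = a powi (i - 2)"
  have c: "a powi (i - 1) = c * a" "a powi i = c * a * a"
    using power_int_add[of a "i - 2" 1] power_int_add[of a "i - 2" 2] assms
    by (simp_all add: c_def power2_eq_square)
  have "i - 1 - 1 = i - 2" by simp
  have "\<delta> (c * a) * a + c * a * \<delta> a = of_int i * (c * a) * \<delta> a"
    using step2 by (simp add: c derivation_mult)
  then have "\<delta> (c * a) * a = (of_int (i - 1) * c * \<delta> a) * a" by (simp add: algebra_simps)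
  then show ?case using assms unfolding \<open>i - 1 - 1 = i - 2\<close> by (simp add: c flip: c_def)
qed (simp add: derivation_1)

end

lemma derivation_jacobian_left: "derivation (\<lambda>u. jacobian u w)"
  unfolding derivation_def jacobian_def
  by (auto simp: derivation_add[OF derivation_dx] derivation_add[OF derivation_dy]
      derivation_mult[OF derivation_dx] derivation_mult[OF derivation_dy]
      derivation_const[OF derivation_dx] derivation_const[OF derivation_dy] algebra_simps)

lemma jacobian_swap: "jacobian u w = - jacobian w u"
  unfolding jacobian_def by (simp add: algebra_simps)

lemma derivation_jacobian_right: "derivation (\<lambda>w. jacobian u w)"
  using derivation_jacobian_left[of u] unfolding derivation_def jacobian_swap[of u]
  by (simp add: algebra_simps)

lemma jacobian_same [simp]: "jacobian u u = 0"
  unfolding jacobian_def by (simp add: algebra_simps)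

text \<open>The numerator is the determinant of the values and first partial derivatives of
  \<open>h\<close>, \<open>f\<close>, \<open>g\<close>. For linear forms it is constant, so that
  only the cube of the denominator remains.\<close>

lemma jacobian_divide:
  assumes "h \<noteq> 0"
  shows "jacobian (f / h) (g / h) = (h * jacobian f g - f * jacobian h g - g * jacobian f h) / h ^ 3"
  using assms
  by (simp add: derivation_divide[OF derivation_jacobian_left] field_simps power2_eq_square
      derivation_divide[OF derivation_jacobian_right] power3_eq_cube)


section \<open>Evaluation of polynomials in two variables\<close>

text \<open>The coefficients, which are polynomials in the first variable, are evaluated at \<open>u\<close>.\<close>

definition hom_eval :: "('a::comm_ring_1 \<Rightarrow> ratfun) \<Rightarrow> ratfun \<Rightarrow> 'a poly \<Rightarrow> ratfun" where
  "hom_eval h w p = poly (map_poly h p) w"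

definition ev :: "ratfun \<Rightarrow> ratfun \<Rightarrow> complex poly poly \<Rightarrow> ratfun" where
  "ev u w = hom_eval (hom_eval const u) w"

lemma hom_eval_pCons:
  assumes "h 0 = 0"
  shows "hom_eval h w (pCons a p) = h a + w * hom_eval h w p"
  using assms by (simp add: hom_eval_def map_poly_pCons)

lemma hom_eval_add:
  assumes "h 0 = 0" "\<And>a b. h (a + b) = h a + h b"
  shows "hom_eval h w (p + q) = hom_eval h w p + hom_eval h w q"
  using assms by (simp add: hom_eval_def map_poly_add_hom)

lemma hom_eval_smult:
  assumes "h 0 = 0" "\<And>a b. h (a * b) = h a * h b"
  shows "hom_eval h w (smult a p) = h a * hom_eval h w p"
proof (induction p)
  case (pCons b p)
  then show ?case using assms by (simp add: hom_eval_pCons algebra_simps)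
qed (simp add: hom_eval_def)

lemma hom_eval_mult:
  assumes "h 0 = 0" "\<And>a b. h (a + b) = h a + h b" "\<And>a b. h (a * b) = h a * h b"
  shows "hom_eval h w (p * q) = hom_eval h w p * hom_eval h w q"
proof (induction p)
  case (pCons b p)
  then show ?case using assms
    by (simp add: hom_eval_pCons hom_eval_add hom_eval_smult algebra_simps)
qed (simp add: hom_eval_def)

lemma hom_eval_0 [simp]: "hom_eval h w 0 = 0"
  by (simp add: hom_eval_def)

lemma hom_eval_const_add: "hom_eval const u (p + q) = hom_eval const u p + hom_eval const u q"
  by (rule hom_eval_add) (simp_all add: const_add)

lemma hom_eval_const_mult: "hom_eval const u (p * q) = hom_eval const u p * hom_eval const u q"
  by (rule hom_eval_mult) (simp_all add: const_add const_mult)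

lemma ev_add: "ev u w (p + q) = ev u w p + ev u w q"
  unfolding ev_def by (rule hom_eval_add) (simp_all add: hom_eval_const_add)

lemma ev_mult: "ev u w (p * q) = ev u w p * ev u w q"
  unfolding ev_def by (rule hom_eval_mult) (simp_all add: hom_eval_const_add hom_eval_const_mult)

lemma ev_0 [simp]: "ev u w 0 = 0"
  unfolding ev_def by simp

lemma ev_pCons: "ev u w (pCons a p) = hom_eval const u a + w * ev u w p"
  unfolding ev_def by (simp add: hom_eval_pCons)

lemma ev_const [simp]: "ev u w [:[:c:]:] = const c"
  by (simp add: ev_pCons hom_eval_pCons)

lemma ev_1 [simp]: "ev u w 1 = 1"
  using ev_const[of u w 1] by (simp flip: one_pCons)

lemma ev_minus: "ev u w (- p) = - ev u w p"
  using ev_add[of u w p "- p"] by (simp add: add_eq_0_iff)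

lemma ev_diff: "ev u w (p - q) = ev u w p - ev u w q"
  using ev_add[of u w p "- q"] by (simp add: ev_minus)

lemma ev_power: "ev u w (p ^ n) = ev u w p ^ n"
  by (induction n) (simp_all add: ev_mult)

abbreviation polyX :: "complex poly poly" where "polyX \<equiv> [:[:0, 1:]:]"
abbreviation polyY :: "complex poly poly" where "polyY \<equiv> [:0, 1:]"

lemma ev_X [simp]: "ev u w polyX = u"
  by (simp add: ev_pCons hom_eval_pCons)

lemma ev_Y [simp]: "ev u w polyY = w"
  using ev_1[of u w] by (simp add: ev_pCons one_pCons)

lemma derivation_hom_eval_const:
  assumes "derivation \<delta>"
  shows "\<delta> (hom_eval const u p) = hom_eval const u (pderiv p) * \<delta> u"
proof (induction p)
  case (pCons a p)
  then show ?case
    by (simp add: hom_eval_pCons pderiv_pCons hom_eval_const_add derivation_add[OF assms]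
        derivation_mult[OF assms] derivation_const[OF assms] algebra_simps)
qed (simp add: derivation_0[OF assms])

abbreviation pdX :: "complex poly poly \<Rightarrow> complex poly poly" where "pdX \<equiv> map_poly pderiv"

lemma derivation_ev:
  assumes "derivation \<delta>"
  shows "\<delta> (ev u w p) = ev u w (pdX p) * \<delta> u + ev u w (pderiv p) * \<delta> w"
proof (induction p)
  case (pCons a p)
  then show ?case
    by (simp add: ev_pCons pderiv_pCons map_poly_pCons ev_add derivation_add[OF assms]
        derivation_mult[OF assms] derivation_hom_eval_const[OF assms] algebra_simps)
qed (simp add: derivation_0[OF assms])

lemma jacobian_ev_left:
  "jacobian (ev u w p) w = ev u w (pdX p) * jacobian u w"
  using derivation_ev[OF derivation_jacobian_left[of w], of u w p] by simp

lemma jacobian_ev_right: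
  "jacobian u (ev u w p) = ev u w (pderiv p) * jacobian u w"
  using derivation_ev[OF derivation_jacobian_right[of u], of u w p] by simp

lemma jacobian_ev:
  "jacobian (ev u w p) (ev u w q) = ev u w (pdX p * pderiv q - pderiv p * pdX q) * jacobian u w"
proof -
  have "jacobian (ev u w p) (ev u w q) =
      ev u w (pdX p) * jacobian u (ev u w q) + ev u w (pderiv p) * jacobian w (ev u w q)"
    by (rule derivation_ev[OF derivation_jacobian_left])
  moreover have "jacobian w (ev u w q) = - (ev u w (pdX q) * jacobian u w)"
    by (subst jacobian_swap) (simp only: jacobian_ev_left)
  ultimately show ?thesis by (simp add: jacobian_ev_right ev_diff ev_mult algebra_simps)
qed

section \<open>Total degree and algebraic independence\<close>

definition tdeg_le :: "complex poly poly \<Rightarrow> nat \<Rightarrow> bool" where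
  "tdeg_le p d \<longleftrightarrow> (\<forall>i j. coeff (coeff p i) j \<noteq> 0 \<longrightarrow> i + j \<le> d)"

lemma tdeg_le_pdX: "tdeg_le p (Suc d) \<Longrightarrow> tdeg_le (pdX p) d"
  unfolding tdeg_le_def by (fastforce simp: coeff_map_poly coeff_pderiv)

lemma tdeg_le_pderiv: "tdeg_le p (Suc d) \<Longrightarrow> tdeg_le (pderiv p) d"
  unfolding tdeg_le_def by (fastforce simp: coeff_pderiv of_nat_poly)

lemma tdeg_le_exists: "\<exists>d. tdeg_le p d"
proof -
  have "tdeg_le p (degree p + Max ((\<lambda>i. degree (coeff p i)) ` {..degree p}))"
    unfolding tdeg_le_def
  proof (intro allI impI)
    fix i j assume nz: "coeff (coeff p i) j \<noteq> 0"
    then have "i \<le> degree p" by (metis coeff_0 le_degree)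
    moreover have "j \<le> degree (coeff p i)" using nz by (rule le_degree)
    ultimately show "i + j \<le> degree p + Max ((\<lambda>i. degree (coeff p i)) ` {..degree p})"
      by (meson Max_ge add_mono atMost_iff finite_atMost finite_imageI image_eqI le_trans)
  qed
  then show ?thesis ..
qed

text \<open>Characteristic zero enters here: it lets a nonzero polynomial be differentiated until a
  nonzero constant is left.\<close>

lemma constant_poly_if_pd_0:
  assumes "pdX p = 0" "pderiv p = 0"
  obtains c where "p = [:[:c:]:]"
proof -
  obtain a where a: "p = [:a:]" using assms(2) by (auto dest: pderiv_iszero)
  with assms(1) have "pderiv a = 0" by (simp add: map_poly_pCons)
  then obtain c where "a = [:c:]" by (auto dest: pderiv_iszero)
  with a that show ?thesis by blast
qed

lemma tdeg_le_0:
  assumes "tdeg_le p 0"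
  shows "\<exists>c. p = [:[:c:]:]"
proof -
  have z: "coeff (coeff p i) j = 0" if "i + j > 0" for i j
    using assms that unfolding tdeg_le_def by force
  have "pdX p = 0" by (rule poly_eqI, rule poly_eqI) (simp add: coeff_map_poly coeff_pderiv z)
  moreover have "pderiv p = 0"
    by (rule poly_eqI, rule poly_eqI) (simp add: coeff_pderiv z of_nat_poly)
  ultimately show ?thesis by (rule constant_poly_if_pd_0) blast
qed

text \<open>Jacobian criterion. Differentiating a relation between \<open>u\<close> and
  \<open>w\<close> and cancelling the jacobian gives relations of smaller degree; by induction both
  partial derivatives vanish, and the relation is a constant.\<close>

lemma ev_eq_0_iff:
  assumes "jacobian u w \<noteq> 0"
  shows "ev u w p = 0 \<longleftrightarrow> p = 0"
proof
  obtain d where "tdeg_le p d" using tdeg_le_exists by blast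
  then show "ev u w p = 0 \<Longrightarrow> p = 0"
  proof (induction d arbitrary: p)
    case 0
    then show ?case using tdeg_le_0 by fastforce
  next
    case (Suc d)
    have "ev u w (pdX p) * jacobian u w = 0" "ev u w (pderiv p) * jacobian u w = 0"
      unfolding jacobian_ev_left[symmetric] jacobian_ev_right[symmetric] Suc.prems
      by (simp_all add: derivation_0[OF derivation_jacobian_left]
          derivation_0[OF derivation_jacobian_right])
    then have "pdX p = 0" "pderiv p = 0"
      using Suc tdeg_le_pdX tdeg_le_pderiv assms by auto
    then obtain c where "p = [:[:c:]:]" by (rule constant_poly_if_pd_0)
    with Suc.prems show ?case by simp
  qed
qed simp

lemma ev_eq_iff:
  assumes "jacobian u w \<noteq> 0"
  shows "ev u w p = ev u w q \<longleftrightarrow> p = q"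
  using ev_eq_0_iff[OF assms, of "p - q"] by (simp add: ev_diff)

section \<open>Subalgebras and discrete valuation rings\<close>

context
  fixes R assumes R: "subalgebra R"
begin

lemma subalgebra_const: "const c \<in> R"
  using R by (auto simp: subalgebra_def)

lemma subalgebra_0: "0 \<in> R"
  using subalgebra_const[of 0] by simp

lemma subalgebra_1: "1 \<in> R"
  using subalgebra_const[of 1] by simp

lemma subalgebra_diff: "a \<in> R \<Longrightarrow> b \<in> R \<Longrightarrow> a - b \<in> R"
  using R by (auto simp: subalgebra_def)

lemma subalgebra_mult: "a \<in> R \<Longrightarrow> b \<in> R \<Longrightarrow> a * b \<in> R"
  using R by (auto simp: subalgebra_def)

lemma subalgebra_minus: "a \<in> R \<Longrightarrow> - a \<in> R"
  using subalgebra_diff[of 0 a] subalgebra_0 by simp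

lemma subalgebra_add: "a \<in> R \<Longrightarrow> b \<in> R \<Longrightarrow> a + b \<in> R"
  using subalgebra_diff[of a "- b"] subalgebra_minus by simp

lemma subalgebra_power: "a \<in> R \<Longrightarrow> a ^ n \<in> R"
  by (induction n) (auto intro: subalgebra_1 subalgebra_mult)

lemma subalgebra_sum: "(\<And>i. i \<in> I \<Longrightarrow> f i \<in> R) \<Longrightarrow> sum f I \<in> R"
  by (induction I rule: infinite_finite_induct) (auto intro: subalgebra_0 subalgebra_add)

lemma subalgebra_ev:
  assumes "u \<in> R" "w \<in> R"
  shows "ev u w p \<in> R"
proof -
  have h: "hom_eval const u a \<in> R" for a
    by (induction a) (auto simp: hom_eval_pCons intro: subalgebra_0 subalgebra_add
        subalgebra_mult subalgebra_const assms)
  show ?thesis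
    by (induction p) (auto simp: ev_pCons intro: subalgebra_0 subalgebra_add subalgebra_mult h assms)
qed

lemma units_mult: "a \<in> units_of_ring R \<Longrightarrow> b \<in> units_of_ring R \<Longrightarrow> a * b \<in> units_of_ring R"
  by (auto simp: units_of_ring_def subalgebra_mult)

lemma units_inverse: "a \<in> units_of_ring R \<Longrightarrow> inverse a \<in> units_of_ring R"
  by (auto simp: units_of_ring_def)

lemma units_power: "a \<in> units_of_ring R \<Longrightarrow> a ^ n \<in> units_of_ring R"
  by (auto simp: units_of_ring_def subalgebra_power simp flip: power_inverse)

lemma units_power_int: "a \<in> units_of_ring R \<Longrightarrow> a powi n \<in> units_of_ring R"
  by (auto simp: power_int_def units_power units_inverse simp flip: power_inverse)

lemma units_const: "c \<noteq> 0 \<Longrightarrow> const c \<in> units_of_ring R"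
  by (auto simp: units_of_ring_def subalgebra_const inverse_const)

lemma units_1: "1 \<in> units_of_ring R"
  using units_const[of 1] by simp

end

lemma is_dvr_subalgebra: "is_dvr E \<Longrightarrow> subalgebra E"
  by (simp add: is_dvr_def)

lemma uniformizer_nonzero: "uniformizer E t \<Longrightarrow> t \<noteq> 0"
  by (simp add: uniformizer_def)

lemma uniformizer_inverse_notin:
  assumes "uniformizer E t"
  shows "t \<in> E" "inverse t \<notin> E"
  using assms by (auto simp: uniformizer_def maxideal_def units_of_ring_def)

lemma uniformizer_power_int_unit:
  assumes E: "subalgebra E" and t: "uniformizer E t" and "t powi n \<in> units_of_ring E"
  shows "n = 0"
proof (rule ccontr)
  assume "n \<noteq> 0"
  then obtain k where "nat \<bar>n\<bar> = Suc k" by (metis abs_zero not0_implies_Suc zero_less_abs_iff zero_less_nat_eq less_numeral_extra(3))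
  then have "t powi n = t ^ Suc k \<or> t powi n = inverse (t ^ Suc k)"
    by (auto simp: power_int_def abs_if power_inverse split: if_splits)
  then have "inverse (t ^ Suc k) \<in> E"
    using assms(3) by (elim disjE) (simp_all add: units_of_ring_def del: power_Suc)
  then have "t ^ k * inverse (t ^ Suc k) \<in> E"
    using E uniformizer_inverse_notin[OF t] by (intro subalgebra_mult subalgebra_power)
  moreover have "t ^ k * inverse (t ^ Suc k) = inverse t"
    using uniformizer_nonzero[OF t] by (simp add: field_simps)
  ultimately show False using uniformizer_inverse_notin[OF t] by metis
qed

text \<open>Writing \<open>t' = a * t powi m\<close> and \<open>t = b * t' powi l\<close> makes
  \<open>t powi (1 - m * l)\<close> a unit, so \<open>m * l = 1\<close>; and \<open>m = -1\<close>
  would put \<open>inverse t\<close> into \<open>E\<close>.\<close>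

lemma uniformizer_associated:
  assumes E: "subalgebra E" and t: "uniformizer E t" and t': "uniformizer E t'"
  obtains a where "a \<in> units_of_ring E" "t' = a * t"
proof -
  note nz = uniformizer_nonzero[OF t] uniformizer_nonzero[OF t']
  obtain m a where a: "a \<in> units_of_ring E" "t' = a * t powi m"
    using t t' nz unfolding uniformizer_def by metis
  obtain l b where b: "b \<in> units_of_ring E" "t = b * t' powi l"
    using t t' nz unfolding uniformizer_def by metis
  have "t = b * a powi l * t powi (m * l)"
    using b(2) unfolding a(2) by (simp add: power_int_mult_distrib power_int_mult mult.assoc)
  then have "t powi (1 - m * l) = b * a powi l"
    using nz by (simp add: power_int_diff field_simps)
  then have "1 - m * l = 0"
    using units_mult[OF E b(1) units_power_int[OF E a(1)]] uniformizer_power_int_unit[OF E t] by metis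
  then have "m = 1 \<or> m = -1"
    by (auto simp: zmult_eq_1_iff)
  moreover have "m \<noteq> -1"
  proof
    assume "m = -1"
    have "a \<noteq> 0" using a by (simp add: units_of_ring_def)
    then have "inverse t = inverse a * t'" using a \<open>m = -1\<close> nz by (simp add: field_simps)
    moreover have "inverse a * t' \<in> E"
      using a uniformizer_inverse_notin(1)[OF t'] E by (auto simp: units_of_ring_def subalgebra_mult)
    ultimately show False using uniformizer_inverse_notin[OF t] by simp
  qed
  ultimately have "m = 1" by blast
  with a that show ?thesis by simp
qed

text \<open>The exponent chosen by \<open>ord_at\<close> may refer to any uniformizer; it is unique
  because two uniformizers differ by a unit.\<close>

lemma ord_at_eqI:
  assumes E: "subalgebra E" and t: "uniformizer E t" and u: "u \<in> units_of_ring E"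
    and f: "f = u * t powi n"
  shows "ord_at E f = n"
  unfolding ord_at_def
proof (rule the_equality)
  fix n' assume "\<exists>t. uniformizer E t \<and> (\<exists>u\<in>units_of_ring E. f = u * t powi n')"
  then obtain t' u' where t': "uniformizer E t'" and u': "u' \<in> units_of_ring E"
    and f': "f = u' * t' powi n'" by blast
  obtain a where a: "a \<in> units_of_ring E" "t' = a * t"
    using uniformizer_associated[OF E t t'] .
  have "u \<noteq> 0" using u by (simp add: units_of_ring_def)
  moreover have "u * t powi n = u' * a powi n' * t powi n'"
    using f f' a(2) by (simp add: power_int_mult_distrib mult.assoc)
  ultimately have "t powi (n - n') = u' * a powi n' * inverse u"
    using uniformizer_nonzero[OF t] by (simp add: power_int_diff field_simps)
  moreover have "u' * a powi n' * inverse u \<in> units_of_ring E"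
    using E u u' a by (intro units_mult units_power_int units_inverse)
  ultimately show "n' = n" using uniformizer_power_int_unit[OF E t, of "n - n'"] by simp
qed (use t u f in blast)

context
  fixes E assumes E: "is_dvr E"
begin

lemma uniformizer_exists: obtains t where "uniformizer E t"
  using E by (auto simp: is_dvr_def)

lemma ord_at_decomp:
  assumes "uniformizer E t" "f \<noteq> 0"
  obtains u where "u \<in> units_of_ring E" "f = u * t powi ord_at E f"
proof -
  from assms obtain n u where "u \<in> units_of_ring E" "f = u * t powi n"
    unfolding uniformizer_def by metis
  with ord_at_eqI[OF is_dvr_subalgebra[OF E] assms(1)] that show ?thesis by metis
qed

lemma ord_at_mult:
  assumes "f \<noteq> 0" "g \<noteq> 0"
  shows "ord_at E (f * g) = ord_at E f + ord_at E g"
proof -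
  obtain t where t: "uniformizer E t" by (rule uniformizer_exists)
  obtain u where u: "u \<in> units_of_ring E" "f = u * t powi ord_at E f"
    using ord_at_decomp[OF t assms(1)] .
  obtain w where w: "w \<in> units_of_ring E" "g = w * t powi ord_at E g"
    using ord_at_decomp[OF t assms(2)] .
  have "f * g = (u * w) * (t powi ord_at E f * t powi ord_at E g)"
    by (subst u(2), subst w(2)) (simp add: mult_ac)
  also have "\<dots> = (u * w) * t powi (ord_at E f + ord_at E g)"
    using uniformizer_nonzero[OF t] by (simp add: power_int_add)
  finally show ?thesis
    using ord_at_eqI[OF is_dvr_subalgebra[OF E] t units_mult[OF is_dvr_subalgebra[OF E] u(1) w(1)]]
    by blast
qed

lemma ord_at_unit:
  assumes "u \<in> units_of_ring E"
  shows "ord_at E u = 0"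
  using uniformizer_exists ord_at_eqI[OF is_dvr_subalgebra[OF E] _ assms, of _ u 0] by auto

lemma ord_at_const: "c \<noteq> 0 \<Longrightarrow> ord_at E (const c) = 0"
  by (intro ord_at_unit units_const is_dvr_subalgebra[OF E])

lemma ord_at_1 [simp]: "ord_at E 1 = 0"
  using ord_at_const[of 1] by simp

lemma ord_at_minus [simp]: "ord_at E (- f) = ord_at E f"
proof (cases "f = 0")
  case False
  then show ?thesis using ord_at_mult[of "const (-1)" f] ord_at_const[of "-1"] by (simp add: const_minus)
qed simp

lemma ord_at_inverse: "f \<noteq> 0 \<Longrightarrow> ord_at E (inverse f) = - ord_at E f"
  using ord_at_mult[of f "inverse f"] by simp

lemma ord_at_divide: "f \<noteq> 0 \<Longrightarrow> g \<noteq> 0 \<Longrightarrow> ord_at E (f / g) = ord_at E f - ord_at E g"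
  by (simp add: divide_inverse ord_at_mult ord_at_inverse)

lemma ord_at_power: "f \<noteq> 0 \<Longrightarrow> ord_at E (f ^ n) = of_nat n * ord_at E f"
  by (induction n) (simp_all add: ord_at_mult algebra_simps)

lemma ord_at_power_int: "f \<noteq> 0 \<Longrightarrow> ord_at E (f powi n) = n * ord_at E f"
  by (simp add: power_int_def ord_at_power ord_at_inverse)

lemma ord_at_prod:
  "(\<And>i. i \<in> I \<Longrightarrow> f i \<noteq> 0) \<Longrightarrow> ord_at E (prod f I) = (\<Sum>i\<in>I. ord_at E (f i))"
  by (induction I rule: infinite_finite_induct) (simp_all add: ord_at_mult)

lemma mem_dvr_iff:
  assumes "f \<noteq> 0"
  shows "f \<in> E \<longleftrightarrow> ord_at E f \<ge> 0"
proof -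
  note S = is_dvr_subalgebra[OF E]
  obtain t where t: "uniformizer E t" by (rule uniformizer_exists)
  obtain u where u: "u \<in> units_of_ring E" "f = u * t powi ord_at E f"
    using ord_at_decomp[OF t assms] .
  have *: "g \<in> E" if g: "g \<noteq> 0" "ord_at E g \<ge> 0" for g
  proof -
    obtain u where u: "u \<in> units_of_ring E" "g = u * t powi ord_at E g"
      using ord_at_decomp[OF t g(1)] .
    have "u * t ^ nat (ord_at E g) \<in> E"
      using u uniformizer_inverse_notin(1)[OF t] S
      by (auto simp: units_of_ring_def intro: subalgebra_mult subalgebra_power)
    then show ?thesis using u(2) g(2) by (simp add: power_int_def)
  qed
  show ?thesis
  proof
    assume "f \<in> E"
    show "ord_at E f \<ge> 0"
    proof (rule ccontr)
      assume "\<not> ord_at E f \<ge> 0"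
      then have "inverse f \<in> E" using *[of "inverse f"] ord_at_inverse assms by simp
      with \<open>f \<in> E\<close> assms have "f \<in> units_of_ring E" by (simp add: units_of_ring_def)
      then show False using ord_at_unit \<open>\<not> ord_at E f \<ge> 0\<close> by simp
    qed
  qed (use * assms in blast)
qed

lemma unit_dvr_iff: "f \<noteq> 0 \<Longrightarrow> f \<in> units_of_ring E \<longleftrightarrow> ord_at E f = 0"
  by (auto simp: units_of_ring_def mem_dvr_iff ord_at_inverse)

lemma maxideal_dvr_iff: "f \<noteq> 0 \<Longrightarrow> f \<in> maxideal E \<longleftrightarrow> ord_at E f > 0"
  by (auto simp: maxideal_def mem_dvr_iff unit_dvr_iff)

lemma valuation_ring_dvr: "valuation_ring E"
  unfolding valuation_ring_def
proof (intro conjI allI impI)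
  fix f :: ratfun assume "f \<noteq> 0"
  then show "f \<in> E \<or> inverse f \<in> E"
    by (auto simp: mem_dvr_iff ord_at_inverse)
qed (rule is_dvr_subalgebra[OF E])

text \<open>The alternative \<open>= 0\<close> represents the order infinity, as
  \<open>ord_at E 0\<close> is unspecified. After division by \<open>t powi n\<close> the claim is
  closure of \<open>E\<close> under addition.\<close>

lemma ord_at_add_ge:
  assumes "f = 0 \<or> n \<le> ord_at E f" "g = 0 \<or> n \<le> ord_at E g"
  shows "f + g = 0 \<or> n \<le> ord_at E (f + g)"
proof -
  obtain t where t: "uniformizer E t" by (rule uniformizer_exists)
  note t0 = uniformizer_nonzero[OF t]
  have ot: "ord_at E (t powi k) = k" for k
    using ord_at_eqI[OF is_dvr_subalgebra[OF E] t units_1[OF is_dvr_subalgebra[OF E]], of "t powi k" k] by simp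
  have *: "h / t powi n \<in> E \<longleftrightarrow> h = 0 \<or> n \<le> ord_at E h" for h
    using mem_dvr_iff[of "h / t powi n"] ord_at_divide[of h "t powi n"] ot t0
      subalgebra_0[OF is_dvr_subalgebra[OF E]] by (cases "h = 0") auto
  have "f / t powi n + g / t powi n \<in> E"
    using assms * subalgebra_add[OF is_dvr_subalgebra[OF E]] by blast
  then show ?thesis using *[of "f + g"] by (simp add: add_divide_distrib)
qed

lemma ord_at_mult_ge:
  assumes "f = 0 \<or> m \<le> ord_at E f" "g = 0 \<or> n \<le> ord_at E g"
  shows "f * g = 0 \<or> m + n \<le> ord_at E (f * g)"
  using assms ord_at_mult[of f g] by (cases "f = 0 \<or> g = 0") auto

lemma ord_at_uniformizer: "uniformizer E t \<Longrightarrow> ord_at E t = 1"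
  using ord_at_eqI[OF is_dvr_subalgebra[OF E] _ units_1[OF is_dvr_subalgebra[OF E]], of t t 1] by simp

lemma maxideal_dvr_add:
  assumes "f \<in> maxideal E" "g \<in> maxideal E"
  shows "f + g \<in> maxideal E"
proof (cases "f + g = 0")
  case True
  then show ?thesis
    using subalgebra_0[OF is_dvr_subalgebra[OF E]] by (simp add: maxideal_def units_of_ring_def)
next
  case False
  have "h = 0 \<or> 1 \<le> ord_at E h" if "h \<in> maxideal E" for h
    using maxideal_dvr_iff[of h] that by force
  with ord_at_add_ge[of f 1 g] assms False maxideal_dvr_iff[of "f + g"] show ?thesis by auto
qed

end

text \<open>An \<open>f\<close> in \<open>F\<close> but not in \<open>E\<close> has a pole along
  \<open>E\<close>. Then every \<open>g\<close> is an element of \<open>E\<close> times a power of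
  \<open>f\<close>, so \<open>F\<close> would be the whole field, which has no uniformizer. This
  identifies prime divisors from a single inclusion.\<close>

lemma dvr_maximal_subring:
  assumes E: "is_dvr E" and F: "is_dvr F" and sub: "E \<subseteq> F"
  shows "E = F"
proof (rule ccontr)
  assume "E \<noteq> F"
  then obtain f where f: "f \<in> F" "f \<notin> E" using sub by blast
  have f0: "f \<noteq> 0" using f subalgebra_0[OF is_dvr_subalgebra[OF E]] by blast
  then have neg: "ord_at E f < 0" using f mem_dvr_iff[OF E] by force
  have "g \<in> F" if "g \<noteq> 0" for g
  proof -
    define N where "N = nat \<bar>ord_at E g\<bar>"
    have "ord_at E (g / f ^ N) = ord_at E g - int N * ord_at E f"
      using that f0 by (simp add: ord_at_divide[OF E] ord_at_power[OF E])
    moreover have "int N * ord_at E f \<le> int N * (-1)"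
      using neg by (intro mult_left_mono) auto
    ultimately have "ord_at E (g / f ^ N) \<ge> 0" unfolding N_def by simp
    then have "g / f ^ N \<in> F" using mem_dvr_iff[OF E] that f0 sub by fastforce
    then have "g / f ^ N * f ^ N \<in> F"
      using f(1) is_dvr_subalgebra[OF F] by (intro subalgebra_mult subalgebra_power)
    then show ?thesis using f0 by simp
  qed
  moreover obtain t where "uniformizer F t" using uniformizer_exists[OF F] .
  ultimately show False
    using uniformizer_inverse_notin(2)[of F t] uniformizer_nonzero[of F t] by auto
qed


section \<open>Localizations\<close>

context
  fixes A P assumes A: "subalgebra A" and P: "prime_ideal_of A P"
begin

lemma prime_ideal_0: "0 \<in> P"
  using P by (simp add: prime_ideal_of_def ideal_of_def)

lemma prime_ideal_subset: "P \<subseteq> A"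
  using P by (simp add: prime_ideal_of_def ideal_of_def)

lemma prime_ideal_absorb: "a \<in> A \<Longrightarrow> b \<in> P \<Longrightarrow> a * b \<in> P"
  using P by (simp add: prime_ideal_of_def ideal_of_def)

lemma prime_ideal_prime: "a \<in> A \<Longrightarrow> b \<in> A \<Longrightarrow> a * b \<in> P \<Longrightarrow> a \<in> P \<or> b \<in> P"
  using P by (simp add: prime_ideal_of_def)

lemma prime_ideal_1: "1 \<notin> P"
proof
  assume "1 \<in> P"
  then have "A \<subseteq> P" using prime_ideal_absorb[of _ 1] by auto
  then show False using P prime_ideal_subset by (auto simp: prime_ideal_of_def)
qed

lemma mem_localizationI: "a \<in> A \<Longrightarrow> b \<in> A \<Longrightarrow> b \<notin> P \<Longrightarrow> a / b \<in> localization A P"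
  by (auto simp: localization_def)

lemma subset_localization: "A \<subseteq> localization A P"
  using mem_localizationI[of _ 1] prime_ideal_1 subalgebra_1[OF A] by auto

lemma subalgebra_localization: "subalgebra (localization A P)"
  unfolding subalgebra_def
proof (intro conjI ballI)
  show "range const \<subseteq> localization A P"
    using subalgebra_const[OF A] subset_localization by blast
  fix x y assume "x \<in> localization A P" "y \<in> localization A P"
  then obtain a b c d where *: "x = a / b" "y = c / d" "a \<in> A" "b \<in> A - P" "c \<in> A" "d \<in> A - P"
    by (auto simp: localization_def)
  then have nz: "b \<noteq> 0" "d \<noteq> 0" using prime_ideal_0 by auto
  have bd: "b * d \<in> A - P" using * A prime_ideal_prime[of b d] by (auto intro: subalgebra_mult)
  have "x - y = (a * d - c * b) / (b * d)" "x * y = (a * c) / (b * d)"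
    using nz * by (simp_all add: field_simps)
  then show "x - y \<in> localization A P" "x * y \<in> localization A P"
    using bd * by (simp_all only: Diff_iff) (intro mem_localizationI subalgebra_diff[OF A]
        subalgebra_mult[OF A]; simp)+
qed

lemma maxideal_localization:
  "maxideal (localization A P) = {a / b | a b. a \<in> P \<and> b \<in> A - P}"
proof (intro equalityI subsetI)
  fix x assume x: "x \<in> maxideal (localization A P)"
  then obtain a b where ab: "x = a / b" "a \<in> A" "b \<in> A - P"
    by (auto simp: maxideal_def localization_def)
  have "a \<in> P"
  proof (rule ccontr)
    assume "a \<notin> P"
    then have "inverse x \<in> localization A P" "x \<noteq> 0"
      using ab prime_ideal_0 mem_localizationI[of b a] by auto
    with x show False by (simp add: maxideal_def units_of_ring_def)
  qed
  with ab show "x \<in> {a / b | a b. a \<in> P \<and> b \<in> A - P}" by blast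
next
  fix x assume "x \<in> {a / b | a b. a \<in> P \<and> b \<in> A - P}"
  then obtain a b where ab: "x = a / b" "a \<in> P" "b \<in> A - P" by blast
  have "x \<notin> units_of_ring (localization A P)"
  proof
    assume "x \<in> units_of_ring (localization A P)"
    then obtain c d where cd: "inverse x = c / d" "c \<in> A" "d \<in> A - P" "x \<noteq> 0"
      by (auto simp: units_of_ring_def localization_def)
    then have "b * d = c * a" using ab prime_ideal_0 by (auto simp: field_simps)
    moreover have "c * a \<in> P" using ab cd prime_ideal_absorb by blast
    ultimately show False using prime_ideal_prime[of b d] ab cd by auto
  qed
  moreover have "x \<in> localization A P" using ab prime_ideal_subset mem_localizationI by auto
  ultimately show "x \<in> maxideal (localization A P)" by (simp add: maxideal_def)
qed

lemma maxideal_localization_Int: "maxideal (localization A P) \<inter> A = P"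
proof (intro equalityI subsetI)
  fix x assume x: "x \<in> maxideal (localization A P) \<inter> A"
  then obtain a b where ab: "x = a / b" "a \<in> P" "b \<in> A - P"
    unfolding maxideal_localization by auto
  then have "b * x = a" using prime_ideal_0 by auto
  then show "x \<in> P" using ab x prime_ideal_prime[of b x] by auto
next
  fix x assume "x \<in> P"
  moreover from this have "x = x / 1 \<and> 1 \<in> A - P" using prime_ideal_1 subalgebra_1[OF A] by simp
  ultimately show "x \<in> maxideal (localization A P) \<inter> A"
    unfolding maxideal_localization using prime_ideal_subset by blast
qed

end

text \<open>Separatedness of a union of affine pieces rests on the following comparison of centres.\<close>

lemma dominated_localization_subset:
  assumes A: "subalgebra A" and P: "prime_ideal_of A P"
    and V: "dominates V (localization A P)" "dominates V S" and "A \<subseteq> S"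
    and S: "subalgebra S"
  shows "localization A P \<subseteq> S"
proof
  fix x assume "x \<in> localization A P"
  then obtain a b where ab: "x = a / b" "a \<in> A" "b \<in> A - P" by (auto simp: localization_def)
  have "b \<notin> maxideal (localization A P)"
    using maxideal_localization_Int[OF A P] ab by blast
  then have "b \<notin> maxideal V"
    using V(1) ab subset_localization[OF A P] unfolding dominates_def by blast
  then have "b \<notin> maxideal S" using V(2) unfolding dominates_def by blast
  then have "inverse b \<in> S" using ab \<open>A \<subseteq> S\<close> by (auto simp: maxideal_def units_of_ring_def)
  then show "x \<in> S" using ab \<open>A \<subseteq> S\<close> S by (auto simp: divide_inverse intro: subalgebra_mult)
qed

section \<open>Affine charts\<close>

text \<open>Complements of multiplicative sets that arise below: prime ideals, but also the set of all
  non-units, which need not be closed under addition.\<close>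

definition prime_set :: "complex poly poly set \<Rightarrow> bool" where
  "prime_set P \<longleftrightarrow> 0 \<in> P \<and> 1 \<notin> P \<and> (\<forall>a. \<forall>b\<in>P. a * b \<in> P) \<and> (\<forall>a b. a * b \<in> P \<longrightarrow> a \<in> P \<or> b \<in> P)"

text \<open>Inverting only the units changes nothing, so with this set the statements about local
  rings also yield statements about the ring of the whole chart.\<close>

lemma prime_set_nonunits: "prime_set {a. \<not> a dvd 1}"
  unfolding prime_set_def by (auto simp: is_unit_mult_iff)

text \<open>Factor \<open>b\<close> into primes: a prime set contains no unit and, with a product,
  one of the factors.\<close>

lemma prime_set_has_prime:
  assumes P: "prime_set P" and "b \<in> P" "b \<noteq> 0"
  obtains p where "prime_elem p" "p dvd b" "p \<in> P"
proof -
  have "b \<in> P \<Longrightarrow> b \<noteq> 0 \<Longrightarrow> \<exists>p. prime_elem p \<and> p dvd b \<and> p \<in> P"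
  proof (induction b rule: prime_divisors_induct)
    case (unit x)
    then obtain y where "1 = y * x" by (metis dvdE mult.commute)
    with unit P show ?case by (simp add: prime_set_def) metis
  next
    case (factor p x)
    then consider "p \<in> P" | "x \<in> P" using P by (auto simp: prime_set_def)
    then show ?case
      using factor by cases (auto intro: dvd_triv_left prime_imp_prime_elem dvd_mult)
  qed auto
  with assms that show ?thesis by blast
qed

text \<open>The assumptions make \<open>ev u w\<close> injective with an image whose fraction field
  is the whole function field. The image is thus the coordinate ring of an affine plane with
  coordinates \<open>u\<close>, \<open>w\<close>.\<close>

locale chart =
  fixes u w :: ratfun
  assumes jacobian_nonzero: "jacobian u w \<noteq> 0"
    and fraction: "\<exists>p q. q \<noteq> 0 \<and> f = ev u w p / ev u w q"
begin

lemma ev_zero_iff [simp]: "ev u w p = 0 \<longleftrightarrow> p = 0"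
  by (rule ev_eq_0_iff[OF jacobian_nonzero])

lemma ev_inject [simp]: "ev u w p = ev u w q \<longleftrightarrow> p = q"
  by (rule ev_eq_iff[OF jacobian_nonzero])

definition ring :: "ratfun set" where "ring = range (ev u w)"

definition loc :: "complex poly poly set \<Rightarrow> ratfun set" where
  "loc P = {ev u w a / ev u w b | a b. b \<notin> P}"

lemma subalgebra_ring: "subalgebra ring"
  unfolding subalgebra_def ring_def
proof (intro conjI ballI)
  show "range const \<subseteq> range (ev u w)" by (metis ev_const image_subsetI rangeI)
qed (auto simp flip: ev_diff ev_mult)

lemma ev_in_ring [simp]: "ev u w p \<in> ring"
  by (simp add: ring_def)

lemma coords_in_ring: "u \<in> ring" "w \<in> ring"
  using ev_in_ring[of polyX] ev_in_ring[of polyY] by simp_all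

lemma coords_nonzero: "u \<noteq> 0" "w \<noteq> 0"
  using ev_zero_iff[of polyX] ev_zero_iff[of polyY] by simp_all

lemma coprime_fraction:
  obtains p q where "q \<noteq> 0" "coprime p q" "f = ev u w p / ev u w q"
proof -
  obtain p q where pq: "q \<noteq> 0" "f = ev u w p / ev u w q" using fraction by blast
  then obtain p' q' where g: "p = p' * gcd p q" "q = q' * gcd p q" "coprime p' q'"
    using gcd_coprime_exists[of p q] by auto
  then have "q' \<noteq> 0" "gcd p q \<noteq> 0" using pq(1) by auto
  moreover have "f = ev u w p' / ev u w q'"
    using \<open>gcd p q \<noteq> 0\<close> unfolding pq(2) by (subst g(1), subst g(2)) (simp add: ev_mult)
  ultimately show ?thesis using that g(3) by blast
qed

lemma prime_set_vimage:
  assumes "prime_ideal_of ring Q"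
  shows "prime_set (ev u w -` Q)"
  unfolding prime_set_def
  using prime_ideal_0[OF subalgebra_ring assms] prime_ideal_1[OF subalgebra_ring assms]
    prime_ideal_absorb[OF subalgebra_ring assms] prime_ideal_prime[OF subalgebra_ring assms]
  by (auto simp: ev_mult)

lemma localization_eq_loc:
  assumes "Q \<subseteq> ring"
  shows "localization ring Q = loc (ev u w -` Q)"
  unfolding localization_def loc_def by (auto simp: ring_def)

lemma loc_mono: "P \<subseteq> P' \<Longrightarrow> loc P' \<subseteq> loc P"
  unfolding loc_def by blast

lemma ring_subset_loc: "prime_set P \<Longrightarrow> ring \<subseteq> loc P"
  unfolding ring_def loc_def prime_set_def by clarsimp (metis div_by_1 ev_1)

lemma loc_nonunits: "loc {a. \<not> a dvd 1} = ring"
proof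
  show "loc {a. \<not> a dvd 1} \<subseteq> ring"
  proof
    fix f assume "f \<in> loc {a. \<not> a dvd 1}"
    then obtain a b where ab: "f = ev u w a / ev u w b" "b dvd 1" by (auto simp: loc_def)
    then obtain c where "1 = b * c" by blast
    then have "ev u w b * ev u w c = 1" by (simp flip: ev_mult)
    then have "ev u w c = inverse (ev u w b)" by (simp add: inverse_unique)
    then have "f = ev u w (a * c)" using ab by (simp add: ev_mult divide_inverse)
    then show "f \<in> ring" by simp
  qed
qed (rule ring_subset_loc[OF prime_set_nonunits])

lemma prime_ideal_multiples:
  assumes "prime_elem p"
  shows "prime_ideal_of ring (ev u w ` {a. p dvd a})"
  unfolding prime_ideal_of_def ideal_of_def ring_def
proof (intro conjI)
  show "ev u w ` {a. p dvd a} \<noteq> range (ev u w)"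
  proof
    assume "ev u w ` {a. p dvd a} = range (ev u w)"
    then obtain a where "p dvd a" "ev u w a = ev u w 1" by (metis (mono_tags, lifting) imageE mem_Collect_eq rangeI)
    then have "p dvd 1" unfolding ev_inject by simp
    then show False using assms prime_elem_not_unit by blast
  qed
  show "0 \<in> ev u w ` {a. p dvd a}" using ev_0[of u w] by (metis dvd_0_right imageI mem_Collect_eq)
qed (auto simp: prime_elem_dvd_mult_iff[OF assms] dvd_add simp flip: ev_add ev_mult)

text \<open>For a prime \<open>p\<close> this is the local ring at the generic point of the curve
  \<open>p = 0\<close>.\<close>

definition prime_ring :: "complex poly poly \<Rightarrow> ratfun set" where
  "prime_ring p = loc {a. p dvd a}"

lemma prime_ring_eq_localization:
  assumes "prime_elem p"
  shows "prime_ring p = localization ring (ev u w ` {a. p dvd a})"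
proof -
  have "ev u w -` ev u w ` {a. p dvd a} = {a. p dvd a}" by auto
  then show ?thesis
    unfolding prime_ring_def by (subst localization_eq_loc) (auto simp: ring_def)
qed

lemma prime_ring_in_Spec: "prime_elem p \<Longrightarrow> prime_ring p \<in> Spec ring"
  unfolding Spec_def using prime_ring_eq_localization prime_ideal_multiples by blast

lemma subalgebra_prime_ring: "prime_elem p \<Longrightarrow> subalgebra (prime_ring p)"
  using prime_ring_eq_localization subalgebra_localization[OF subalgebra_ring]
    prime_ideal_multiples by metis

lemma prime_ring_fraction_in: "\<not> p dvd b \<Longrightarrow> ev u w a / ev u w b \<in> prime_ring p"
  unfolding prime_ring_def loc_def by blast

lemma prime_ring_fraction_unit:
  assumes "\<not> p dvd a" "\<not> p dvd b"
  shows "ev u w a / ev u w b \<in> units_of_ring (prime_ring p)"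
  using assms prime_ring_fraction_in[of p b a] prime_ring_fraction_in[of p a b]
  by (auto simp: units_of_ring_def)

lemma prime_ring_decomp:
  assumes "prime_elem p" "a \<noteq> 0" "b \<noteq> 0"
  shows "\<exists>x\<in>units_of_ring (prime_ring p). ev u w a / ev u w b =
    x * ev u w p powi (int (multiplicity p a) - int (multiplicity p b))"
proof -
  have "\<not> is_unit p" "p \<noteq> 0" using assms by (auto simp: prime_elem_def)
  from multiplicity_decompose'[OF assms(2) this(1)] multiplicity_decompose'[OF assms(3) this(1)]
  obtain a' b' where a': "a = p ^ multiplicity p a * a'" "\<not> p dvd a'"
    and b': "b = p ^ multiplicity p b * b'" "\<not> p dvd b'" by metis
  have "ev u w a / ev u w b = (ev u w a' / ev u w b') *
      ev u w p powi (int (multiplicity p a) - int (multiplicity p b))"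
    using \<open>p \<noteq> 0\<close> by (subst a'(1), subst b'(1)) (simp add: power_int_diff ev_mult ev_power mult.commute)
  then show ?thesis using prime_ring_fraction_unit[OF a'(2) b'(2)] by blast
qed

lemma uniformizer_prime_ring:
  assumes p: "prime_elem p"
  shows "uniformizer (prime_ring p) (ev u w p)"
proof -
  have p0: "\<not> is_unit p" "p \<noteq> 0" using assms by (auto simp: prime_elem_def)
  have "inverse (ev u w p) \<notin> prime_ring p"
  proof
    assume "inverse (ev u w p) \<in> prime_ring p"
    then obtain a b where ab: "inverse (ev u w p) = ev u w a / ev u w b" "\<not> p dvd b"
      unfolding prime_ring_def loc_def by blast
    then have "b \<noteq> 0" by auto
    with ab p0 have "ev u w b = ev u w (p * a)" by (simp add: field_simps ev_mult)
    with ab show False by simp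
  qed
  moreover have "ev u w p \<in> prime_ring p"
    using prime_ring_fraction_in[of p 1 p] p0 by simp
  moreover have "\<exists>n. \<exists>x\<in>units_of_ring (prime_ring p). f = x * ev u w p powi n" if f: "f \<noteq> 0" for f
  proof -
    obtain a b where ab: "b \<noteq> 0" "f = ev u w a / ev u w b" using fraction by blast
    with f have "a \<noteq> 0" by auto
    from prime_ring_decomp[OF p this ab(1)] ab(2) show ?thesis by blast
  qed
  ultimately show ?thesis
    using p0 by (simp add: uniformizer_def maxideal_def units_of_ring_def)
qed

lemma is_dvr_prime_ring: "prime_elem p \<Longrightarrow> is_dvr (prime_ring p)"
  unfolding is_dvr_def using uniformizer_prime_ring subalgebra_prime_ring by blast

lemma ord_at_prime_ring_fraction:
  assumes "prime_elem p" "a \<noteq> 0" "b \<noteq> 0"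
  shows "ord_at (prime_ring p) (ev u w a / ev u w b) = int (multiplicity p a) - int (multiplicity p b)"
  using prime_ring_decomp[OF assms] ord_at_eqI[OF subalgebra_prime_ring[OF assms(1)]
      uniformizer_prime_ring[OF assms(1)]] by blast

lemma ord_at_prime_ring:
  assumes "prime_elem p" "a \<noteq> 0"
  shows "ord_at (prime_ring p) (ev u w a) = int (multiplicity p a)"
  using ord_at_prime_ring_fraction[OF assms, of 1] assms(1) by (simp add: multiplicity_one prime_elem_not_unit)

text \<open>Unique factorization: a function with a pole has a pole along a prime divisor.\<close>

lemma mem_loc_if_ord_nonneg:
  assumes P: "prime_set P" and f: "f \<noteq> 0"
    and ord: "\<And>p. prime_elem p \<Longrightarrow> p \<in> P \<Longrightarrow> ord_at (prime_ring p) f \<ge> 0"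
  shows "f \<in> loc P"
proof -
  obtain a b where ab: "b \<noteq> 0" "coprime a b" "f = ev u w a / ev u w b"
    by (rule coprime_fraction)
  have "b \<notin> P"
  proof
    assume "b \<in> P"
    then obtain p where p: "prime_elem p" "p dvd b" "p \<in> P" using prime_set_has_prime P ab(1) by blast
    have "a \<noteq> 0" using ab f by auto
    have "\<not> p dvd a" using p ab(2) by (metis coprime_common_divisor prime_elem_not_unit)
    then have "multiplicity p a = 0" by (rule not_dvd_imp_multiplicity_0)
    moreover have "multiplicity p b > 0"
      using p ab(1) prime_elem_not_unit by (simp add: prime_elem_not_unit multiplicity_gt_zero_iff)
    ultimately show False
      using ord[OF p(1,3)] ord_at_prime_ring_fraction[OF p(1) \<open>a \<noteq> 0\<close> ab(1)] ab(3) by simp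
  qed
  then show ?thesis using ab(3) by (auto simp: loc_def)
qed

lemma loc_subset_prime_ring:
  assumes "prime_set P" "p \<in> P"
  shows "loc P \<subseteq> prime_ring p"
  unfolding prime_ring_def using assms
  by (intro loc_mono) (auto simp: prime_set_def dvd_def mult.commute)

text \<open>As \<open>p\<close> vanishes along \<open>E\<close>, the denominators allowed in
  \<open>E\<close> are not divisible by \<open>p\<close>, which gives one inclusion; discrete
  valuation rings admit no proper inclusions.\<close>

lemma prime_divisor_eq_prime_ring:
  assumes E: "is_dvr E" "E \<in> Spec ring" and p: "prime_elem p" "ev u w p \<in> maxideal E"
  shows "E = prime_ring p"
proof -
  obtain Q where Q: "prime_ideal_of ring Q" "E = localization ring Q"
    using E(2) by (auto simp: Spec_def)
  have "ev u w p \<in> Q"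
    using maxideal_localization_Int[OF subalgebra_ring Q(1)] p(2) unfolding Q(2)
    by (metis IntI ev_in_ring)
  moreover have "E = loc (ev u w -` Q)"
    using Q localization_eq_loc prime_ideal_subset[OF subalgebra_ring Q(1)] by simp
  ultimately have "E \<subseteq> prime_ring p"
    using loc_subset_prime_ring[OF prime_set_vimage[OF Q(1)], of p] by simp
  then show ?thesis using dvr_maximal_subring E(1) is_dvr_prime_ring[OF p(1)] by blast
qed

end

text \<open>If \<open>f\<close> is not in \<open>E\<close>, then \<open>inverse f\<close> is.
  Multiplying the equation by the power of \<open>inverse f\<close> that is one below the degree
  expresses \<open>f\<close> by coefficients and powers of \<open>inverse f\<close>.\<close>

lemma integral_mem_dvr:
  assumes E: "is_dvr E" and p: "lead_coeff p = 1" "\<And>i. coeff p i \<in> E" "poly p f = 0"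
  shows "f \<in> E"
proof (rule ccontr)
  assume "f \<notin> E"
  then have f0: "f \<noteq> 0" using subalgebra_0[OF is_dvr_subalgebra[OF E]] by blast
  have inv: "inverse f \<in> E"
    using valuation_ring_dvr[OF E] f0 \<open>f \<notin> E\<close> by (auto simp: valuation_ring_def)
  obtain n where n: "degree p = Suc n"
  proof (cases "degree p")
    case 0
    then obtain a where "p = [:a:]" by (rule degree_eq_zeroE)
    with p show ?thesis by simp
  qed
  have "f ^ Suc n + (\<Sum>i\<le>n. coeff p i * f ^ i) = 0"
    using p(1,3) n by (simp add: poly_altdef lessThan_Suc_atMost atMost_Suc algebra_simps del: power_Suc)
  then have "(\<Sum>i\<le>n. coeff p i * f ^ i) = - (f * f ^ n)" by (simp add: add_eq_0_iff)
  then have "- (\<Sum>i\<le>n. coeff p i * f ^ i) * inverse f ^ n = f"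
    using f0 by (simp add: power_inverse)
  then have "f = - (\<Sum>i\<le>n. coeff p i * f ^ i * inverse f ^ n)"
    by (simp only: sum_distrib_right mult_minus_left)
  also have "(\<Sum>i\<le>n. coeff p i * f ^ i * inverse f ^ n) = (\<Sum>i\<le>n. coeff p i * inverse f ^ (n - i))"
  proof (rule sum.cong)
    fix i assume "i \<in> {..n}"
    then have "inverse f ^ n = inverse f ^ i * inverse f ^ (n - i)" by (simp flip: power_add)
    then show "coeff p i * f ^ i * inverse f ^ n = coeff p i * inverse f ^ (n - i)"
      using f0 by (simp add: field_simps)
  qed simp
  finally have "f = - (\<Sum>i\<le>n. coeff p i * inverse f ^ (n - i))" .
  moreover have "- (\<Sum>i\<le>n. coeff p i * inverse f ^ (n - i)) \<in> E"
    using is_dvr_subalgebra[OF E] p(2) inv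
    by (intro subalgebra_minus subalgebra_sum subalgebra_mult subalgebra_power)
  ultimately show False using \<open>f \<notin> E\<close> by simp
qed

text \<open>By unique factorization a function is in the local ring once it is in the discrete
  valuation rings of all curves through the point, and those are integrally closed.\<close>

lemma (in chart) integrally_closed_Spec:
  assumes "R \<in> Spec ring"
  shows "integrally_closed R"
  unfolding integrally_closed_def
proof (intro allI impI, elim conjE)
  fix f p assume p: "lead_coeff p = 1" "\<forall>i. coeff p i \<in> R" "poly p f = 0"
  obtain Q where Q: "prime_ideal_of ring Q" "R = localization ring Q"
    using assms by (auto simp: Spec_def)
  have R: "R = loc (ev u w -` Q)"
    using Q localization_eq_loc prime_ideal_subset[OF subalgebra_ring Q(1)] by simp
  show "f \<in> R"
  proof (cases "f = 0")
    case True
    then show ?thesis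
      using Q subalgebra_0[OF subalgebra_localization[OF subalgebra_ring Q(1)]] by simp
  next
    case False
    show ?thesis unfolding R
    proof (rule mem_loc_if_ord_nonneg[OF prime_set_vimage[OF Q(1)] False])
      fix q assume q: "prime_elem q" "q \<in> ev u w -` Q"
      then have "R \<subseteq> prime_ring q"
        using loc_subset_prime_ring[OF prime_set_vimage[OF Q(1)]] R by simp
      then have "f \<in> prime_ring q"
        using integral_mem_dvr[OF is_dvr_prime_ring[OF q(1)] p(1)] p by blast
      then show "ord_at (prime_ring q) f \<ge> 0"
        using mem_dvr_iff[OF is_dvr_prime_ring[OF q(1)] False] by simp
    qed
  qed
qed

section \<open>The coordinate charts of the projective plane\<close>

lemma frame_simps:
  "frame 0 = - (fx + fy + 1)" "frame (Suc 0) = fx" "frame 2 = fy" "frame 3 = 1"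
  by (simp_all add: frame_def coord_def)

lemma Fract_eq_ev: "Fract p 1 = ev fx fy p"
proof -
  have h: "hom_eval const fx a = Fract [:a:] 1" for a
  proof (induction a)
    case (pCons c a)
    have "Fract [:pCons c a:] 1 = const c + fx * Fract [:a:] 1"
      by (simp add: const_def fx_def)
    with pCons show ?case by (simp add: hom_eval_pCons)
  qed (simp add: fract_collapse)
  show ?thesis
  proof (induction p)
    case (pCons a p)
    have "Fract (pCons a p) 1 = Fract [:a:] 1 + fy * Fract p 1"
      by (simp add: fy_def)
    with pCons h show ?case by (simp add: ev_pCons)
  qed (simp add: fract_collapse)
qed

lemma ratfun_eq_fraction: obtains p q where "q \<noteq> 0" "f = ev fx fy p / ev fx fy q"
proof (cases f)
  case (Fract p q)
  then have "f = Fract p 1 / Fract q 1" by simp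
  with Fract(2) that show ?thesis by (simp only: Fract_eq_ev)
qed

lemma jacobian_fx_fy: "jacobian fx fy = 1"
  by (simp add: jacobian_def)

lemma frame_nonzero: "i \<in> {0..3} \<Longrightarrow> frame i \<noteq> 0"
proof -
  have "ev fx fy (- (polyX + polyY + 1)) \<noteq> 0" "ev fx fy polyX \<noteq> 0" "ev fx fy polyY \<noteq> 0"
    by (subst ev_eq_0_iff; simp add: jacobian_fx_fy one_pCons)+
  then have "frame 0 \<noteq> 0" "frame (Suc 0) \<noteq> 0" "frame 2 \<noteq> 0" "frame 3 \<noteq> 0"
    by (simp_all only: frame_simps ev_minus ev_add ev_X ev_Y ev_1) simp_all
  moreover assume "i \<in> {0..3}"
  then have "i = 0 \<or> i = Suc 0 \<or> i = 2 \<or> i = 3" by auto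
  ultimately show ?thesis by blast
qed

lemma frame_eq_coord: "k \<in> {1, 2, 3} \<Longrightarrow> frame k = coord k"
  by (auto simp: frame_def)

lemma sum_frame: "(\<Sum>i\<in>{0..3}. frame i) = 0"
proof -
  have "{0..3::nat} = {0, Suc 0, 2, 3}" by auto
  then show ?thesis by (simp add: frame_simps)
qed

lemma frame_fourth:
  assumes "a \<in> {0..3}" "b \<in> {0..3}" "k \<in> {0..3}" "e \<in> {0..3}" "distinct [a, b, k, e]"
  shows "frame e = - (frame a + frame b + frame k)"
proof -
  have "{a, b, k, e} = {0..3}" using assms by (intro card_subset_eq) auto
  with sum_frame have "(\<Sum>i\<in>{a, b, k, e}. frame i) = 0" by simp
  with assms(5) have "frame a + (frame b + (frame k + frame e)) = 0" by simp
  then show ?thesis by (simp add: eq_neg_iff_add_eq_0 algebra_simps)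
qed

lemma frame_fourth_exists:
  assumes "a \<in> {0..3}" "b \<in> {0..3}" "k \<in> {0..3}" "distinct [a, b, k]"
  obtains e :: nat where "e \<in> {0..3}" "distinct [a, b, k, e]"
proof -
  have "card {a, b, k} < card {0..3::nat}" using assms by simp
  then have "\<not> {0..3} \<subseteq> {a, b, k}" by (meson card_mono finite.emptyI finite_insert linorder_not_le)
  then obtain e where "e \<in> {0..3}" "e \<notin> {a, b, k}" by blast
  with that[of e] assms(4) show ?thesis by auto
qed

text \<open>Any three of the four forms have determinant 1 or -1, being linearly independent with
  the fourth as minus their sum; here this is checked case by case on the numerator
  \<open>N\<close>. The exponent 3 is the source of the degree -3 of the canonical divisor.\<close>

lemma jacobian_frame:
  assumes "a \<in> {0..3}" "b \<in> {0..3}" "k \<in> {0..3}" "distinct [a, b, k]"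
  obtains c where "c \<noteq> 0" "jacobian (frame a / frame k) (frame b / frame k) = const c / frame k ^ 3"
proof -
  have simps: "jacobian (f + g) h = jacobian f h + jacobian g h"
    "jacobian h (f + g) = jacobian h f + jacobian h g" "jacobian (- f) h = - jacobian f h"
    "jacobian h (- f) = - jacobian h f" "jacobian 1 h = 0" "jacobian h 1 = 0"
    "jacobian fx fy = 1" "jacobian fy fx = - 1" for f g h
    using derivation_jacobian_left derivation_jacobian_right jacobian_swap[of fy fx]
    by (simp_all add: jacobian_fx_fy derivation_add[OF derivation_jacobian_left] derivation_add[OF derivation_jacobian_right]
      derivation_minus[OF derivation_jacobian_left] derivation_minus[OF derivation_jacobian_right]
      derivation_1[OF derivation_jacobian_left] derivation_1[OF derivation_jacobian_right])
  define N where "N a b k = frame k * jacobian (frame a) (frame b)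
      - frame a * jacobian (frame k) (frame b) - frame b * jacobian (frame a) (frame k)" for a b k
  have J: "jacobian (frame 0) (frame (Suc 0)) = 1" "jacobian (frame (Suc 0)) (frame 0) = - 1"
    "jacobian (frame 0) (frame 2) = - 1" "jacobian (frame 2) (frame 0) = 1"
    "jacobian (frame (Suc 0)) (frame 2) = 1" "jacobian (frame 2) (frame (Suc 0)) = - 1"
    "jacobian (frame 3) f = 0" "jacobian f (frame 3) = 0" for f
    unfolding frame_simps by (simp_all only: simps jacobian_same) simp_all
  have mem: "i = 0 \<or> i = Suc 0 \<or> i = 2 \<or> i = 3" if "i \<in> {0..3}" for i :: nat using that by auto
  have "N a b k = const 1 \<or> N a b k = const (-1)"
    using mem[OF assms(1)] mem[OF assms(2)] mem[OF assms(3)] assms(4)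
    by (elim disjE; hypsubst; (simp; fail | (simp only: N_def J jacobian_same; simp add: frame_simps const_minus)))
  moreover have "jacobian (frame a / frame k) (frame b / frame k) = N a b k / frame k ^ 3"
    unfolding N_def using frame_nonzero[OF assms(3)] by (rule jacobian_divide)
  ultimately show ?thesis using that[of 1] that[of "-1"] by auto
qed

text \<open>The jacobian gives independence. For generation, the fractions \<open>S\<close> are
  closed under division and contain the ratios of all four forms, the fourth by the relation with
  sum zero; hence they contain \<open>fx\<close> and \<open>fy\<close>.\<close>

lemma chart_frame:
  assumes "a \<in> {0..3}" "b \<in> {0..3}" "k \<in> {0..3}" "distinct [a, b, k]"
  shows "chart (frame a / frame k) (frame b / frame k)"
proof
  let ?u = "frame a / frame k" and ?w = "frame b / frame k"
  show jac: "jacobian ?u ?w \<noteq> 0"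
    using jacobian_frame[OF assms] frame_nonzero[OF assms(3)] by (metis const_eq_0_iff divide_eq_0_iff power_not_zero)
  define S where "S = {f. \<exists>p q. q \<noteq> 0 \<and> f = ev ?u ?w p / ev ?u ?w q}"
  have inj: "ev ?u ?w p = 0 \<longleftrightarrow> p = 0" for p by (rule ev_eq_0_iff[OF jac])
  have ev_S: "ev ?u ?w p \<in> S" for p unfolding S_def by clarsimp (metis div_by_1 ev_1 one_neq_zero)
  have div_S: "f / g \<in> S" if fg: "f \<in> S" "g \<in> S" for f g
  proof (cases "g = 0")
    case True
    then show ?thesis using ev_S[of 0] by simp
  next
    case False
    obtain p q p' q' where *: "q \<noteq> 0" "f = ev ?u ?w p / ev ?u ?w q" "q' \<noteq> 0"
      "g = ev ?u ?w p' / ev ?u ?w q'" using fg unfolding S_def by blast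
    with False have "p' \<noteq> 0" by auto
    moreover have "f / g = ev ?u ?w (p * q') / ev ?u ?w (q * p')" using * by (simp add: ev_mult)
    ultimately show ?thesis using *(1) unfolding S_def by (metis (mono_tags, lifting) mem_Collect_eq mult_eq_0_iff)
  qed
  have sub_S: "subalgebra S"
    unfolding subalgebra_def
  proof (intro conjI ballI)
    show "range const \<subseteq> S" using ev_S[of "[:[:_:]:]"] by auto
    fix f g assume "f \<in> S" "g \<in> S"
    then obtain p q p' q' where *: "q \<noteq> 0" "f = ev ?u ?w p / ev ?u ?w q" "q' \<noteq> 0"
      "g = ev ?u ?w p' / ev ?u ?w q'" unfolding S_def by blast
    have "f - g = ev ?u ?w (p * q' - p' * q) / ev ?u ?w (q * q')"
      "f * g = ev ?u ?w (p * p') / ev ?u ?w (q * q')"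
      using * inj by (simp_all add: ev_mult ev_diff diff_frac_eq)
    then show "f - g \<in> S" "f * g \<in> S"
      using div_S ev_S by metis+
  qed
  have frame_S: "frame i / frame k \<in> S" if i: "i \<in> {0..3}" for i
  proof -
    have k0: "frame k \<noteq> 0" by (rule frame_nonzero[OF assms(3)])
    obtain e where e: "e \<in> {0..3}" "distinct [a, b, k, e]" using frame_fourth_exists[OF assms] .
    have "{a, b, k, e} = {0..3}" using assms e by (intro card_subset_eq) auto
    with i consider "i = a" | "i = b" | "i = k" | "i = e" by blast
    then show ?thesis
    proof cases
      case 4
      have "frame e / frame k = ev ?u ?w (- (polyX + polyY + 1))"
        using k0 unfolding frame_fourth[OF assms(1-3) e]
        by (simp only: ev_minus ev_add ev_X ev_Y ev_1) (simp add: field_simps)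
      with 4 ev_S show ?thesis by simp
    qed (use ev_S[of polyX] ev_S[of polyY] ev_S[of 1] k0 in simp_all)
  qed
  have quot_S: "frame i / frame j \<in> S" if "i \<in> {0..3}" "j \<in> {0..3}" for i j
    using div_S[OF frame_S[OF that(1)] frame_S[OF that(2)]] frame_nonzero[OF assms(3)] by simp
  have "fx \<in> S" "fy \<in> S" using quot_S[of 1 3] quot_S[of 2 3] by (simp_all add: frame_simps)
  fix f
  obtain p q where "f = ev fx fy p / ev fx fy q" by (rule ratfun_eq_fraction)
  then have "f \<in> S" using div_S subalgebra_ev[OF sub_S \<open>fx \<in> S\<close> \<open>fy \<in> S\<close>] by simp
  then show "\<exists>p q. q \<noteq> 0 \<and> f = ev ?u ?w p / ev ?u ?w q" by (simp add: S_def)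
qed

section \<open>The plane as a normal variety\<close>

definition chart_ring :: "nat \<Rightarrow> ratfun set" where
  "chart_ring k = subalgebra hull {coord j / coord k | j. j \<in> {1, 2, 3}}"

lemma P2_eq: "P2 = (\<Union>k\<in>{1, 2, 3}. Spec (chart_ring k))"
  by (simp add: P2_def chart_ring_def)

lemma subalgebra_hull: "subalgebra (subalgebra hull S)"
  by (rule hull_in) (auto simp: subalgebra_def)

lemma subalgebra_chart_ring: "subalgebra (chart_ring k)"
  unfolding chart_ring_def by (rule subalgebra_hull)

lemma coord_in_chart_ring: "j \<in> {1, 2, 3} \<Longrightarrow> coord j / coord k \<in> chart_ring k"
  unfolding chart_ring_def by (rule hull_inc) blast

lemma frame_in_chart_ring:
  assumes "k \<in> {1, 2, 3}" "i \<in> {0..3}"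
  shows "frame i / frame k \<in> chart_ring k"
proof (cases "i = 0")
  case True
  have c: "coord 1 = fx" "coord 2 = fy" "coord 3 = 1" by (simp_all add: coord_def)
  have "frame 0 / frame k = - (coord 1 / coord k + coord 2 / coord k + coord 3 / coord k)"
    unfolding frame_eq_coord[OF assms(1)] c frame_simps
    by (subst minus_divide_left[symmetric]) (simp only: add_divide_distrib)
  also have "\<dots> \<in> chart_ring k"
    by (intro subalgebra_minus[OF subalgebra_chart_ring] subalgebra_add[OF subalgebra_chart_ring]
        coord_in_chart_ring) auto
  finally show ?thesis using True by simp
next
  case False
  then have "i \<in> {1, 2, 3}" using assms(2) by auto
  then show ?thesis using coord_in_chart_ring[of i k] assms(1) by (simp add: frame_eq_coord)
qed

text \<open>Any two of the other three forms are affine coordinates on chart \<open>k\<close>, as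
  the third is determined by them. This freedom is used later to take the lines through the centre
  of a divisor as coordinate axes.\<close>

lemma chart_ring_eq:
  assumes "a \<in> {0..3}" "b \<in> {0..3}" "k \<in> {1, 2, 3}" "distinct [a, b, k]"
  shows "chart.ring (frame a / frame k) (frame b / frame k) = chart_ring k"
proof -
  have k: "k \<in> {0..3}" using assms(3) by auto
  interpret chart "frame a / frame k" "frame b / frame k" by (rule chart_frame[OF assms(1,2) k assms(4)])
  have k0: "frame k \<noteq> 0" by (rule frame_nonzero[OF k])
  show ?thesis
  proof
    show "ring \<subseteq> chart_ring k"
      unfolding ring_def
      using subalgebra_ev[OF subalgebra_chart_ring frame_in_chart_ring[OF assms(3,1)]
          frame_in_chart_ring[OF assms(3,2)]] by blast
    obtain e where e: "e \<in> {0..3}" "distinct [a, b, k, e]"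
      using frame_fourth_exists[OF assms(1,2) k assms(4)] .
    have abke: "{a, b, k, e} = {0..3}" using assms k e by (intro card_subset_eq) auto
    have "frame j / frame k \<in> ring" if "j \<in> {0..3}" for j
    proof -
      from that abke consider "j = a" | "j = b" | "j = k" | "j = e" by blast
      then show ?thesis
      proof cases
        case 4
        have "frame e / frame k = - (frame a / frame k + frame b / frame k + 1)"
          using k0 unfolding frame_fourth[OF assms(1,2) k e] by (simp add: field_simps)
        also have "\<dots> \<in> ring"
          by (intro subalgebra_minus[OF subalgebra_ring] subalgebra_add[OF subalgebra_ring]
              coords_in_ring subalgebra_1[OF subalgebra_ring])
        finally show ?thesis using 4 by simp
      qed (use coords_in_ring subalgebra_1[OF subalgebra_ring] k0 in simp_all)
    qed
    then have "coord j / coord k \<in> ring" if "j \<in> {1, 2, 3}" for j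
    proof -
      have "j \<in> {0..3}" using that by auto
      then have "frame j / frame k \<in> ring" by fact
      then show ?thesis by (simp only: frame_eq_coord[OF that] frame_eq_coord[OF assms(3)])
    qed
    then show "chart_ring k \<subseteq> ring"
      unfolding chart_ring_def by (intro hull_minimal subalgebra_ring) auto
  qed
qed

lemma chart_indices:
  assumes "k \<in> {1, 2, 3::nat}" "i \<in> {0..3}" "i \<noteq> k"
  obtains b where "b \<in> {0..3}" "distinct [i, b, k]"
proof -
  have "card {i, k} < card {0..3::nat}" using assms by simp
  then have "\<not> {0..3} \<subseteq> {i, k}" by (meson card_mono finite.emptyI finite_insert linorder_not_le)
  then obtain b where "b \<in> {0..3}" "b \<notin> {i, k}" by blast
  with that[of b] assms(3) show ?thesis by auto
qed

lemma chart_ring_obtain: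
  assumes "k \<in> {1, 2, 3}"
  obtains u w where "chart u w" "chart.ring u w = chart_ring k"
proof -
  obtain b where "b \<in> {0..3}" "distinct [0, b, k]" using chart_indices[OF assms, of 0] assms by (metis One_nat_def Suc_eq_numeral(1) atLeastAtMost_iff insert_iff le0 old.nat.distinct(1) singletonD zero_neq_numeral)
  with assms that chart_frame[of 0 b k] chart_ring_eq[of 0 b k] show ?thesis by auto
qed

lemma affine_algebra_chart_ring:
  assumes "k \<in> {1, 2, 3}"
  shows "affine_algebra (chart_ring k)"
  unfolding affine_algebra_def
proof (intro conjI allI)
  have "finite {coord j / coord k | j. j \<in> {1, 2, 3::nat}}" by simp
  then show "\<exists>S. finite S \<and> chart_ring k = subalgebra hull S"
    unfolding chart_ring_def by blast
  fix f
  obtain u w where c: "chart u w" "chart.ring u w = chart_ring k" using chart_ring_obtain[OF assms] .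
  interpret chart u w by (rule c(1))
  obtain p q where "q \<noteq> 0" "f = ev u w p / ev u w q" using fraction by blast
  then show "\<exists>a\<in>chart_ring k. \<exists>b\<in>chart_ring k - {0}. f = a / b"
    using c(2) ev_in_ring ev_zero_iff by (metis Diff_iff singletonD)
qed

lemma coord_nonzero: "k \<in> {1, 2, 3} \<Longrightarrow> coord k \<noteq> 0"
  using frame_nonzero[of k] frame_eq_coord[of k] by force

text \<open>The ratio \<open>coord k / coord l\<close> lies in \<open>S\<close> and is invertible in
  \<open>V\<close>; by domination it is invertible in \<open>S\<close>, which lets \<open>S\<close>
  pass from chart \<open>l\<close> to chart \<open>k\<close>.\<close>

lemma chart_ring_subset_dominated:
  assumes kl: "k \<in> {1, 2, 3}" "l \<in> {1, 2, 3}" and "subalgebra S" "chart_ring l \<subseteq> S"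
    and V: "dominates V S" "subalgebra V" "chart_ring k \<subseteq> V"
  shows "chart_ring k \<subseteq> S"
proof -
  define c where "c = coord k / coord l"
  have c0: "c \<noteq> 0" using coord_nonzero kl by (simp add: c_def)
  have "inverse c = coord l / coord k" by (simp add: c_def)
  then have "inverse c \<in> V" "c \<in> S"
    using coord_in_chart_ring[OF kl(1), of l] coord_in_chart_ring[OF kl(2), of k] V(3) assms(4)
    unfolding c_def by auto
  then have "c \<notin> maxideal V" using c0 V(1) by (auto simp: maxideal_def units_of_ring_def dominates_def)
  then have inv: "inverse c \<in> S"
    using V(1) \<open>c \<in> S\<close> by (auto simp: maxideal_def units_of_ring_def dominates_def)
  have "coord j / coord k \<in> S" if "j \<in> {1, 2, 3}" for j
  proof -
    have "coord j / coord k = coord j / coord l * inverse c"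
      using coord_nonzero kl by (simp add: c_def)
    moreover have "coord j / coord l \<in> S" using coord_in_chart_ring[OF that, of l] assms(4) by blast
    ultimately show ?thesis using subalgebra_mult[OF assms(3) _ inv] by metis
  qed
  then show ?thesis unfolding chart_ring_def[of k] by (intro hull_minimal assms(3)) auto
qed

lemma Spec_subalgebra: "subalgebra A \<Longrightarrow> R \<in> Spec A \<Longrightarrow> subalgebra R"
  by (auto simp: Spec_def subalgebra_localization)

lemma Spec_subset: "subalgebra A \<Longrightarrow> R \<in> Spec A \<Longrightarrow> A \<subseteq> R"
  using subset_localization by (auto simp: Spec_def)

lemma variety_P2: "variety P2"
  unfolding variety_def
proof (intro conjI allI impI ballI)
  show "\<exists>\<A>. finite \<A> \<and> \<A> \<noteq> {} \<and> (\<forall>A\<in>\<A>. affine_algebra A) \<and> P2 = \<Union> (Spec ` \<A>)"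
    by (rule exI[of _ "chart_ring ` {1, 2, 3}"]) (auto simp: P2_eq intro: affine_algebra_chart_ring)
next
  \<comment> \<open>One inclusion is enough, since the roles of the two centres can be exchanged.
    The centre \<open>S\<close> contains the chart ring of \<open>R\<close>, and the denominators
    allowed in \<open>R\<close> are units of \<open>V\<close>, hence of \<open>S\<close>.\<close>
  have sub: "R \<subseteq> S" if V: "valuation_ring V" and RS: "R \<in> P2" "S \<in> P2"
    and dom: "dominates V R" "dominates V S" for V R S
  proof -
    obtain k l where kl: "k \<in> {1, 2, 3}" "R \<in> Spec (chart_ring k)" "l \<in> {1, 2, 3}"
      "S \<in> Spec (chart_ring l)" using RS unfolding P2_eq by blast
    have "chart_ring k \<subseteq> V"
      using Spec_subset[OF subalgebra_chart_ring kl(2)] dom(1) by (auto simp: dominates_def)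
    then have "chart_ring k \<subseteq> S"
      using V kl dom(2) Spec_subset[OF subalgebra_chart_ring kl(4)]
        Spec_subalgebra[OF subalgebra_chart_ring kl(4)]
      by (intro chart_ring_subset_dominated[of k l S V]) (auto simp: valuation_ring_def)
    moreover obtain Q where "prime_ideal_of (chart_ring k) Q" "R = localization (chart_ring k) Q"
      using kl(2) by (auto simp: Spec_def)
    ultimately show ?thesis
      using dominated_localization_subset[OF subalgebra_chart_ring, of k Q V S] dom
        Spec_subalgebra[OF subalgebra_chart_ring kl(4)] by simp
  qed
  fix V R S assume "valuation_ring V" "R \<in> P2" "S \<in> P2" "dominates V R \<and> dominates V S"
  then show "R = S" using sub by (meson subset_antisym)
qed

lemma normal_variety_P2: "normal_variety P2"
  unfolding normal_variety_def
proof (intro conjI ballI variety_P2)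
  fix R assume "R \<in> P2"
  then obtain k where k: "k \<in> {1, 2, 3}" "R \<in> Spec (chart_ring k)" unfolding P2_eq by blast
  obtain u w where c: "chart u w" "chart.ring u w = chart_ring k" using chart_ring_obtain[OF k(1)] .
  then show "integrally_closed R" using chart.integrally_closed_Spec[OF c(1)] k(2) by simp
qed

section \<open>Orders of 2-forms\<close>

lemma localization_denominator:
  assumes A: "subalgebra A" "prime_ideal_of A P" "E = localization A P" and E: "is_dvr E"
    and b: "b \<in> A - P"
  shows "b \<noteq> 0" "ord_at E b = 0"
proof -
  show "b \<noteq> 0" using b prime_ideal_0[OF A(1,2)] by auto
  have "b \<in> E" "b \<notin> maxideal E"
    using b maxideal_localization_Int[OF A(1,2)] subset_localization[OF A(1,2)] A(3) by auto
  then have "b \<in> units_of_ring E" by (simp add: maxideal_def)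
  then show "ord_at E b = 0" by (rule ord_at_unit[OF E])
qed

text \<open>For \<open>f = a / b\<close> the quotient rule reads
  \<open>\<delta> f = (\<delta> a - f * \<delta> b) / b\<close>, where \<open>b\<close> is a unit of
  \<open>E\<close> and \<open>f\<close> has no pole.\<close>

lemma derivation_bound_localization:
  assumes A: "subalgebra A" "prime_ideal_of A P" "E = localization A P" and E: "is_dvr E"
    and \<delta>: "derivation \<delta>" and bound: "\<And>a. a \<in> A \<Longrightarrow> \<delta> a = 0 \<or> n \<le> ord_at E (\<delta> a)"
    and f: "f \<in> E"
  shows "\<delta> f = 0 \<or> n \<le> ord_at E (\<delta> f)"
proof -
  obtain a b where ab: "f = a / b" "a \<in> A" "b \<in> A - P"
    using f A(3) by (auto simp: localization_def)
  note b = localization_denominator[OF A E ab(3)]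
  have inv: "inverse b = 0 \<or> 0 \<le> ord_at E (inverse b)" using b by (simp add: ord_at_inverse[OF E])
  have mf: "- f = 0 \<or> 0 \<le> ord_at E (- f)" using f mem_dvr_iff[OF E, of f] ord_at_minus[OF E] by auto
  have "\<delta> f = \<delta> a * inverse b + - f * \<delta> b * inverse b"
    unfolding ab(1) derivation_divide[OF \<delta> b(1)] using b(1)
    by (simp add: field_simps power2_eq_square)
  moreover have "\<delta> a * inverse b = 0 \<or> n + 0 \<le> ord_at E (\<delta> a * inverse b)"
    using bound[OF ab(2)] inv by (rule ord_at_mult_ge[OF E])
  moreover have "- f * \<delta> b * inverse b = 0 \<or> 0 + n + 0 \<le> ord_at E (- f * \<delta> b * inverse b)"
    using mf bound[of b] inv ab(3) by (intro ord_at_mult_ge[OF E]) auto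
  ultimately show ?thesis using ord_at_add_ge[OF E, of "\<delta> a * inverse b" n "- f * \<delta> b * inverse b"] by simp
qed

text \<open>A derivation has bounded poles on \<open>E\<close> because \<open>E\<close> is a
  localization of a finitely generated algebra: the elements that satisfy a given bound form a
  subalgebra, so it suffices to bound the generators.\<close>

lemma derivation_bound_variety:
  assumes X: "variety X" and E: "E \<in> prime_divisors X" and \<delta>: "derivation \<delta>"
  obtains n where "\<And>f. f \<in> E \<Longrightarrow> \<delta> f = 0 \<or> n \<le> ord_at E (\<delta> f)"
proof -
  have dvr: "is_dvr E" using E by (simp add: prime_divisors_def)
  from X E obtain A P where A: "affine_algebra A" "prime_ideal_of A P" "E = localization A P"
    unfolding variety_def prime_divisors_def Spec_def by blast
  then obtain S where S: "finite S" "A = subalgebra hull S" unfolding affine_algebra_def by blast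
  have subA: "subalgebra A" unfolding S(2) by (rule subalgebra_hull)
  \<comment> \<open>The element 0 keeps the set nonempty. If \<open>\<delta> s = 0\<close>, the
    order is an unspecified integer, which can only lower the bound.\<close>
  define n where "n = Min (insert 0 ((\<lambda>s. ord_at E (\<delta> s)) ` S))"
  define T where "T = {f \<in> E. \<delta> f = 0 \<or> n \<le> ord_at E (\<delta> f)}"
  have AE: "A \<subseteq> E" using subset_localization[OF subA A(2)] A(3) by simp
  have "subalgebra T"
    unfolding subalgebra_def
  proof (intro conjI ballI)
    note sub = is_dvr_subalgebra[OF dvr]
    show "range const \<subseteq> T"
      unfolding T_def using subalgebra_const[OF sub] derivation_const[OF \<delta>] by auto
    fix f g assume fg: "f \<in> T" "g \<in> T"
    have "\<delta> (f - g) = \<delta> f + - \<delta> g" by (simp add: derivation_diff[OF \<delta>])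
    moreover have "- \<delta> g = 0 \<or> n \<le> ord_at E (- \<delta> g)"
      using fg by (simp add: T_def ord_at_minus[OF dvr])
    ultimately show "f - g \<in> T"
      using fg subalgebra_diff[OF sub] ord_at_add_ge[OF dvr, of "\<delta> f" n "- \<delta> g"] by (simp add: T_def)
    have "f = 0 \<or> 0 \<le> ord_at E f" "g = 0 \<or> 0 \<le> ord_at E g"
      using fg mem_dvr_iff[OF dvr] by (auto simp: T_def)
    then have "\<delta> f * g = 0 \<or> n + 0 \<le> ord_at E (\<delta> f * g)" "f * \<delta> g = 0 \<or> 0 + n \<le> ord_at E (f * \<delta> g)"
      using fg by (intro ord_at_mult_ge[OF dvr]; simp add: T_def)+
    then show "f * g \<in> T"
      using fg subalgebra_mult[OF sub] ord_at_add_ge[OF dvr, of "\<delta> f * g" n "f * \<delta> g"]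
      by (simp add: T_def derivation_mult[OF \<delta>])
  qed
  moreover have "S \<subseteq> T"
  proof
    fix s assume s: "s \<in> S"
    then have "n \<le> ord_at E (\<delta> s)" unfolding n_def using S(1) by (intro Min_le) auto
    then show "s \<in> T" using s AE S(2) hull_inc[of s S subalgebra] by (auto simp: T_def)
  qed
  ultimately have "A \<subseteq> T" unfolding S(2) by (intro hull_minimal)
  then have "\<delta> f = 0 \<or> n \<le> ord_at E (\<delta> f)" if "f \<in> E" for f
    using derivation_bound_localization[OF subA A(2,3) dvr \<delta>, of n f] that by (auto simp: T_def)
  with that show ?thesis by blast
qed

text \<open>Without a lower bound the infimum of integers in \<open>canonical_div\<close> would
  carry no information.\<close>

lemma bdd_below_jacobian_orders:
  assumes X: "variety X" and E: "E \<in> prime_divisors X"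
  shows "bdd_below {ord_at E (jacobian u v) | u v. u \<in> E \<and> v \<in> E \<and> jacobian u v \<noteq> 0}"
proof -
  have dvr: "is_dvr E" using E by (simp add: prime_divisors_def)
  obtain m where m: "\<And>f. f \<in> E \<Longrightarrow> dx f = 0 \<or> m \<le> ord_at E (dx f)"
    using derivation_bound_variety[OF X E derivation_dx] by blast
  obtain n where n: "\<And>f. f \<in> E \<Longrightarrow> dy f = 0 \<or> n \<le> ord_at E (dy f)"
    using derivation_bound_variety[OF X E derivation_dy] by blast
  have "m + n \<le> ord_at E (jacobian u v)" if "u \<in> E" "v \<in> E" "jacobian u v \<noteq> 0" for u v
  proof -
    have "dx u * dy v = 0 \<or> m + n \<le> ord_at E (dx u * dy v)"
      using that m n by (intro ord_at_mult_ge[OF dvr])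
    moreover have "- (dx v * dy u) = 0 \<or> m + n \<le> ord_at E (- (dx v * dy u))"
      using ord_at_mult_ge[OF dvr m[OF that(2)] n[OF that(1)]] by (simp add: ord_at_minus[OF dvr])
    ultimately show ?thesis
      using ord_at_add_ge[OF dvr, of "dx u * dy v" "m + n" "- (dx v * dy u)"] that(3)
      by (simp add: jacobian_def mult.commute)
  qed
  then show ?thesis by (intro bdd_belowI[of _ "m + n"]) auto
qed

lemma ord_at_jacobian_ge:
  assumes X: "variety X" and E: "E \<in> prime_divisors X" and u: "u \<in> E" and v: "v \<in> E"
    and nz: "jacobian u v \<noteq> 0"
  shows "- canonical_div X E \<le> of_int (ord_at E (jacobian u v))"
proof -
  have "Inf {ord_at E (jacobian u v) | u v. u \<in> E \<and> v \<in> E \<and> jacobian u v \<noteq> 0} \<le> ord_at E (jacobian u v)"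
    using u v nz by (intro cInf_lower bdd_below_jacobian_orders[OF X E]) auto
  then show ?thesis using E by (simp add: canonical_div_def)
qed

text \<open>The 2-form \<open>df/f \<and> dg/g\<close> has at most a simple pole along \<open>E\<close>.\<close>

lemma ord_at_log_form:
  assumes X: "variety X" and E: "E \<in> prime_divisors X" and f: "f \<noteq> 0" and g: "g \<noteq> 0"
    and nz: "jacobian f g \<noteq> 0"
  shows "of_int (ord_at E f + ord_at E g - ord_at E (jacobian f g)) \<le> 1 + canonical_div X E"
proof -
  have dvr: "is_dvr E" using E by (simp add: prime_divisors_def)
  obtain I where I: "canonical_div X E = - of_int I" using E by (simp add: canonical_div_def)
  obtain t where t: "uniformizer E t" using uniformizer_exists[OF dvr] .
  note t0 = uniformizer_nonzero[OF t]
  define a b where "a = ord_at E f" and "b = ord_at E g"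
  obtain x where x: "x \<in> units_of_ring E" "f = x * t powi a"
    using ord_at_decomp[OF dvr t f] unfolding a_def .
  obtain y where y: "y \<in> units_of_ring E" "g = y * t powi b"
    using ord_at_decomp[OF dvr t g] unfolding b_def .
  have I_le: "jacobian h k = 0 \<or> I \<le> ord_at E (jacobian h k)" if "h \<in> E" "k \<in> E" for h k
    using ord_at_jacobian_ge[OF X E that] unfolding I by auto
  have mem: "x \<in> E" "y \<in> E" "t \<in> E"
    using x y uniformizer_inverse_notin(1)[OF t] by (auto simp: units_of_ring_def)
  have oi: "(of_int m :: ratfun) = 0 \<or> 0 \<le> ord_at E (of_int m)" for m
    unfolding of_int_eq_const using ord_at_const[OF dvr, of "of_int m"] by (cases "m = 0") auto
  have ot: "t powi m = 0 \<or> m \<le> ord_at E (t powi m)" for m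
    using t0 by (simp add: ord_at_power_int[OF dvr] ord_at_uniformizer[OF dvr t])
  have ox: "x = 0 \<or> 0 \<le> ord_at E x" "y = 0 \<or> 0 \<le> ord_at E y"
    using mem_dvr_iff[OF dvr] mem by blast+
  \<comment> \<open>The Leibniz rule for \<open>f = x * t powi a\<close> and
    \<open>g = y * t powi b\<close>. Since \<open>jacobian t t = 0\<close>, no term differentiates
    both powers of \<open>t\<close>, so at most one factor \<open>t\<close> is lost.\<close>
  define S where "S = t powi a * t powi b * jacobian x y"
  define S' where "S' = of_int b * y * t powi a * t powi (b - 1) * jacobian x t"
  define S'' where "S'' = of_int a * x * t powi (a - 1) * t powi b * jacobian t y"
  have "jacobian f g = S + (S' + S'')"
    unfolding x(2) y(2) S_def S'_def S''_def
    by (simp add: derivation_mult[OF derivation_jacobian_left] derivation_mult[OF derivation_jacobian_right]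
        derivation_power_int[OF derivation_jacobian_left t0] derivation_power_int[OF derivation_jacobian_right t0]
        algebra_simps)
  moreover have "S = 0 \<or> a + b + I \<le> ord_at E S"
    unfolding S_def using I_le ot mem by (intro ord_at_mult_ge[OF dvr])
  then have "S = 0 \<or> a + b - 1 + I \<le> ord_at E S" by linarith
  moreover have "S' = 0 \<or> 0 + 0 + a + (b - 1) + I \<le> ord_at E S'"
    unfolding S'_def using I_le ot mem oi ox by (intro ord_at_mult_ge[OF dvr])
  then have "S' = 0 \<or> a + b - 1 + I \<le> ord_at E S'" by linarith
  moreover have "S'' = 0 \<or> 0 + 0 + (a - 1) + b + I \<le> ord_at E S''"
    unfolding S''_def using I_le ot mem oi ox by (intro ord_at_mult_ge[OF dvr])
  then have "S'' = 0 \<or> a + b - 1 + I \<le> ord_at E S''" by linarith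
  ultimately have "jacobian f g = 0 \<or> a + b - 1 + I \<le> ord_at E (jacobian f g)"
    by (simp only:) (intro ord_at_add_ge[OF dvr])
  with nz have "a + b - ord_at E (jacobian f g) \<le> 1 - I" by linarith
  then have "(of_int (a + b - ord_at E (jacobian f g)) :: rat) \<le> of_int (1 - I)"
    by (simp only: of_int_le_iff)
  then show ?thesis unfolding I a_def b_def by simp
qed


section \<open>The canonical divisor and the lines of the projective plane\<close>

text \<open>The order of a hyperplane section that does not pass through \<open>E\<close>, relative to the
  normalisation \<open>z\<^sub>3 = 1\<close>.\<close>

definition hyperplane_ord :: "ratfun set \<Rightarrow> int" where
  "hyperplane_ord E = Min ((\<lambda>j. ord_at E (coord j)) ` {1, 2, 3})"

lemma hyperplane_ord_chart:
  assumes E: "is_dvr E" and k: "k \<in> {1, 2, 3}" "chart_ring k \<subseteq> E"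
  shows "hyperplane_ord E = ord_at E (coord k)"
  unfolding hyperplane_ord_def
proof (rule Min_eqI)
  fix y assume "y \<in> (\<lambda>j. ord_at E (coord j)) ` {1, 2, 3}"
  then obtain j where j: "j \<in> {1, 2, 3}" "y = ord_at E (coord j)" by blast
  have "coord j / coord k \<in> E" using coord_in_chart_ring[OF j(1)] k(2) by blast
  then have "0 \<le> ord_at E (coord j / coord k)"
    using mem_dvr_iff[OF E, of "coord j / coord k"] coord_nonzero j(1) k(1) by simp
  then show "ord_at E (coord k) \<le> y"
    using coord_nonzero[OF j(1)] coord_nonzero[OF k(1)] j(2) by (simp add: ord_at_divide[OF E])
qed (use k in auto)

lemma P2_chart:
  assumes "R \<in> P2"
  obtains k where "k \<in> {1, 2, 3}" "R \<in> Spec (chart_ring k)" "chart_ring k \<subseteq> R"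
  using assms Spec_subset[OF subalgebra_chart_ring] unfolding P2_eq by blast

text \<open>On chart \<open>k\<close> the form \<open>du \<and> dw\<close> generates the 2-forms,
  and it is a constant times \<open>dx \<and> dy\<close> divided by the cube of
  \<open>coord k\<close>. Hence \<open>dx \<and> dy\<close> has order
  \<open>3 * ord_at E (coord k)\<close>.\<close>

lemma canonical_div_P2:
  assumes E: "E \<in> prime_divisors P2"
  shows "canonical_div P2 E = 3 * of_int (hyperplane_ord E)"
proof -
  have dvr: "is_dvr E" and "E \<in> P2" using E by (simp_all add: prime_divisors_def)
  then obtain k where k: "k \<in> {1, 2, 3}" "E \<in> Spec (chart_ring k)" "chart_ring k \<subseteq> E"
    using P2_chart by blast
  obtain P where P: "prime_ideal_of (chart_ring k) P" "E = localization (chart_ring k) P"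
    using k(2) by (auto simp: Spec_def)
  have k3: "k \<in> {0..3}" "0 \<noteq> k" using k(1) by auto
  obtain b where b: "b \<in> {0..3}" "distinct [0, b, k]" using chart_indices[OF k(1) _ k3(2)] by auto
  define u w where "u = frame 0 / frame k" and "w = frame b / frame k"
  have 0: "0 \<in> {0..3::nat}" by simp
  interpret chart u w unfolding u_def w_def by (rule chart_frame[OF 0 b(1) k3(1) b(2)])
  have ring: "ring = chart_ring k" unfolding u_def w_def by (rule chart_ring_eq[OF 0 b(1) k(1) b(2)])
  obtain c where c: "c \<noteq> 0" "jacobian u w = const c / frame k ^ 3"
    using jacobian_frame[OF 0 b(1) k3(1) b(2)] unfolding u_def w_def .
  have J: "ord_at E (jacobian u w) = - 3 * hyperplane_ord E"
    using coord_nonzero[OF k(1)] c(1)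
    by (simp add: c(2) hyperplane_ord_chart[OF dvr k(1,3)] ord_at_divide[OF dvr]
        ord_at_const[OF dvr] ord_at_power[OF dvr] frame_eq_coord[OF k(1)])
  have 1: "jacobian (ev u w p) (ev u w q) = 0 \<or>
      ord_at E (jacobian u w) \<le> ord_at E (jacobian (ev u w p) (ev u w q))" for p q
  proof -
    have "ev u w r = 0 \<or> 0 \<le> ord_at E (ev u w r)" for r
      using mem_dvr_iff[OF dvr, of "ev u w r"] k(3) ev_in_ring ring by blast
    then have "ev u w r * jacobian u w = 0 \<or>
        0 + ord_at E (jacobian u w) \<le> ord_at E (ev u w r * jacobian u w)" for r
      by (intro ord_at_mult_ge[OF dvr]) auto
    from this[of "pdX p * pderiv q - pderiv p * pdX q"] show ?thesis unfolding jacobian_ev by simp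
  qed
  \<comment> \<open>The bound passes from polynomials to elements of \<open>E\<close> in one
    argument at a time, since with the other argument fixed the jacobian is a derivation.\<close>
  have 2: "jacobian f (ev u w q) = 0 \<or> ord_at E (jacobian u w) \<le> ord_at E (jacobian f (ev u w q))"
    if "f \<in> E" for f q
    by (rule derivation_bound_localization[OF subalgebra_chart_ring P dvr derivation_jacobian_left _ that])
      (use 1 in \<open>auto simp: ring_def simp flip: ring\<close>)
  have 3: "jacobian f g = 0 \<or> ord_at E (jacobian u w) \<le> ord_at E (jacobian f g)"
    if "f \<in> E" "g \<in> E" for f g
    by (rule derivation_bound_localization[OF subalgebra_chart_ring P dvr derivation_jacobian_right _ that(2)])
      (use 2 that(1) in \<open>auto simp: ring_def simp flip: ring\<close>)
  have "Inf {ord_at E (jacobian u v) | u v. u \<in> E \<and> v \<in> E \<and> jacobian u v \<noteq> 0} = ord_at E (jacobian u w)"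
  proof (rule cInf_eq_minimum)
    show "ord_at E (jacobian u w) \<in> {ord_at E (jacobian u v) | u v. u \<in> E \<and> v \<in> E \<and> jacobian u v \<noteq> 0}"
      using coords_in_ring ring k(3) jacobian_nonzero by blast
  qed (use 3 in auto)
  then show ?thesis using E J by (simp add: canonical_div_def)
qed

lemma line_eq:
  assumes "E \<in> prime_divisors P2"
  shows "line i E = of_int (ord_at E (coord i) - hyperplane_ord E)"
  using assms by (simp add: line_def hyperplane_ord_def)

lemma boundary_eq:
  assumes "E \<in> prime_divisors P2"
  shows "boundary \<gamma> E = \<gamma> * (\<Sum>i\<in>{0..3}. of_int (ord_at E (coord i) - hyperplane_ord E))"
  using assms by (simp add: boundary_def line_eq)

lemma boundary_outside: "E \<notin> prime_divisors P2 \<Longrightarrow> boundary \<gamma> E = 0"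
  by (simp add: boundary_def line_def)

section \<open>A bound on the order of a polynomial along a divisor\<close>

lemma polyX_dvd_iff: "polyX dvd p \<longleftrightarrow> (\<forall>i. coeff (coeff p i) 0 = 0)"
  by (simp add: const_poly_dvd_iff dvd_iff_poly_eq_0 poly_0_coeff_0)

lemma polyY_dvd_iff: "polyY dvd p \<longleftrightarrow> coeff p 0 = 0"
  by (simp add: dvd_iff_poly_eq_0 poly_0_coeff_0)

lemma prime_elem_pCons_0_1: "prime_elem [:0, 1::'a::idom:]"
  by (rule prime_elemI) (auto simp: dvd_iff_poly_eq_0)

lemma prime_elem_polyX: "prime_elem polyX"
  by (intro lift_prime_elem_poly prime_elem_pCons_0_1)

lemma prime_elem_polyY: "prime_elem polyY"
  by (rule prime_elem_pCons_0_1)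

lemma polyX_power: "polyX ^ m = [:monom 1 m:]"
  by (simp add: poly_const_pow monom_altdef)

lemma polyY_power: "polyY ^ m = monom 1 m"
  by (simp add: monom_altdef)

lemma pd_coords: "pdX polyX = 1" "pdX polyY = 0" "pderiv polyX = 0" "pderiv polyY = 1"
  by (simp_all add: map_poly_pCons pderiv_pCons one_pCons)

lemma coeff_polyX_polyY_mult:
  "coeff (coeff (polyX ^ m * polyY ^ n * q) (i + n)) (j + m) = coeff (coeff q i) j"
proof -
  have "polyX ^ m * polyY ^ n * q = smult (monom 1 m) (monom 1 n * q)"
    by (simp add: polyX_power polyY_power)
  then show ?thesis by (simp add: coeff_monom_mult)
qed

lemma tdeg_le_polyX_polyY_mult:
  assumes "tdeg_le (polyX ^ m * polyY ^ n * q) d" "q \<noteq> 0"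
  shows "m + n \<le> d" "tdeg_le q (d - (m + n))"
proof -
  have *: "i + j + (m + n) \<le> d" if "coeff (coeff q i) j \<noteq> 0" for i j
  proof -
    have "coeff (coeff (polyX ^ m * polyY ^ n * q) (i + n)) (j + m) \<noteq> 0"
      using that unfolding coeff_polyX_polyY_mult .
    then have "(i + n) + (j + m) \<le> d" using assms(1) unfolding tdeg_le_def by blast
    then show ?thesis by simp
  qed
  obtain i j where "coeff (coeff q i) j \<noteq> 0"
    using assms(2) by (metis coeff_0 poly_eqI)
  from *[OF this] show "m + n \<le> d" by simp
  show "tdeg_le q (d - (m + n))" unfolding tdeg_le_def using * by fastforce
qed

lemma tdeg_le_add: "tdeg_le p d \<Longrightarrow> tdeg_le q d \<Longrightarrow> tdeg_le (p + q) d"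
  unfolding tdeg_le_def by (metis add_0 coeff_add)

lemma tdeg_le_mono: "tdeg_le p d \<Longrightarrow> d \<le> e \<Longrightarrow> tdeg_le p e"
  unfolding tdeg_le_def by (meson order_trans)

lemma tdeg_le_polyY_mult: "tdeg_le p d \<Longrightarrow> tdeg_le (polyY * p) (Suc d)"
  unfolding tdeg_le_def by (auto simp: coeff_pCons split: nat.splits)

lemma tdeg_le_polyX_mult: "tdeg_le p d \<Longrightarrow> tdeg_le (polyX * p) (Suc d)"
  unfolding tdeg_le_def by (fastforce simp: coeff_pCons split: nat.splits)

lemma tdeg_le_polyX_power_mult: "tdeg_le p d \<Longrightarrow> tdeg_le (polyX ^ n * p) (d + n)"
  by (induction n) (simp_all only: power_0 mult_1_left add_0_right power_Suc mult.assoc add_Suc_right tdeg_le_polyX_mult)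

lemma tdeg_le_const: "tdeg_le [:[:c:]:] d"
  unfolding tdeg_le_def by (auto simp: coeff_pCons split: nat.splits)

text \<open>Homogenization: passage to the chart with coordinates \<open>1/u, w/u\<close>.\<close>

lemma homogenization_exists:
  assumes "tdeg_le q M" "u \<noteq> 0"
  shows "\<exists>Q. tdeg_le Q M \<and> u ^ M * ev (1 / u) (w / u) q = ev u w Q"
  using assms(1)
proof (induction M arbitrary: q)
  case 0
  then obtain c where "q = [:[:c:]:]" using tdeg_le_0 by blast
  then show ?case using tdeg_le_const[of c 0] by (intro exI[of _ "[:[:c:]:]"]) simp
next
  case (Suc M)
  \<comment> \<open>Write \<open>q = c + X * b + Y * r\<close> with \<open>b\<close> in
    \<open>X\<close> alone; \<open>b\<close> and \<open>r\<close> have degree at most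
    \<open>M\<close>.\<close>
  obtain a r where q: "q = pCons a r" by (rule pCons_cases)
  obtain c b where a: "a = pCons c b" by (rule pCons_cases)
  have "tdeg_le r M" unfolding tdeg_le_def
  proof (intro allI impI)
    fix i j assume "coeff (coeff r i) j \<noteq> 0"
    then have "coeff (coeff q (Suc i)) j \<noteq> 0" by (simp add: q)
    then show "i + j \<le> M" using Suc.prems unfolding tdeg_le_def by fastforce
  qed
  then obtain R where R: "tdeg_le R M" "u ^ M * ev (1 / u) (w / u) r = ev u w R"
    using Suc.IH by blast
  have "tdeg_le [:b:] M" unfolding tdeg_le_def
  proof (intro allI impI)
    fix i j assume nz: "coeff (coeff [:b:] i) j \<noteq> 0"
    then have "i = 0" by (cases i) simp_all
    with nz have "coeff (coeff q 0) (Suc j) \<noteq> 0" by (simp add: q a)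
    then show "i + j \<le> M" using Suc.prems \<open>i = 0\<close> unfolding tdeg_le_def by fastforce
  qed
  then obtain B where B: "tdeg_le B M" "u ^ M * ev (1 / u) (w / u) [:b:] = ev u w B"
    using Suc.IH by blast
  have "ev (1 / u) (w / u) q = const c + (1 / u) * ev (1 / u) (w / u) [:b:] + (w / u) * ev (1 / u) (w / u) r"
    by (simp add: q a ev_pCons hom_eval_pCons)
  then have "u * ev (1 / u) (w / u) q = u * const c + ev (1 / u) (w / u) [:b:] + w * ev (1 / u) (w / u) r"
    using \<open>u \<noteq> 0\<close> by (simp add: field_simps)
  then have "u ^ M * (u * ev (1 / u) (w / u) q) =
      u ^ M * (u * const c + ev (1 / u) (w / u) [:b:] + w * ev (1 / u) (w / u) r)" by simp
  then have "u ^ Suc M * ev (1 / u) (w / u) q = const c * u ^ Suc M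
      + u ^ M * ev (1 / u) (w / u) [:b:] + w * (u ^ M * ev (1 / u) (w / u) r)"
    by (simp only: distrib_left power_Suc mult_ac)
  also have "\<dots> = ev u w (polyX ^ Suc M * [:[:c:]:] + B + polyY * R)"
    by (simp only: ev_add ev_mult ev_power ev_X ev_Y ev_const R B) (simp add: mult_ac)
  finally have "u ^ Suc M * ev (1 / u) (w / u) q = ev u w (polyX ^ Suc M * [:[:c:]:] + B + polyY * R)" .
  moreover have "tdeg_le (polyX ^ Suc M * [:[:c:]:] + B + polyY * R) (Suc M)"
    using R(1) B(1) tdeg_le_polyX_power_mult[OF tdeg_le_const[of c 0], of "Suc M"]
    by (intro tdeg_le_add tdeg_le_polyY_mult) (auto intro: tdeg_le_mono)
  ultimately show ?case by blast
qed

context chart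
begin

text \<open>A section of \<open>O(d)\<close> that is regular on two charts is a form of degree
  \<open>d\<close>: the monomials of \<open>q\<close> contribute only terms of total degree at most
  \<open>d\<close> in \<open>u\<close> and \<open>w\<close>.\<close>

lemma tdeg_le_if_other_chart:
  assumes p: "p \<noteq> 0" and eq: "ev u w p = u powi d * ev (1 / u) (w / u) q"
  shows "0 \<le> d" "tdeg_le p (nat d)"
proof -
  note u0 = coords_nonzero(1)
  obtain M where "tdeg_le q M" using tdeg_le_exists by blast
  then obtain Q where Q: "tdeg_le Q M" "u ^ M * ev (1 / u) (w / u) q = ev u w Q"
    using homogenization_exists[OF _ u0] by blast
  \<comment> \<open>Positive and negative part of \<open>d\<close>, whose sign is not yet known;
    multiplying by powers of \<open>X\<close> makes both sides polynomials.\<close>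
  define d1 d2 where "d1 = nat d" and "d2 = nat (- d)"
  have "u ^ d2 * u powi d = u ^ d1"
    using u0 by (auto simp: d1_def d2_def power_int_def power_inverse)
  then have "u ^ (M + d2) * ev u w p = u ^ d1 * ev u w Q"
    unfolding eq Q(2)[symmetric] by (simp add: power_add mult_ac)
  then have "ev u w (polyX ^ (M + d2) * p) = ev u w (polyX ^ d1 * Q)"
    by (simp only: ev_mult ev_power ev_X)
  then have "polyX ^ (M + d2) * polyY ^ 0 * p = polyX ^ d1 * Q" unfolding ev_inject by simp
  then have t: "tdeg_le (polyX ^ (M + d2) * polyY ^ 0 * p) (M + d1)"
    using tdeg_le_polyX_power_mult[OF Q(1), of d1] by simp
  have "M + d2 + 0 \<le> M + d1" by (rule tdeg_le_polyX_polyY_mult(1)[OF t p])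
  then show "0 \<le> d" by (simp add: d1_def d2_def)
  then have "d2 = 0" by (simp add: d2_def)
  then show "tdeg_le p (nat d)" using tdeg_le_polyX_polyY_mult(2)[OF t p] by (simp add: d1_def)
qed

end

text \<open>\<open>A\<close> stands for the log discrepancy of \<open>E\<close> relative to the form
  \<open>du \<and> dw\<close>. By the chain rule for jacobians, \<open>log_form\<close> is the
  simple pole condition stated within the polynomial ring.\<close>

locale chart_valuation = chart +
  fixes E :: "ratfun set" and A :: int
  assumes dvr: "is_dvr E" and ring_subset: "ring \<subseteq> E"
    and log_form: "\<And>p q. p \<noteq> 0 \<Longrightarrow> q \<noteq> 0 \<Longrightarrow> pdX p * pderiv q - pderiv p * pdX q \<noteq> 0 \<Longrightarrow>
      ord_at E (ev u w p) + ord_at E (ev u w q)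
        \<le> A + ord_at E (ev u w (pdX p * pderiv q - pderiv p * pdX q))"
begin

abbreviation v :: "complex poly poly \<Rightarrow> int" where "v p \<equiv> ord_at E (ev u w p)"

lemma v_nonneg: "p \<noteq> 0 \<Longrightarrow> 0 \<le> v p"
  using mem_dvr_iff[OF dvr, of "ev u w p"] ring_subset ev_in_ring[of p] by fastforce

lemma v_mult: "p \<noteq> 0 \<Longrightarrow> q \<noteq> 0 \<Longrightarrow> v (p * q) = v p + v q"
  by (simp add: ev_mult ord_at_mult[OF dvr])

lemma v_power: "p \<noteq> 0 \<Longrightarrow> v (p ^ n) = int n * v p"
  by (simp add: ev_power ord_at_power[OF dvr])

lemma v_coords: "0 \<le> v polyX" "0 \<le> v polyY" "v polyX + v polyY \<le> A"
proof -
  show "0 \<le> v polyX" "0 \<le> v polyY" by (rule v_nonneg, simp)+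
  show "v polyX + v polyY \<le> A" using log_form[of polyX polyY] by (simp add: pd_coords dvr)
qed

lemma v_pderiv: "pderiv p \<noteq> 0 \<Longrightarrow> v p \<le> v (pderiv p) + (A - v polyX)"
proof -
  assume nz: "pderiv p \<noteq> 0"
  have "pdX p * pderiv polyX - pderiv p * pdX polyX = - pderiv p"
    by (simp add: pd_coords)
  with log_form[of p polyX] nz show ?thesis by (cases "p = 0") (simp_all add: ev_minus dvr)
qed

lemma v_pdX: "pdX p \<noteq> 0 \<Longrightarrow> v p \<le> v (pdX p) + (A - v polyY)"
proof -
  assume nz: "pdX p \<noteq> 0"
  have "pdX p * pderiv polyY - pderiv p * pdX polyY = pdX p"
    by (simp add: pd_coords)
  with log_form[of p polyY] nz show ?thesis by (cases "p = 0") (simp_all add: dvr)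
qed

text \<open>Otherwise the constant, as a difference of two elements of positive order, would have
  positive order.\<close>

lemma v_const_plus:
  assumes "c \<noteq> 0" "p - [:[:c:]:] = 0 \<or> 0 < v (p - [:[:c:]:])" "p \<noteq> 0"
  shows "v p = 0"
proof (rule ccontr)
  assume "v p \<noteq> 0"
  then have "1 \<le> v p" using v_nonneg[OF assms(3)] by simp
  have c: "const c = ev u w p + - ev u w (p - [:[:c:]:])" by (simp add: ev_diff)
  have "ev u w p + - ev u w (p - [:[:c:]:]) = 0 \<or> 1 \<le> ord_at E (ev u w p + - ev u w (p - [:[:c:]:]))"
    using assms(2) \<open>1 \<le> v p\<close> by (intro ord_at_add_ge[OF dvr]) (auto simp: ord_at_minus[OF dvr])
  then show False using assms(1) ord_at_const[OF dvr assms(1)] unfolding c[symmetric] by simp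
qed

lemma v_le_tdeg: "tdeg_le p d \<Longrightarrow> p \<noteq> 0 \<Longrightarrow> v p \<le> int d * A"
proof (induction d arbitrary: p)
  case 0
  then obtain c where "p = [:[:c:]:]" using tdeg_le_0 by blast
  with 0 show ?case using ord_at_const[OF dvr, of c] by simp
next
  case (Suc d)
  have A: "0 \<le> A" using v_coords by linarith
  consider "pdX p \<noteq> 0" | "pderiv p \<noteq> 0" | "pdX p = 0" "pderiv p = 0" by blast
  then show ?case
  proof cases
    case 1
    have "v (pdX p) \<le> int d * A" using Suc 1 tdeg_le_pdX by blast
    then show ?thesis using v_pdX[OF 1] v_coords by (simp add: algebra_simps)
  next
    case 2
    have "v (pderiv p) \<le> int d * A" using Suc 2 tdeg_le_pderiv by blast
    then show ?thesis using v_pderiv[OF 2] v_coords by (simp add: algebra_simps)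
  next
    case 3
    then obtain c where "p = [:[:c:]:]" by (rule constant_poly_if_pd_0)
    with Suc A show ?thesis using ord_at_const[OF dvr, of c] by simp
  qed
qed

text \<open>
  Inversion of adjunction: on the line \<open>X = 0\<close>, where \<open>p\<close> has at most \<open>d\<close> zeros, the derivation
  \<open>\<partial>/\<partial>Y\<close> lowers the vanishing order at a point by one, and it lowers \<open>v\<close> by at most \<open>A - v X\<close>.
\<close>

lemma v_le_polyX:
  assumes "tdeg_le p d" "\<not> polyX dvd p"
  shows "v p \<le> int d * (A - v polyX)"
proof (cases "v polyX = 0")
  case True
  have "p \<noteq> 0" using assms(2) by auto
  with True show ?thesis using v_le_tdeg[OF assms(1)] by simp
next
  case False
  then have pos: "0 < v polyX" using v_coords by linarith
  show ?thesis using assms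
  proof (induction d arbitrary: p)
    case 0
    have "p \<noteq> 0" using 0 by auto
    then show ?case using v_le_tdeg[OF 0(1)] by simp
  next
    case (Suc d)
    show ?case
    proof (cases "polyX dvd pderiv p")
      case False
      have "v (pderiv p) \<le> int d * (A - v polyX)" using Suc False tdeg_le_pderiv by blast
      moreover have "pderiv p \<noteq> 0" using False by auto
      ultimately show ?thesis using v_pderiv[of p] by (simp add: algebra_simps)
    next
      case True
      \<comment> \<open>Now \<open>p\<close> restricts to a constant on the line
        \<open>X = 0\<close>, and this constant is not zero as \<open>X\<close> does not divide
        \<open>p\<close>. Since \<open>v polyX > 0\<close>, this forces
        \<open>v p = 0\<close>.\<close>
      define c where "c = coeff (coeff p 0) 0"
      have "coeff (coeff p (Suc i)) 0 = 0" for i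
        using True unfolding polyX_dvd_iff by (simp add: coeff_pderiv of_nat_poly)
           (metis add_is_0 of_nat_0_eq_iff of_nat_Suc one_neq_zero plus_1_eq_Suc)
      then have z: "coeff (coeff p i) 0 = 0" if "i \<noteq> 0" for i using that by (cases i) auto
      have "c \<noteq> 0"
      proof
        assume "c = 0"
        then have "coeff (coeff p i) 0 = 0" for i by (cases "i = 0") (simp_all add: z c_def)
        with Suc.prems(2) show False unfolding polyX_dvd_iff by blast
      qed
      have "polyX dvd p - [:[:c:]:]"
        unfolding polyX_dvd_iff using z by (auto simp: c_def coeff_pCons split: nat.splits)
      then obtain r where r: "p - [:[:c:]:] = polyX * r" by (rule dvdE)
      have "p - [:[:c:]:] = 0 \<or> 0 < v (p - [:[:c:]:])"
      proof (cases "r = 0")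
        case False
        have "v (polyX * r) = v polyX + v r" using False by (intro v_mult) simp_all
        then show ?thesis using pos v_nonneg[OF False] unfolding r by linarith
      qed (simp add: r)
      moreover have "p \<noteq> 0" using Suc.prems(2) by auto
      ultimately have "v p = 0" using v_const_plus \<open>c \<noteq> 0\<close> by blast
      moreover have "0 \<le> int (Suc d) * (A - v polyX)" using v_coords by (intro mult_nonneg_nonneg) linarith+
      ultimately show ?thesis by simp
    qed
  qed
qed

text \<open>The mirror image of \<open>v_le_polyX\<close>. The variables are nested unsymmetrically,
  and restriction to the line \<open>Y = 0\<close> is the coefficient
  \<open>coeff p 0\<close>.\<close>

lemma v_le_polyY:
  assumes "tdeg_le p d" "\<not> polyY dvd p"
  shows "v p \<le> int d * (A - v polyY)"
proof (cases "v polyY = 0")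
  case True
  have "p \<noteq> 0" using assms(2) by auto
  with True show ?thesis using v_le_tdeg[OF assms(1)] by simp
next
  case False
  then have pos: "0 < v polyY" using v_coords by linarith
  show ?thesis using assms
  proof (induction d arbitrary: p)
    case 0
    have "p \<noteq> 0" using 0 by auto
    then show ?case using v_le_tdeg[OF 0(1)] by simp
  next
    case (Suc d)
    show ?case
    proof (cases "polyY dvd pdX p")
      case False
      have "v (pdX p) \<le> int d * (A - v polyY)" using Suc False tdeg_le_pdX by blast
      moreover have "pdX p \<noteq> 0" using False by auto
      ultimately show ?thesis using v_pdX[of p] by (simp add: algebra_simps)
    next
      case True
      then have "pderiv (coeff p 0) = 0" unfolding polyY_dvd_iff by (simp add: coeff_map_poly)
      then obtain c where c: "coeff p 0 = [:c:]" by (auto dest: pderiv_iszero)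
      have "c \<noteq> 0" using c Suc.prems(2) unfolding polyY_dvd_iff by auto
      have "polyY dvd p - [:[:c:]:]" unfolding polyY_dvd_iff by (simp add: c)
      then obtain r where r: "p - [:[:c:]:] = polyY * r" by (rule dvdE)
      have "p - [:[:c:]:] = 0 \<or> 0 < v (p - [:[:c:]:])"
      proof (cases "r = 0")
        case False
        have "v (polyY * r) = v polyY + v r" using False by (intro v_mult) simp_all
        then show ?thesis using pos v_nonneg[OF False] unfolding r by linarith
      qed (simp add: r)
      moreover have "p \<noteq> 0" using Suc.prems(2) by auto
      ultimately have "v p = 0" using v_const_plus \<open>c \<noteq> 0\<close> by blast
      moreover have "0 \<le> int (Suc d) * (A - v polyY)" using v_coords by (intro mult_nonneg_nonneg) linarith+
      ultimately show ?thesis by simp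
    qed
  qed
qed

text \<open>
  The pair of half the two coordinate lines and \<open>1/d\<close> times a curve of degree \<open>d\<close> that contains
  both lines with the same multiplicity is log canonical.
\<close>

lemma v_equal_multiplicity_bound:
  assumes p: "p \<noteq> 0" "tdeg_le p d" and m: "multiplicity polyX p = m" "multiplicity polyY p = m"
  shows "2 * v p + int d * (v polyX + v polyY) \<le> 2 * int d * A"
proof -
  have nu: "\<not> is_unit polyX" "\<not> is_unit polyY"
    using prime_elem_polyX prime_elem_polyY by (auto dest: prime_elem_not_unit)
  obtain p1 where p1: "p = polyX ^ m * p1" "\<not> polyX dvd p1"
    using multiplicity_decompose'[OF p(1) nu(1)] m(1) by metis
  have p10: "p1 \<noteq> 0" using p(1) p1(1) by auto
  have "\<not> polyY dvd polyX" by (simp add: polyY_dvd_iff)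
  then have "multiplicity polyY (polyX ^ m) = 0"
    using prime_elem_dvd_power[OF prime_elem_polyY] by (metis not_dvd_imp_multiplicity_0)
  then have "multiplicity polyY p1 = m"
    using m(2) p10 unfolding p1(1)
    by (subst (asm) prime_elem_multiplicity_mult_distrib[OF prime_elem_polyY]) simp_all
  then obtain q where q: "p1 = polyY ^ m * q" "\<not> polyY dvd q"
    using multiplicity_decompose'[OF p10 nu(2)] by metis
  have q0: "q \<noteq> 0" and qX: "\<not> polyX dvd q" using q(1) p10 p1(2) by auto
  have pq: "p = polyX ^ m * polyY ^ m * q" using p1(1) q(1) by (simp add: mult.assoc)
  have md: "m + m \<le> d" and tq: "tdeg_le q (d - (m + m))"
    using tdeg_le_polyX_polyY_mult[OF _ q0] p(2) unfolding pq by blast+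
  define a b D M where "a = v polyX" and "b = v polyY" and "D = int d" and "M = int m"
  have "v p = v (polyX ^ m * polyY ^ m) + v q"
    unfolding pq using q0 by (intro v_mult) simp_all
  also have "v (polyX ^ m * polyY ^ m) = v (polyX ^ m) + v (polyY ^ m)" by (intro v_mult) simp_all
  also have "v (polyX ^ m) = int m * v polyX" by (intro v_power) simp
  also have "v (polyY ^ m) = int m * v polyY" by (intro v_power) simp
  finally have vp: "v p = M * a + M * b + v q" by (simp add: a_def b_def M_def)
  have e: "int (d - (m + m)) = D - 2 * M" using md by (simp add: D_def M_def)
  \<comment> \<open>The sum of the two bounds, inserted into \<open>2 * v p + D * (a + b)\<close>,
    gives \<open>2 * D * A - 4 * M * (A - (a + b))\<close>, and the subtracted term is
    nonnegative.\<close>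
  have "v q \<le> (D - 2 * M) * (A - a)" "v q \<le> (D - 2 * M) * (A - b)"
    using v_le_polyX[OF tq qX] v_le_polyY[OF tq q(2)] unfolding e a_def b_def by blast+
  moreover have "0 \<le> M * (A - (a + b))"
    using v_coords(3) by (intro mult_nonneg_nonneg) (simp_all add: a_def b_def M_def)
  ultimately have "2 * v p + D * (a + b) \<le> 2 * D * A"
    unfolding vp by (simp add: algebra_simps)
  then show ?thesis by (simp only: a_def b_def D_def)
qed

end

section \<open>Transpositions of coordinates\<close>

context chart
begin

lemma ring_swap: "range (ev w u) = ring"
proof
  show "range (ev w u) \<subseteq> ring"
    using subalgebra_ev[OF subalgebra_ring coords_in_ring(2,1)] by blast
  have sub: "subalgebra (range (ev w u))"
    unfolding subalgebra_def
  proof (intro conjI ballI)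
    show "range const \<subseteq> range (ev w u)" by (metis ev_const image_subsetI rangeI)
  qed (auto simp flip: ev_diff ev_mult)
  have "u \<in> range (ev w u)" "w \<in> range (ev w u)"
    by (metis ev_Y rangeI, metis ev_X rangeI)
  then show "ring \<subseteq> range (ev w u)" unfolding ring_def using subalgebra_ev[OF sub] by blast
qed

lemma chart_swap: "chart w u"
proof
  show jac: "jacobian w u \<noteq> 0" using jacobian_nonzero jacobian_swap[of w u] by simp
  fix f
  obtain p q where pq: "q \<noteq> 0" "f = ev u w p / ev u w q" using fraction by blast
  obtain p' q' where "ev u w p = ev w u p'" "ev u w q = ev w u q'"
    using ring_swap ev_in_ring by (metis imageE)
  with pq show "\<exists>p q. q \<noteq> 0 \<and> f = ev w u p / ev w u q"
    by (metis ev_0 ev_zero_iff)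
qed

text \<open>The reflection of the plane that exchanges the two coordinate axes. It is well defined
  on fractions because \<open>ev u w\<close> is injective.\<close>

definition swap_aut :: "ratfun \<Rightarrow> ratfun" where
  "swap_aut f = (THE g. \<forall>p q. q \<noteq> 0 \<and> f = ev u w p / ev u w q \<longrightarrow> g = ev w u p / ev w u q)"

lemma swap_aut_fraction:
  assumes q: "q \<noteq> 0"
  shows "swap_aut (ev u w p / ev u w q) = ev w u p / ev w u q"
  unfolding swap_aut_def
proof (rule the_equality)
  interpret sw: chart w u by (rule chart_swap)
  show "\<forall>p' q'. q' \<noteq> 0 \<and> ev u w p / ev u w q = ev u w p' / ev u w q' \<longrightarrow>
      ev w u p / ev w u q = ev w u p' / ev w u q'"
  proof (intro allI impI, elim conjE)
    fix p' q' assume q': "q' \<noteq> 0" "ev u w p / ev u w q = ev u w p' / ev u w q'"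
    then have "ev u w (p * q') = ev u w (p' * q)"
      using q by (simp add: frac_eq_eq ev_mult del: ev_inject)
    then have "ev w u (p * q') = ev w u (p' * q)" by simp
    then show "ev w u p / ev w u q = ev w u p' / ev w u q'"
      using q q'(1) by (simp add: frac_eq_eq ev_mult del: sw.ev_inject)
  qed
qed (use q in blast)

lemma swap_aut_ev: "swap_aut (ev u w p) = ev w u p"
  using swap_aut_fraction[of 1 p] by simp

lemma swap_aut_hom:
  "swap_aut (f + g) = swap_aut f + swap_aut g" "swap_aut (f * g) = swap_aut f * swap_aut g"
proof -
  interpret sw: chart w u by (rule chart_swap)
  obtain p q where f: "q \<noteq> 0" "f = ev u w p / ev u w q" using fraction by blast
  obtain p' q' where g: "q' \<noteq> 0" "g = ev u w p' / ev u w q'" using fraction by blast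
  have nz: "q * q' \<noteq> 0" using f g by simp
  have fg: "swap_aut f = ev w u p / ev w u q" "swap_aut g = ev w u p' / ev w u q'"
    by (simp_all only: f g swap_aut_fraction[OF f(1)] swap_aut_fraction[OF g(1)])
  have "f + g = ev u w (p * q' + p' * q) / ev u w (q * q')"
    using f g by (simp add: ev_add ev_mult add_frac_eq)
  then have "swap_aut (f + g) = ev w u (p * q' + p' * q) / ev w u (q * q')"
    by (simp only: swap_aut_fraction[OF nz])
  then show "swap_aut (f + g) = swap_aut f + swap_aut g"
    unfolding fg using f(1) g(1) by (simp add: ev_add ev_mult add_frac_eq)
  have "f * g = ev u w (p * p') / ev u w (q * q')"
    using f g by (simp add: ev_mult)
  then have "swap_aut (f * g) = ev w u (p * p') / ev w u (q * q')"
    by (simp only: swap_aut_fraction[OF nz])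
  then show "swap_aut (f * g) = swap_aut f * swap_aut g"
    unfolding fg by (simp add: ev_mult)
qed

lemma swap_aut_const: "swap_aut (const c) = const c"
  using swap_aut_ev[of "[:[:c:]:]"] by simp

lemma swap_aut_coords: "swap_aut u = w" "swap_aut w = u"
  using swap_aut_ev[of polyX] swap_aut_ev[of polyY] by simp_all

lemma swap_aut_ev_swap: "swap_aut (ev w u p) = ev u w p"
proof -
  have \<phi>0: "swap_aut 0 = 0" using swap_aut_const[of 0] by simp
  have h: "swap_aut (hom_eval const w q) = hom_eval const u q" for q
    by (induction q) (simp_all add: hom_eval_pCons swap_aut_hom swap_aut_const swap_aut_coords \<phi>0)
  show ?thesis by (induction p) (simp_all add: ev_pCons swap_aut_hom swap_aut_coords \<phi>0 h)
qed

lemma swap_aut_divide: "swap_aut (f / g) = swap_aut f / swap_aut g"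
proof (cases "g = 0")
  case True
  then show ?thesis using swap_aut_const[of 0] by simp
next
  case False
  have "swap_aut g * swap_aut (inverse g) = 1"
    using False swap_aut_const[of 1] by (simp flip: swap_aut_hom)
  then have "swap_aut (inverse g) = inverse (swap_aut g)" by (simp add: inverse_unique)
  then show ?thesis by (simp add: divide_inverse swap_aut_hom)
qed

lemma swap_aut_involution: "swap_aut (swap_aut f) = f"
proof -
  obtain p q where f: "q \<noteq> 0" "f = ev u w p / ev u w q" using fraction by blast
  then show ?thesis by (simp add: swap_aut_divide swap_aut_ev swap_aut_ev_swap)
qed

lemma field_aut_swap_aut: "field_aut swap_aut"
proof -
  have "bij swap_aut" by (rule o_bij[of swap_aut]) (simp_all add: fun_eq_iff swap_aut_involution)
  then show ?thesis unfolding field_aut_def using swap_aut_hom swap_aut_const by blast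
qed

text \<open>The image is the ring of the first coordinate of the swapped chart. That coordinate is
  \<open>w\<close>, so it vanishes along the image, which identifies the image in the original
  chart.\<close>

lemma swap_aut_prime_ring: "swap_aut ` prime_ring polyX = prime_ring polyY"
proof -
  interpret sw: chart w u by (rule chart_swap)
  have ring: "sw.ring = ring" by (simp add: sw.ring_def ring_swap)
  have "swap_aut ` prime_ring polyX = sw.prime_ring polyX"
  proof (intro equalityI subsetI)
    fix x assume "x \<in> swap_aut ` prime_ring polyX"
    then obtain a b where "x = swap_aut (ev u w a / ev u w b)" "\<not> polyX dvd b"
      unfolding prime_ring_def loc_def by blast
    then show "x \<in> sw.prime_ring polyX"
      by (simp only: swap_aut_divide swap_aut_ev sw.prime_ring_fraction_in not_False_eq_True)
  next
    fix x assume "x \<in> sw.prime_ring polyX"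
    then obtain a b where ab: "x = ev w u a / ev w u b" "\<not> polyX dvd b"
      unfolding sw.prime_ring_def sw.loc_def by blast
    then have "x = swap_aut (ev u w a / ev u w b)" by (simp only: swap_aut_divide swap_aut_ev)
    then show "x \<in> swap_aut ` prime_ring polyX" using prime_ring_fraction_in ab(2) by blast
  qed
  also have "sw.prime_ring polyX = prime_ring polyY"
  proof (rule prime_divisor_eq_prime_ring[OF sw.is_dvr_prime_ring[OF prime_elem_polyX] _ prime_elem_polyY])
    show "sw.prime_ring polyX \<in> Spec ring"
      using sw.prime_ring_in_Spec[OF prime_elem_polyX] by (simp only: ring)
    show "ev u w polyY \<in> maxideal (sw.prime_ring polyX)"
      using sw.uniformizer_prime_ring[OF prime_elem_polyX] by (simp add: uniformizer_def)
  qed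
  finally show ?thesis .
qed

end

text \<open>Exchanging \<open>a\<close> and \<open>b\<close> over the denominator \<open>k\<close>
  also fixes the fourth form, which is minus the sum of the other three and so symmetric in
  \<open>a\<close> and \<open>b\<close>.\<close>

lemma swap_aut_frame_in_S4:
  assumes abk: "a \<in> {0..3}" "b \<in> {0..3}" "k \<in> {0..3}" "distinct [a, b, k]"
  shows "chart.swap_aut (frame a / frame k) (frame b / frame k) \<in> S4"
proof -
  interpret chart "frame a / frame k" "frame b / frame k" by (rule chart_frame[OF abk])
  define \<tau> where "\<tau> = Transposition.transpose a b"
  have k0: "frame k \<noteq> 0" by (rule frame_nonzero[OF abk(3)])
  obtain e where e: "e \<in> {0..3}" "distinct [a, b, k, e]" using frame_fourth_exists[OF abk] .
  have abke: "{a, b, k, e} = {0..3}" using abk e by (intro card_subset_eq) auto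
  have one: "swap_aut 1 = 1" using swap_aut_const[of 1] by simp
  have fe: "frame e / frame k = - 1 - frame a / frame k - frame b / frame k"
    using k0 unfolding frame_fourth[OF abk(1-3) e] by (simp add: field_simps)
  have \<tau>_simps: "\<tau> a = b" "\<tau> b = a" "\<tau> k = k" "\<tau> e = e"
    using e by (auto simp: \<tau>_def transpose_apply_other)
  have 1: "swap_aut (frame i / frame k) = frame (\<tau> i) / frame k" if "i \<in> {0..3}" for i
  proof -
    from that abke consider "i = a" | "i = b" | "i = k" | "i = e" by blast
    then show ?thesis
    proof cases
      case 4
      have "swap_aut (frame e / frame k) + (swap_aut (frame a / frame k) + swap_aut (frame b / frame k)) =
          swap_aut (const (- 1))"
        by (simp only: fe swap_aut_hom(1)[symmetric]) (simp add: const_minus)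
      then have "swap_aut (frame e / frame k) = frame e / frame k"
        unfolding swap_aut_coords swap_aut_const fe by (simp add: const_minus algebra_simps)
      with 4 show ?thesis by (simp add: \<tau>_simps)
    qed (use swap_aut_coords one k0 in \<open>simp_all add: \<tau>_simps\<close>)
  qed
  have "swap_aut (frame i / frame j) = frame (\<tau> i) / frame (\<tau> j)" if "i \<in> {0..3}" "j \<in> {0..3}" for i j
  proof -
    have "frame i / frame j = (frame i / frame k) / (frame j / frame k)" using k0 by simp
    then have "swap_aut (frame i / frame j) = (frame (\<tau> i) / frame k) / (frame (\<tau> j) / frame k)"
      using 1 that by (simp only: swap_aut_divide)
    then show ?thesis using k0 by simp
  qed
  moreover have "\<tau> permutes {0..3}" unfolding \<tau>_def using abk by (intro permutes_swap_id)
  ultimately show ?thesis unfolding S4_def using field_aut_swap_aut by blast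
qed


section \<open>Equivariant divisors on the projective plane\<close>

lemma prime_ring_in_prime_divisors:
  assumes "chart u w" "chart.ring u w = chart_ring k" "k \<in> {1, 2, 3}" "prime_elem p"
  shows "chart.prime_ring u w p \<in> prime_divisors P2" "chart_ring k \<subseteq> chart.prime_ring u w p"
proof -
  interpret chart u w by (rule assms(1))
  have "prime_ring p \<in> Spec (chart_ring k)" using prime_ring_in_Spec[OF assms(4)] assms(2) by simp
  then show "prime_ring p \<in> prime_divisors P2" "chart_ring k \<subseteq> prime_ring p"
    using is_dvr_prime_ring[OF assms(4)] assms(3) Spec_subset[OF subalgebra_chart_ring]
    unfolding prime_divisors_def P2_eq by blast+
qed

lemma mem_chart_ring_if_ord_nonneg:
  assumes k: "k \<in> {1, 2, 3}" and "f \<noteq> 0"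
    and ord: "\<And>E. E \<in> prime_divisors P2 \<Longrightarrow> chart_ring k \<subseteq> E \<Longrightarrow> 0 \<le> ord_at E f"
  shows "f \<in> chart_ring k"
proof -
  obtain u w where c: "chart u w" "chart.ring u w = chart_ring k" using chart_ring_obtain[OF k] .
  interpret chart u w by (rule c(1))
  have "f \<in> loc {a. \<not> a dvd 1}"
    using prime_ring_in_prime_divisors[OF c k] ord
    by (intro mem_loc_if_ord_nonneg prime_set_nonunits \<open>f \<noteq> 0\<close>) blast
  then show ?thesis using loc_nonunits c(2) by simp
qed

lemma mem_local_ring_if_ord_nonneg:
  assumes R: "R \<in> P2" and "f \<noteq> 0"
    and ord: "\<And>E. E \<in> prime_divisors P2 \<Longrightarrow> R \<subseteq> E \<Longrightarrow> 0 \<le> ord_at E f"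
  shows "f \<in> R"
proof -
  obtain k where k: "k \<in> {1, 2, 3}" "R \<in> Spec (chart_ring k)" using P2_chart[OF R] .
  obtain u w where c: "chart u w" "chart.ring u w = chart_ring k" using chart_ring_obtain[OF k(1)] .
  interpret chart u w by (rule c(1))
  obtain Q where Q: "prime_ideal_of ring Q" "R = localization ring Q"
    using k(2) c(2) by (auto simp: Spec_def)
  have R_loc: "R = loc (ev u w -` Q)"
    using Q localization_eq_loc prime_ideal_subset[OF subalgebra_ring Q(1)] by simp
  show ?thesis
    unfolding R_loc
  proof (rule mem_loc_if_ord_nonneg[OF prime_set_vimage[OF Q(1)] \<open>f \<noteq> 0\<close>])
    fix p assume p: "prime_elem p" "p \<in> ev u w -` Q"
    then have "R \<subseteq> prime_ring p"
      using loc_subset_prime_ring[OF prime_set_vimage[OF Q(1)]] R_loc by simp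
    then show "0 \<le> ord_at (prime_ring p) f"
      using ord prime_ring_in_prime_divisors(1)[OF c k(1) p(1)] by blast
  qed
qed

lemma coord_nonzero_all: "i \<in> {0..3} \<Longrightarrow> coord i \<noteq> 0"
  using frame_nonzero[of i] by (auto simp: frame_def split: if_splits)

lemma ord_at_frame: "is_dvr E \<Longrightarrow> ord_at E (frame i) = ord_at E (coord i)"
  by (simp add: frame_def)

text \<open>\<open>g\<close> represents a form of degree \<open>d\<close> with divisor
  \<open>n * D\<close>, written with the third coordinate set to 1; subtracting
  \<open>d * hyperplane_ord E\<close> turns the order of a function into that of a section of
  \<open>O(d)\<close>. The sign of \<open>d\<close> is left open and comes out of the degree
  estimate.\<close>

locale equivariant_divisor =
  fixes D :: qdiv and n :: nat and g :: ratfun and d :: int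
  assumes n_pos: "0 < n" and g_nonzero: "g \<noteq> 0"
    and D_nonneg: "\<And>E. 0 \<le> D E" and D_invariant: "invariant_div S4 P2 D"
    and equation: "\<And>E. E \<in> prime_divisors P2 \<Longrightarrow> of_nat n * D E = of_int (ord_at E g - d * hyperplane_ord E)"
begin

text \<open>The local equation of \<open>n * D\<close> on chart \<open>k\<close>, that is, the form
  divided by the power \<open>d\<close> of the coordinate \<open>k\<close>.\<close>

definition F :: "nat \<Rightarrow> ratfun" where "F k = g / coord k powi d"

lemma F_nonzero: "k \<in> {1, 2, 3} \<Longrightarrow> F k \<noteq> 0"
  using coord_nonzero[of k] g_nonzero by (simp add: F_def power_int_not_zero)

lemma ord_at_F:
  assumes E: "is_dvr E" and k: "k \<in> {1, 2, 3}"
  shows "ord_at E (F k) = ord_at E g - d * ord_at E (coord k)"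
  using coord_nonzero[OF k] g_nonzero
  by (simp add: F_def ord_at_divide[OF E] ord_at_power_int[OF E] power_int_not_zero)

lemma ord_at_F_P2:
  assumes E: "E \<in> prime_divisors P2" and k: "k \<in> {1, 2, 3}" "chart_ring k \<subseteq> E"
  shows "of_int (ord_at E (F k)) = of_nat n * D E"
proof -
  have "is_dvr E" using E by (simp add: prime_divisors_def)
  then show ?thesis using equation[OF E] by (simp add: ord_at_F[OF _ k(1)] hyperplane_ord_chart[OF _ k])
qed

lemma F_in_chart_ring:
  assumes k: "k \<in> {1, 2, 3}"
  shows "F k \<in> chart_ring k"
proof (rule mem_chart_ring_if_ord_nonneg[OF k F_nonzero[OF k]])
  fix E assume E: "E \<in> prime_divisors P2" "chart_ring k \<subseteq> E"
  have "(0::rat) \<le> of_int (ord_at E (F k))"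
    unfolding ord_at_F_P2[OF E(1) k E(2)] using D_nonneg by simp
  then show "0 \<le> ord_at E (F k)" by simp
qed

end

text \<open>The three forms other than \<open>z\<^sub>k\<close> sum to \<open>- z\<^sub>k\<close>, so not all of them vanish along \<open>E\<close>.\<close>

lemma frame_unit_exists:
  assumes E: "is_dvr E" and k: "k \<in> {1, 2, 3}" "chart_ring k \<subseteq> E"
  obtains e where "e \<in> {0..3}" "e \<noteq> k" "ord_at E (frame e / frame k) = 0"
proof (rule ccontr)
  assume "\<not> thesis"
  with that have nz: "ord_at E (frame e / frame k) \<noteq> 0" if "e \<in> {0..3} - {k}" for e using that by blast
  have k3: "k \<in> {0..3}" and k0: "frame k \<noteq> 0" using k(1) frame_nonzero by auto
  have max: "frame e / frame k \<in> maxideal E" if e: "e \<in> {0..3} - {k}" for e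
  proof -
    have f0: "frame e / frame k \<noteq> 0" using e k0 frame_nonzero[of e] by simp
    have "frame e / frame k \<in> E" using frame_in_chart_ring[OF k(1)] k(2) e by blast
    then have "0 < ord_at E (frame e / frame k)"
      using nz[OF e] mem_dvr_iff[OF E f0] by simp
    then show ?thesis using maxideal_dvr_iff[OF E f0] by simp
  qed
  have 0: "0 \<in> maxideal E"
    using subalgebra_0[OF is_dvr_subalgebra[OF E]] by (simp add: maxideal_def units_of_ring_def)
  have "sum (\<lambda>e. frame e / frame k) T \<in> maxideal E" if "T \<subseteq> {0..3} - {k}" for T
    using finite_subset[OF that finite_Diff[OF finite_atLeastAtMost]] that
    by (induction T rule: finite_induct) (simp_all add: 0 maxideal_dvr_add[OF E max])
  then have "(\<Sum>e\<in>{0..3} - {k}. frame e / frame k) \<in> maxideal E" by blast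
  also have "(\<Sum>e\<in>{0..3} - {k}. frame e / frame k) = (\<Sum>e\<in>{0..3}. frame e / frame k) - 1"
    using k3 k0 by (subst sum_diff1) auto
  also have "(\<Sum>e\<in>{0..3}. frame e / frame k) = 0"
    by (simp only: sum_divide_distrib[symmetric] sum_frame div_0)
  finally have "- 1 \<in> maxideal E" by simp
  then show False using maxideal_dvr_iff[OF E, of "- 1"] ord_at_1[OF E] by (simp add: ord_at_minus[OF E])
qed

context equivariant_divisor
begin

text \<open>Along \<open>E\<close>, \<open>S\<close> is the order of the four lines and
  \<open>F k\<close> is the equation of \<open>n * D\<close>. \<open>A\<close> is the log
  discrepancy, as the canonical divisor of the plane pulls back with coefficient
  \<open>3 * ord_at E (coord k)\<close>.\<close>

lemma divisor_bound:
  assumes X: "variety X" and E: "E \<in> prime_divisors X" and k: "k \<in> {1, 2, 3}" "chart_ring k \<subseteq> E"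
    and S_def: "S = (\<Sum>i\<in>{0..3}. of_int (ord_at E (coord i) - ord_at E (coord k)))"
    and A_def: "A = 1 + canonical_div X E - 3 * of_int (ord_at E (coord k))"
  shows "0 \<le> d" "0 \<le> S" "S \<le> A" "0 \<le> ord_at E (F k)" "of_int (ord_at E (F k)) \<le> of_int d * A"
    "2 * of_int (ord_at E (F k)) + of_int d * S \<le> 2 * of_int d * A"
proof -
  have dvr: "is_dvr E" using E by (simp add: prime_divisors_def)
  have k3: "k \<in> {0..3}" using k(1) by auto
  obtain e where e: "e \<in> {0..3}" "e \<noteq> k" "ord_at E (frame e / frame k) = 0"
    using frame_unit_exists[OF dvr k] .
  \<comment> \<open>The lines \<open>e\<close> and \<open>k\<close> miss the centre of
    \<open>E\<close>; the other two become the coordinate axes. The index \<open>a\<close> must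
    belong to one of the three charts, because the degree of \<open>p\<close> is read off by
    comparison with chart \<open>a\<close>.\<close>
  obtain a b where ab: "a \<in> {0..3}" "b \<in> {0..3}" "distinct [e, k, a, b]" "a \<noteq> 0"
  proof -
    obtain b where b: "b \<in> {0..3}" "distinct [e, b, k]" using chart_indices[OF k(1) e(1,2)] .
    obtain a where a: "a \<in> {0..3}" "distinct [e, b, k, a]" using frame_fourth_exists[OF e(1) b(1) k3 b(2)] .
    show ?thesis
    proof (cases "a = 0")
      case True
      then show ?thesis using a b by (intro that[of b a]) auto
    next
      case False
      then show ?thesis using a b by (intro that[of a b]) auto
    qed
  qed
  have a: "a \<in> {1, 2, 3}" using ab by auto
  have dist: "distinct [a, b, k]" "distinct [k, b, a]" using ab(3) by auto
  define u w where "u = frame a / frame k" and "w = frame b / frame k"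
  have nz: "frame a \<noteq> 0" "frame b \<noteq> 0" "frame k \<noteq> 0" using frame_nonzero ab(1,2) k3 by blast+
  have cuw: "chart u w" unfolding u_def w_def by (rule chart_frame[OF ab(1,2) k3 dist(1)])
  interpret chart u w by (rule cuw)
  have ring: "ring = chart_ring k" unfolding u_def w_def by (rule chart_ring_eq[OF ab(1,2) k(1) dist(1)])
  obtain c where c: "c \<noteq> 0" "jacobian u w = const c / frame k ^ 3"
    using jacobian_frame[OF ab(1,2) k3 dist(1)] unfolding u_def w_def .
  have J: "ord_at E (jacobian u w) = - 3 * ord_at E (coord k)"
    using nz c(1) by (simp add: c(2) ord_at_divide[OF dvr] ord_at_const[OF dvr] ord_at_power[OF dvr]
        ord_at_frame[OF dvr])
  obtain I\<^sub>0 where "canonical_div X E = - of_int I\<^sub>0" using E by (simp add: canonical_div_def)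
  then obtain I where I: "canonical_div X E = of_int I" by (metis of_int_minus)
  define A' where "A' = 1 + I - 3 * ord_at E (coord k)"
  have A': "A = of_int A'" by (simp add: A_def A'_def I)
  interpret chart_valuation u w E A'
  proof
    fix p q :: "complex poly poly"
    let ?r = "pdX p * pderiv q - pderiv p * pdX q"
    assume pq: "p \<noteq> 0" "q \<noteq> 0" "?r \<noteq> 0"
    have "jacobian (ev u w p) (ev u w q) \<noteq> 0"
      unfolding jacobian_ev using pq(3) jacobian_nonzero ev_zero_iff by (metis mult_eq_0_iff)
    then have "(of_int (ord_at E (ev u w p) + ord_at E (ev u w q)
        - ord_at E (jacobian (ev u w p) (ev u w q))) :: rat) \<le> of_int (1 + I)"
      using ord_at_log_form[OF X E, of "ev u w p" "ev u w q"] pq(1,2) I by simp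
    then have "ord_at E (ev u w p) + ord_at E (ev u w q) - ord_at E (jacobian (ev u w p) (ev u w q)) \<le> 1 + I"
      by (simp only: of_int_le_iff)
    moreover have "ord_at E (jacobian (ev u w p) (ev u w q)) = ord_at E (ev u w ?r) + ord_at E (jacobian u w)"
      unfolding jacobian_ev using pq(3) jacobian_nonzero ev_zero_iff by (intro ord_at_mult[OF dvr]) blast+
    ultimately show "ord_at E (ev u w p) + ord_at E (ev u w q) \<le> A' + ord_at E (ev u w ?r)"
      unfolding J A'_def by simp
  qed (use dvr k(2) ring in auto)
  obtain p where p: "F k = ev u w p" using F_in_chart_ring[OF k(1)] ring by (auto simp: ring_def)
  have p0: "p \<noteq> 0" using F_nonzero[OF k(1)] p by auto
  have "frame k / frame a = 1 / u" "frame b / frame a = w / u" using nz by (simp_all add: u_def w_def)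
  then have "chart_ring a = range (ev (1 / u) (w / u))"
    using chart_ring_eq[OF k3 ab(2) a dist(2)] chart.ring_def[OF chart_frame[OF k3 ab(2,1) dist(2)]] by simp
  then obtain q where q: "F a = ev (1 / u) (w / u) q" using F_in_chart_ring[OF a] by blast
  \<comment> \<open>The same section of \<open>O(d)\<close> in two charts; its regularity on both
    bounds the degree of \<open>p\<close>.\<close>
  have "u powi d * F a = F k"
    using nz by (simp add: F_def u_def frame_eq_coord[OF a] frame_eq_coord[OF k(1)]
        power_int_divide_distrib)
  then have eq: "ev u w p = u powi d * ev (1 / u) (w / u) q" by (simp only: p q)
  show d0: "0 \<le> d" by (rule tdeg_le_if_other_chart(1)[OF p0 eq])
  have deg: "tdeg_le p (nat d)" by (rule tdeg_le_if_other_chart(2)[OF p0 eq])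
  have mult: "of_nat (multiplicity r p) = of_nat n * D (prime_ring r)" if r: "prime_elem r" for r
    using ord_at_F_P2[OF prime_ring_in_prime_divisors(1)[OF cuw ring k(1) r] k(1)
        prime_ring_in_prime_divisors(2)[OF cuw ring k(1) r]]
      ord_at_prime_ring[OF r p0] unfolding p by simp
  \<comment> \<open>Invariance of \<open>D\<close> under the transposition of the lines
    \<open>a\<close> and \<open>b\<close>.\<close>
  have "D (prime_ring polyX) = D (prime_ring polyY)"
    using D_invariant swap_aut_frame_in_S4[OF ab(1,2) k3 dist(1)] swap_aut_prime_ring
      prime_ring_in_prime_divisors(1)[OF cuw ring k(1) prime_elem_polyX]
    unfolding invariant_div_def u_def[symmetric] w_def[symmetric] by metis
  then have "(of_nat (multiplicity polyX p) :: rat) = of_nat (multiplicity polyY p)"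
    using mult[OF prime_elem_polyX] mult[OF prime_elem_polyY] by simp
  then have "multiplicity polyX p = multiplicity polyY p" by simp
  then have main: "2 * v p + d * (v polyX + v polyY) \<le> 2 * d * A'"
    using v_equal_multiplicity_bound[OF p0 deg refl] d0 by simp
  define S' where "S' = v polyX + v polyY"
  have o: "ord_at E (frame i / frame k) = ord_at E (coord i) - ord_at E (coord k)" if "i \<in> {0..3}" for i
    using nz frame_nonzero[OF that] by (simp add: ord_at_divide[OF dvr] ord_at_frame[OF dvr])
  \<comment> \<open>The terms of \<open>e\<close> and \<open>k\<close> vanish, so the order of all
    four lines is that of the two axes.\<close>
  have "{e, k, a, b} = {0..3}" using ab e k3 by (intro card_subset_eq) auto
  then have "(\<Sum>i\<in>{0..3}. ord_at E (coord i) - ord_at E (coord k)) =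
      (\<Sum>i\<in>{e, k, a, b}. ord_at E (coord i) - ord_at E (coord k))" by simp
  also have "\<dots> = S'"
    using ab(3) e(3) o[OF e(1)] o[OF ab(1)] o[OF ab(2)] by (simp add: S'_def u_def w_def)
  finally have S': "S = of_int S'" unfolding S_def by (simp only: of_int_sum[symmetric])
  show "0 \<le> S" "S \<le> A" unfolding S' A' using v_coords by (simp_all add: S'_def)
  show "0 \<le> ord_at E (F k)" unfolding p by (rule v_nonneg[OF p0])
  have "v p \<le> d * A'" using v_le_tdeg[OF deg p0] d0 by simp
  then have "(of_int (v p) :: rat) \<le> of_int (d * A')" by (simp only: of_int_le_iff)
  then show "of_int (ord_at E (F k)) \<le> of_int d * A" by (simp add: p A')
  have "(of_int (2 * v p + d * S') :: rat) \<le> of_int (2 * d * A')"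
    using main unfolding S'_def by (simp only: of_int_le_iff)
  then show "2 * of_int (ord_at E (F k)) + of_int d * S \<le> 2 * of_int d * A"
    by (simp add: p A' S')
qed

end

section \<open>Log canonicity\<close>

lemma anticanonical_systemE:
  assumes D: "D \<in> anticanonical_system S4 P2 (boundary \<gamma>)"
  obtains n g d where "equivariant_divisor D n g d" "of_int d = of_nat n * (3 - 4 * \<gamma>)"
proof -
  from D have D': "\<forall>E. 0 \<le> D E" "invariant_div S4 P2 D"
    "q_lin_equiv P2 D (\<lambda>F. - canonical_div P2 F - boundary \<gamma> F)"
    by (auto simp: anticanonical_system_def)
  then obtain n\<^sub>0 f where nf: "n\<^sub>0 > 0" "f \<noteq> 0" "\<And>E. E \<in> prime_divisors P2 \<Longrightarrow>
      of_nat n\<^sub>0 * (D E - (- canonical_div P2 E - boundary \<gamma> E)) = of_int (ord_at E f)"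
    unfolding q_lin_equiv_def by blast
  obtain r s where rs: "quotient_of \<gamma> = (r, s)" by fastforce
  have s: "s > 0" using quotient_of_denom_pos[OF rs] .
  have \<gamma>: "\<gamma> = of_int r / of_int s" using quotient_of_div[OF rs] .
  define n where "n = n\<^sub>0 * nat s"
  \<comment> \<open>With \<open>n = n\<^sub>0 * s\<close> the divisor of \<open>f powi s\<close> is
    \<open>n * (D + K + B)\<close>. The product of the four forms removes \<open>n * B\<close>,
    because \<open>n * \<gamma> = n\<^sub>0 * r\<close>; the remaining multiples of
    \<open>hyperplane_ord\<close> add up to \<open>d\<close>.\<close>
  define g where "g = f powi s / (\<Prod>i\<in>{0..3}. coord i) powi (int n\<^sub>0 * r)"
  define d where "d = 3 * int n - 4 * (int n\<^sub>0 * r)"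
  have n_s: "int n = int n\<^sub>0 * s" using s by (simp add: n_def)
  have c0: "(\<Prod>i\<in>{0..3}. coord i) \<noteq> 0" using coord_nonzero_all by (simp add: prod_zero_iff)
  have n\<gamma>: "of_nat n * \<gamma> = of_int (int n\<^sub>0 * r)"
    using s by (simp add: \<gamma> n_def)
  have "equivariant_divisor D n g d"
  proof
    show "0 < n" using nf(1) s by (simp add: n_def)
    show "g \<noteq> 0" using nf(2) c0 by (simp add: g_def power_int_not_zero)
    fix E assume E: "E \<in> prime_divisors P2"
    then have dvr: "is_dvr E" by (simp add: prime_divisors_def)
    define C where "C = (\<Sum>i\<in>{0..3::nat}. ord_at E (coord i))"
    have B: "boundary \<gamma> E = \<gamma> * of_int (C - 4 * hyperplane_ord E)"
      by (simp add: boundary_eq[OF E] C_def sum_subtractf)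
    have "ord_at E (\<Prod>i\<in>{0..3}. coord i) = C"
      unfolding C_def by (rule ord_at_prod[OF dvr]) (rule coord_nonzero_all)
    then have "ord_at E g = s * ord_at E f - int n\<^sub>0 * r * C"
      using nf(2) c0 by (simp add: g_def ord_at_divide[OF dvr] ord_at_power_int[OF dvr] power_int_not_zero)
    then have "(of_int (ord_at E g) :: rat) = of_int s * of_int (ord_at E f) - of_int (int n\<^sub>0 * r) * of_int C"
      by simp
    moreover have "of_nat n * D E = of_int s * of_int (ord_at E f)
        - 3 * of_nat n * of_int (hyperplane_ord E) - of_nat n * \<gamma> * of_int (C - 4 * hyperplane_ord E)"
    proof -
      have "of_int s * (of_nat n\<^sub>0 * (D E + 3 * of_int (hyperplane_ord E) + \<gamma> * of_int (C - 4 * hyperplane_ord E)))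
          = of_int s * of_int (ord_at E f)"
        using nf(3)[OF E] unfolding canonical_div_P2[OF E] B by (simp add: algebra_simps)
      moreover have "(of_nat n :: rat) = of_nat n\<^sub>0 * of_int s" using s by (simp add: n_def)
      ultimately show ?thesis by (simp add: algebra_simps)
    qed
    ultimately show "of_nat n * D E = of_int (ord_at E g - d * hyperplane_ord E)"
      unfolding n\<gamma> by (simp add: d_def algebra_simps)
  qed (use D' in auto)
  moreover have "of_int d = of_nat n * (3 - 4 * \<gamma>)"
    using n\<gamma> by (simp add: d_def algebra_simps)
  ultimately show ?thesis using that by blast
qed

context equivariant_divisor
begin

lemma log_discrepancy_bound:
  assumes \<gamma>: "0 \<le> \<gamma>" "\<gamma> \<le> 1" and d: "of_int d = of_nat n * (3 - 4 * \<gamma>)"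
    and t: "0 \<le> t" "t * (3 - 4 * \<gamma>) \<le> 1" "t * (3 - 4 * \<gamma>) \<le> 2 * (1 - \<gamma>)"
    and X: "variety X" and E: "E \<in> prime_divisors X" and k: "k \<in> {1, 2, 3}" "chart_ring k \<subseteq> E"
    and S_def: "S = (\<Sum>i\<in>{0..3}. of_int (ord_at E (coord i) - ord_at E (coord k)))"
  shows "3 * of_int (ord_at E (coord k)) + \<gamma> * S + t / of_nat n * of_int (ord_at E (F k))
      \<le> 1 + canonical_div X E"
proof -
  define A where "A = 1 + canonical_div X E - 3 * of_int (ord_at E (coord k))"
  note b = divisor_bound[OF X E k S_def A_def]
  define V :: rat where "V = of_int (ord_at E (F k))"
  have "\<gamma> * S + t / of_nat n * V \<le> A"
  proof (cases "d = 0")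
    \<comment> \<open>This is \<open>\<gamma> = 3/4\<close>, where \<open>D\<close> has degree 0 and
      \<open>V\<close> is squeezed between 0 and \<open>d * A\<close>. A negative \<open>d\<close>,
      that is \<open>\<gamma> > 3/4\<close>, is excluded by \<open>b(1)\<close>.\<close>
    case True
    then have "V = 0" using b(4,5) by (simp add: V_def)
    moreover have "\<gamma> * S \<le> S" using b(2) \<gamma> by (simp add: mult_left_le_one_le)
    ultimately show ?thesis using b(3) by simp
  next
    case False
    then have dpos: "0 < (of_int d :: rat)" using b(1) by simp
    \<comment> \<open>The degree of \<open>t * D\<close>, since \<open>d / n\<close> is the degree
      of \<open>D\<close>.\<close>
    define \<delta> where "\<delta> = t * (3 - 4 * \<gamma>)"
    have n0: "0 < (of_nat n :: rat)" using n_pos by simp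
    have g0: "0 < 3 - 4 * \<gamma>" using dpos n0 unfolding d by (simp add: zero_less_mult_iff)
    have "t / of_nat n = \<delta> / of_int d" unfolding d \<delta>_def using g0 n0 by (simp add: field_simps)
    moreover have "2 * V / of_int d \<le> 2 * A - S"
      unfolding pos_divide_le_eq[OF dpos] using b(6) by (simp add: V_def algebra_simps)
    moreover have \<delta>0: "0 \<le> \<delta>" using t(1) g0 by (simp add: \<delta>_def)
    ultimately have 1: "2 * (t / of_nat n * V) \<le> \<delta> * (2 * A - S)"
      using mult_left_mono[of "2 * V / of_int d" "2 * A - S" \<delta>] by (simp add: mult_ac)
    have A0: "0 \<le> A" using b(2,3) by linarith
    have le: "\<delta> \<le> 1" using t(2) unfolding \<delta>_def .
    have "\<delta> \<le> 2 * (1 - \<gamma>)" using t(3) unfolding \<delta>_def .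
    then have le': "2 * \<gamma> + \<delta> \<le> 2" by (simp add: algebra_simps)
    have eq: "2 * (\<gamma> * S) + \<delta> * (2 * A - S) = (2 * \<gamma> - \<delta>) * S + 2 * (\<delta> * A)"
      by (simp add: algebra_simps)
    have "2 * (\<gamma> * S) + \<delta> * (2 * A - S) \<le> 2 * A"
    proof (cases "0 \<le> 2 * \<gamma> - \<delta>")
      case True
      then have "(2 * \<gamma> - \<delta>) * S \<le> (2 * \<gamma> - \<delta>) * A" using b(3) by (intro mult_left_mono)
      moreover have "(2 * \<gamma> + \<delta>) * A \<le> 2 * A" using le' A0 by (intro mult_right_mono)
      ultimately show ?thesis unfolding eq by (simp add: algebra_simps)
    next
      case False
      then have "(2 * \<gamma> - \<delta>) * S \<le> 0" using b(2) by (intro mult_nonpos_nonneg) auto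
      moreover have "\<delta> * A \<le> 1 * A" using le A0 by (intro mult_right_mono)
      ultimately show ?thesis unfolding eq by simp
    qed
    with 1 show ?thesis by linarith
  qed
  then show ?thesis by (simp add: A_def V_def)
qed

end

section \<open>Support and sign of the boundary\<close>

lemma finite_line_support:
  assumes k: "k \<in> {1, 2, 3}" and i: "i \<in> {0..3}"
  shows "finite {E \<in> Spec (chart_ring k). is_dvr E \<and> ord_at E (coord i) \<noteq> ord_at E (coord k)}"
proof (cases "i = k")
  case False
  have k3: "k \<in> {0..3}" using k by auto
  obtain b where b: "b \<in> {0..3}" "distinct [i, b, k]" using chart_indices[OF k i False] .
  interpret chart "frame i / frame k" "frame b / frame k" by (rule chart_frame[OF i b(1) k3 b(2)])
  have ring: "ring = chart_ring k" by (rule chart_ring_eq[OF i b(1) k b(2)])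
  have "E = prime_ring polyX"
    if E: "E \<in> Spec (chart_ring k)" "is_dvr E" "ord_at E (coord i) \<noteq> ord_at E (coord k)" for E
  proof (rule prime_divisor_eq_prime_ring[OF E(2) _ prime_elem_polyX])
    have nz: "frame i / frame k \<noteq> 0" using frame_nonzero i k3 by simp
    have "ord_at E (frame i / frame k) \<noteq> 0"
      using E(3) frame_nonzero[OF i] frame_nonzero[OF k3]
      by (simp add: ord_at_divide[OF E(2)] ord_at_frame[OF E(2)])
    moreover have "frame i / frame k \<in> E"
      using frame_in_chart_ring[OF k i] Spec_subset[OF subalgebra_chart_ring E(1)] by blast
    ultimately show "ev (frame i / frame k) (frame b / frame k) polyX \<in> maxideal E"
      using mem_dvr_iff[OF E(2) nz] maxideal_dvr_iff[OF E(2) nz] by simp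
  qed (use E ring in simp)
  then have "{E \<in> Spec (chart_ring k). is_dvr E \<and> ord_at E (coord i) \<noteq> ord_at E (coord k)}
      \<subseteq> {prime_ring polyX}" by blast
  then show ?thesis by (rule finite_subset) simp
qed simp

lemma finite_boundary_support: "finite {E. boundary \<gamma> E \<noteq> 0}"
proof (rule finite_subset)
  show "finite (\<Union>k\<in>{1, 2, 3}. \<Union>i\<in>{0..3}.
      {E \<in> Spec (chart_ring k). is_dvr E \<and> ord_at E (coord i) \<noteq> ord_at E (coord k)})"
    by (intro finite_UN_I finite_line_support) auto
  show "{E. boundary \<gamma> E \<noteq> 0} \<subseteq> (\<Union>k\<in>{1, 2, 3}. \<Union>i\<in>{0..3}.
      {E \<in> Spec (chart_ring k). is_dvr E \<and> ord_at E (coord i) \<noteq> ord_at E (coord k)})"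
  proof
    fix E assume "E \<in> {E. boundary \<gamma> E \<noteq> 0}"
    then have nz: "boundary \<gamma> E \<noteq> 0" by simp
    then have E: "E \<in> prime_divisors P2" using boundary_outside by blast
    then have dvr: "is_dvr E" and "E \<in> P2" by (simp_all add: prime_divisors_def)
    then obtain k where k: "k \<in> {1, 2, 3}" "E \<in> Spec (chart_ring k)" "chart_ring k \<subseteq> E"
      using P2_chart by blast
    have "\<exists>i\<in>{0..3}. ord_at E (coord i) \<noteq> hyperplane_ord E"
      using nz unfolding boundary_eq[OF E] by (rule contrapos_np) simp
    then show "E \<in> (\<Union>k\<in>{1, 2, 3}. \<Union>i\<in>{0..3}.
        {E \<in> Spec (chart_ring k). is_dvr E \<and> ord_at E (coord i) \<noteq> ord_at E (coord k)})"
      using k dvr hyperplane_ord_chart[OF dvr k(1,3)] by auto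
  qed
qed

lemma boundary_nonneg:
  assumes "0 \<le> \<gamma>"
  shows "0 \<le> boundary \<gamma> E"
proof (cases "E \<in> prime_divisors P2")
  case True
  then have dvr: "is_dvr E" and "E \<in> P2" by (simp_all add: prime_divisors_def)
  then obtain k where k: "k \<in> {1, 2, 3}" "chart_ring k \<subseteq> E" using P2_chart by blast
  have k3: "k \<in> {0..3}" using k(1) by auto
  have "hyperplane_ord E \<le> ord_at E (coord i)" if i: "i \<in> {0..3}" for i
  proof -
    have nz: "frame i / frame k \<noteq> 0" using frame_nonzero i k3 by simp
    have "frame i / frame k \<in> E" using frame_in_chart_ring[OF k(1) i] k(2) by blast
    then have "0 \<le> ord_at E (frame i / frame k)" using mem_dvr_iff[OF dvr nz] by simp
    then show ?thesis
      using frame_nonzero[OF i] frame_nonzero[OF k3] hyperplane_ord_chart[OF dvr k]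
      by (simp add: ord_at_divide[OF dvr] ord_at_frame[OF dvr])
  qed
  then show ?thesis
    unfolding boundary_eq[OF True] using assms by (intro mult_nonneg_nonneg sum_nonneg) simp_all
qed (simp add: boundary_outside)

text \<open>The centre is unique by separatedness. If \<open>f\<close> and \<open>f'\<close> are
  equations of \<open>n * D\<close> and \<open>n' * D\<close> there, then
  \<open>f ^ n' / f' ^ n\<close> has order 0 along every prime divisor through the centre; without
  zeros and poles it is a unit of \<open>R\<close>, hence of \<open>E\<close>.\<close>

lemma pullback_coeff_eq:
  assumes E: "is_dvr E" and R: "R \<in> P2" "dominates E R"
    and f: "0 < n" "local_equation P2 D R n f"
  shows "pullback_coeff P2 D E = of_int (ord_at E f) / of_nat n"
  unfolding pullback_coeff_def
proof (rule the_equality)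
  fix r :: rat assume "\<exists>R\<in>P2. dominates E R \<and>
    (\<exists>n f. n > 0 \<and> local_equation P2 D R n f \<and> r = of_int (ord_at E f) / of_nat n)"
  then obtain R' n' f' where R': "R' \<in> P2" "dominates E R'" and f': "0 < n'" "local_equation P2 D R' n' f'"
    and r: "r = of_int (ord_at E f') / of_nat n'" by blast
  have "R' = R"
    using variety_P2 valuation_ring_dvr[OF E] R R' unfolding variety_def by blast
  have nz: "f \<noteq> 0" "f' \<noteq> 0" using f(2) f'(2) by (simp_all add: local_equation_def)
  define h where "h = f ^ n' / f' ^ n"
  have h0: "h \<noteq> 0" "inverse h \<noteq> 0" using nz by (simp_all add: h_def)
  have oh: "ord_at G h = int n' * ord_at G f - int n * ord_at G f'" if "is_dvr G" for G
    using nz by (simp add: h_def ord_at_divide[OF that] ord_at_power[OF that])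
  have zero: "ord_at G h = 0" if G: "G \<in> prime_divisors P2" "R \<subseteq> G" for G
  proof -
    have dvr: "is_dvr G" using G(1) by (simp add: prime_divisors_def)
    have "(of_int (ord_at G f) :: rat) = of_nat n * D G" "(of_int (ord_at G f') :: rat) = of_nat n' * D G"
      using f(2) f'(2) G \<open>R' = R\<close> by (simp_all add: local_equation_def)
    then have "(of_int (int n' * ord_at G f) :: rat) = of_int (int n * ord_at G f')" by simp
    then have "int n' * ord_at G f = int n * ord_at G f'" by (simp only: of_int_eq_iff)
    then show ?thesis by (simp add: oh[OF dvr])
  qed
  have "h \<in> R" by (rule mem_local_ring_if_ord_nonneg[OF R(1) h0(1)]) (simp add: zero)
  moreover have "inverse h \<in> R"
  proof (rule mem_local_ring_if_ord_nonneg[OF R(1) h0(2)])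
    fix G assume G: "G \<in> prime_divisors P2" "R \<subseteq> G"
    then have "is_dvr G" by (simp add: prime_divisors_def)
    then show "0 \<le> ord_at G (inverse h)" using zero[OF G] h0 by (simp add: ord_at_inverse)
  qed
  ultimately have "h \<in> units_of_ring E"
    using R(2) h0 by (auto simp: units_of_ring_def dominates_def)
  then have "int n' * ord_at E f = int n * ord_at E f'" using ord_at_unit[OF E] oh[OF E] by simp
  then have "(of_int (int n' * ord_at E f) :: rat) = of_int (int n * ord_at E f')" by simp
  then show "r = of_int (ord_at E f) / of_nat n" unfolding r using f(1) f'(1) by (simp add: field_simps)
qed (use R f in blast)

lemma nat_multiple_int:
  fixes x :: rat
  obtains N m where "0 < N" "of_nat N * x = of_int m"
proof -
  obtain r s where rs: "quotient_of x = (r, s)" by fastforce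
  show ?thesis
  proof (rule that)
    show "0 < nat s" using quotient_of_denom_pos[OF rs] by simp
    then show "of_nat (nat s) * x = of_int r" using quotient_of_div[OF rs] by simp
  qed
qed

context equivariant_divisor
begin

lemma local_equation_exists:
  fixes \<gamma> t :: rat
  obtains N f where "0 < N" "\<And>k. k \<in> {1, 2, 3} \<Longrightarrow> f k \<noteq> 0"
    "\<And>k E. k \<in> {1, 2, 3} \<Longrightarrow> is_dvr E \<Longrightarrow> of_int (ord_at E (f k)) =
      of_nat N * (3 * of_int (ord_at E (coord k)) +
        \<gamma> * (\<Sum>i\<in>{0..3}. of_int (ord_at E (coord i) - ord_at E (coord k))) +
        t / of_nat n * of_int (ord_at E (F k)))"
proof -
  obtain N\<^sub>1 m\<^sub>1 where 1: "0 < N\<^sub>1" "of_nat N\<^sub>1 * \<gamma> = of_int m\<^sub>1" by (rule nat_multiple_int[of \<gamma>])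
  obtain N\<^sub>2 m\<^sub>2 where 2: "0 < N\<^sub>2" "of_nat N\<^sub>2 * (t / of_nat n) = of_int m\<^sub>2"
    by (rule nat_multiple_int[of "t / of_nat n"])
  define N where "N = N\<^sub>1 * N\<^sub>2"
  define p q where "p = int N\<^sub>2 * m\<^sub>1" and "q = int N\<^sub>1 * m\<^sub>2"
  have pq: "of_int p = of_nat N * \<gamma>" "of_int q = of_nat N * (t / of_nat n)"
    by (simp_all add: p_def q_def N_def flip: 1(2) 2(2))
  \<comment> \<open>The three factors are equations for multiples of the canonical divisor, of the
    boundary and of \<open>t * D\<close>; \<open>N\<close> clears the denominators of
    \<open>\<gamma>\<close> and \<open>t / n\<close>. The order is computed for every discrete
    valuation ring, so that it serves both on the plane and for pullbacks.\<close>
  define f where "f k = coord k powi (3 * int N) * (\<Prod>i\<in>{0..3}. coord i / coord k) powi p * F k powi q" for k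
  show ?thesis
  proof (rule that[of N f])
    show "0 < N" using 1 2 by (simp add: N_def)
    fix k assume k: "k \<in> {1, 2, 3::nat}"
    have k0: "coord k \<noteq> 0" by (rule coord_nonzero[OF k])
    have P0: "(\<Prod>i\<in>{0..3}. coord i / coord k) \<noteq> 0" using coord_nonzero_all k0 by (simp add: prod_zero_iff)
    have nz: "coord k powi (3 * int N) \<noteq> 0" "(\<Prod>i\<in>{0..3}. coord i / coord k) powi p \<noteq> 0" "F k powi q \<noteq> 0"
      using k0 P0 F_nonzero[OF k] by (simp_all only: power_int_not_zero not_False_eq_True simp_thms)
    show "f k \<noteq> 0" unfolding f_def using nz by simp
    fix E assume E: "is_dvr E"
    have "ord_at E (\<Prod>i\<in>{0..3}. coord i / coord k) = (\<Sum>i\<in>{0..3}. ord_at E (coord i / coord k))"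
      using coord_nonzero_all k0 by (intro ord_at_prod[OF E]) simp
    also have "\<dots> = (\<Sum>i\<in>{0..3}. ord_at E (coord i) - ord_at E (coord k))"
      using coord_nonzero_all k0 by (intro sum.cong refl) (simp add: ord_at_divide[OF E])
    finally have P: "ord_at E (\<Prod>i\<in>{0..3}. coord i / coord k) =
        (\<Sum>i\<in>{0..3}. ord_at E (coord i) - ord_at E (coord k))" .
    have "ord_at E (f k) = 3 * int N * ord_at E (coord k)
        + p * (\<Sum>i\<in>{0..3}. ord_at E (coord i) - ord_at E (coord k)) + q * ord_at E (F k)"
      unfolding f_def P[symmetric] using nz k0 P0 F_nonzero[OF k]
      by (simp only: ord_at_mult[OF E] mult_eq_0_iff ord_at_power_int[OF E] simp_thms)
    then have "(of_int (ord_at E (f k)) :: rat) = of_int (3 * int N * ord_at E (coord k)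
        + p * (\<Sum>i\<in>{0..3}. ord_at E (coord i) - ord_at E (coord k)) + q * ord_at E (F k))"
      by (simp only:)
    also have "\<dots> = 3 * of_nat N * of_int (ord_at E (coord k))
        + of_int p * (\<Sum>i\<in>{0..3}. of_int (ord_at E (coord i) - ord_at E (coord k)))
        + of_int q * of_int (ord_at E (F k))"
      by (simp only: of_int_add of_int_mult of_int_sum of_int_of_nat_eq of_int_numeral)
    finally show "of_int (ord_at E (f k)) =
      of_nat N * (3 * of_int (ord_at E (coord k)) +
        \<gamma> * (\<Sum>i\<in>{0..3}. of_int (ord_at E (coord i) - ord_at E (coord k))) +
        t / of_nat n * of_int (ord_at E (F k)))"
      unfolding pq by (simp only: distrib_left mult_ac)
  qed
qed

lemma log_pair_and_log_canonical:
  assumes \<gamma>: "0 \<le> \<gamma>" "\<gamma> \<le> 1" and d: "of_int d = of_nat n * (3 - 4 * \<gamma>)"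
    and t: "0 \<le> t" "t * (3 - 4 * \<gamma>) \<le> 1" "t * (3 - 4 * \<gamma>) \<le> 2 * (1 - \<gamma>)"
    and D: "q_divisor P2 D"
  shows "log_pair P2 (\<lambda>F. boundary \<gamma> F + t * D F)"
    and "log_canonical P2 (\<lambda>F. boundary \<gamma> F + t * D F)"
proof -
  let ?M = "\<lambda>E. canonical_div P2 E + (boundary \<gamma> E + t * D E)"
  let ?L = "\<lambda>E k. 3 * of_int (ord_at E (coord k)) +
        \<gamma> * (\<Sum>i\<in>{0..3}. of_int (ord_at E (coord i) - ord_at E (coord k))) +
        t / of_nat n * of_int (ord_at E (F k)) :: rat"
  have M: "?M E = ?L E k" if E: "E \<in> prime_divisors P2" and k: "k \<in> {1, 2, 3}" "chart_ring k \<subseteq> E" for E k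
  proof -
    have dvr: "is_dvr E" using E by (simp add: prime_divisors_def)
    show ?thesis
      using n_pos unfolding canonical_div_P2[OF E] boundary_eq[OF E] hyperplane_ord_chart[OF dvr k]
        ord_at_F_P2[OF E k] by simp
  qed
  show "log_pair P2 (\<lambda>F. boundary \<gamma> F + t * D F)"
    unfolding log_pair_def
  proof (intro conjI allI normal_variety_P2)
    have D_supp: "finite {E. D E \<noteq> 0}" "\<And>E. E \<notin> prime_divisors P2 \<Longrightarrow> D E = 0"
      using D by (auto simp: q_divisor_def)
    show "q_divisor P2 (\<lambda>F. boundary \<gamma> F + t * D F)"
      unfolding q_divisor_def
    proof
      show "finite {E. boundary \<gamma> E + t * D E \<noteq> 0}"
        by (rule finite_subset[OF _ finite_UnI[OF finite_boundary_support[of \<gamma>] D_supp(1)]]) auto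
    qed (use D_supp(2) boundary_outside in force)
    fix E
    show "0 \<le> boundary \<gamma> E + t * D E"
      using boundary_nonneg[OF \<gamma>(1)] t(1) D_nonneg by simp
    show "boundary \<gamma> E + t * D E \<le> 1"
    proof (cases "E \<in> prime_divisors P2")
      case True
      then have "E \<in> P2" by (simp add: prime_divisors_def)
      then obtain k where k: "k \<in> {1, 2, 3}" "chart_ring k \<subseteq> E" using P2_chart by blast
      \<comment> \<open>On the plane itself the canonical terms cancel, and the discrepancy bound
        says that the coefficient is at most 1.\<close>
      show ?thesis
        using log_discrepancy_bound[OF \<gamma> d t variety_P2 True k refl] M[OF True k] by linarith
    qed (simp add: D_supp(2) boundary_outside)
  qed
  obtain N f where N: "0 < N" and f0: "\<And>k. k \<in> {1, 2, 3} \<Longrightarrow> f k \<noteq> 0"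
    and f: "\<And>k E. k \<in> {1, 2, 3} \<Longrightarrow> is_dvr E \<Longrightarrow> of_int (ord_at E (f k)) = of_nat N * ?L E k"
    using local_equation_exists[of \<gamma> t] by blast
  have leq: "local_equation P2 ?M R N (f k)" if k: "k \<in> {1, 2, 3}" "chart_ring k \<subseteq> R" for R k
    unfolding local_equation_def
  proof (intro conjI ballI impI)
    show "f k \<noteq> 0" by (rule f0[OF k(1)])
    fix G assume G: "G \<in> prime_divisors P2" "R \<subseteq> G"
    then have "is_dvr G" "chart_ring k \<subseteq> G" using k(2) by (auto simp: prime_divisors_def)
    then show "of_int (ord_at G (f k)) = of_nat N * ?M G" using f[OF k(1)] M[OF G(1) k(1)] by simp
  qed
  show "log_canonical P2 (\<lambda>F. boundary \<gamma> F + t * D F)"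
    unfolding log_canonical_def
  proof (intro conjI allI impI ballI)
    show "q_cartier P2 ?M"
      unfolding q_cartier_def
    proof (intro exI[of _ N] conjI ballI N)
      fix R assume "R \<in> P2"
      then obtain k where "k \<in> {1, 2, 3}" "chart_ring k \<subseteq> R" using P2_chart by blast
      then show "\<exists>f. local_equation P2 ?M R N f" using leq by blast
    qed
    fix X E assume X: "log_resolution X P2 (\<lambda>F. boundary \<gamma> F + t * D F)" and E: "E \<in> prime_divisors X"
    have var: "variety X" using X by (simp add: log_resolution_def)
    have dvr: "is_dvr E" "E \<in> X" using E by (simp_all add: prime_divisors_def)
    then obtain R where R: "R \<in> P2" "dominates E R"
      using X by (auto simp: log_resolution_def proper_birational_def)
    obtain k where k: "k \<in> {1, 2, 3}" "chart_ring k \<subseteq> R" using P2_chart[OF R(1)] by blast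
    have kE: "chart_ring k \<subseteq> E" using k(2) R(2) by (auto simp: dominates_def)
    have "pullback_coeff P2 ?M E = of_int (ord_at E (f k)) / of_nat N"
      by (rule pullback_coeff_eq[OF dvr(1) R N leq[OF k]])
    also have "\<dots> = ?L E k" using f[OF k(1) dvr(1)] N by simp
    finally show "pullback_coeff P2 ?M E - canonical_div X E \<le> 1"
      using log_discrepancy_bound[OF \<gamma> d t var E k(1) kE refl] by linarith
  qed
qed

end

text \<open>One statement for all ranges of \<open>\<gamma>\<close>: they differ in which upper
  condition on \<open>t\<close> is binding, and from \<open>3/4\<close> on none is.\<close>

lemma glct_ge:
  assumes \<gamma>: "0 \<le> \<gamma>" "\<gamma> \<le> 1"
    and t: "0 \<le> t" "t * (3 - 4 * \<gamma>) \<le> 1" "t * (3 - 4 * \<gamma>) \<le> 2 * (1 - \<gamma>)"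
  shows "ereal (of_rat t) \<le> glct S4 P2 (boundary \<gamma>)"
  unfolding glct_def
proof (intro Sup_upper CollectI exI[of _ t] conjI refl ballI)
  fix D assume D: "D \<in> anticanonical_system S4 P2 (boundary \<gamma>)"
  then have q: "q_divisor P2 D" by (simp add: anticanonical_system_def)
  obtain n g d where "equivariant_divisor D n g d" "of_int d = of_nat n * (3 - 4 * \<gamma>)"
    using anticanonical_systemE[OF D] .
  then show "log_pair P2 (\<lambda>F. boundary \<gamma> F + t * D F)" "log_canonical P2 (\<lambda>F. boundary \<gamma> F + t * D F)"
    using equivariant_divisor.log_pair_and_log_canonical \<gamma> t q by blast+
qed

theorem lemma1p7:
  fixes \<gamma> :: rat
  assumes "0 \<le> \<gamma>" and "\<gamma> \<le> 1"
  shows "(\<gamma> \<le> 1/2 \<longrightarrow> glct S4 P2 (boundary \<gamma>) \<ge> ereal (of_rat (1 / (3 - 4 * \<gamma>)))) \<and>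
         (1/2 \<le> \<gamma> \<and> \<gamma> < 3/4 \<longrightarrow>
            glct S4 P2 (boundary \<gamma>) \<ge> ereal (of_rat (2 * (1 - \<gamma>) / (3 - 4 * \<gamma>)))) \<and>
         (3/4 \<le> \<gamma> \<longrightarrow> glct S4 P2 (boundary \<gamma>) \<ge> \<infinity>)"
proof (intro conjI impI)
  assume "\<gamma> \<le> 1/2"
  then have "0 < 3 - 4 * \<gamma>" by simp
  then show "ereal (of_rat (1 / (3 - 4 * \<gamma>))) \<le> glct S4 P2 (boundary \<gamma>)"
    using \<open>\<gamma> \<le> 1/2\<close> by (intro glct_ge assms) simp_all
next
  assume \<gamma>: "1/2 \<le> \<gamma> \<and> \<gamma> < 3/4"
  then have "0 < 3 - 4 * \<gamma>" by simp
  then show "ereal (of_rat (2 * (1 - \<gamma>) / (3 - 4 * \<gamma>))) \<le> glct S4 P2 (boundary \<gamma>)"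
    using \<gamma> assms by (intro glct_ge assms) simp_all
next
  assume \<gamma>: "3/4 \<le> \<gamma>"
  have "ereal x \<le> glct S4 P2 (boundary \<gamma>)" for x
  proof -
    \<comment> \<open>Since \<open>3 - 4 * \<gamma>\<close> is not positive, every natural number is
      an admissible \<open>t\<close>, which makes the supremum exceed every real.\<close>
    obtain m where m: "x \<le> real m" using real_arch_simple by blast
    have "(of_nat m :: rat) * (3 - 4 * \<gamma>) \<le> 0" using \<gamma> by (intro mult_nonneg_nonpos) simp_all
    then have "of_nat m * (3 - 4 * \<gamma>) \<le> 1" "of_nat m * (3 - 4 * \<gamma>) \<le> 2 * (1 - \<gamma>)"
      using assms(2) by (auto elim: order_trans)
    then have "ereal (of_rat (of_nat m)) \<le> glct S4 P2 (boundary \<gamma>)"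
      by (intro glct_ge assms) simp_all
    then have "ereal (real m) \<le> glct S4 P2 (boundary \<gamma>)" by simp
    with m show ?thesis by (meson ereal_less_eq(3) order_trans)
  qed
  then show "\<infinity> \<le> glct S4 P2 (boundary \<gamma>)" using ereal_top by simp
qed

end
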